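(* Let $\mathcal{R}$ be any (commutative, unital) ring of coefficients. For every link diagram $D$ and all $i,j$, the short exact sequence of Khovanov homology (with coefficients in $\mathcal{R}$) $$0\to H_{i+2,j+4}(D)\xrightarrow{\alpha_h}H_{i,j}(D\#D_h)\xrightarrow{\beta_h}H_{i-2,j-4}(D)\to 0$$ splits, so that $$H_{i,j}(D\#D_h)=H_{i+2,j+4}(D)\oplus H_{i-2,j-4}(D).$$ Here $D\#D_h$ is the connected sum of $D$ with the Hopf link diagram $D_h$. The map $\alpha_h$ is induced by sending an enhanced state $S$ of $D$ to the enhanced state of $D\#D_h$ which has negative markers at both crossings of the added Hopf link, agrees with $S$ at the crossings of $D$ and on the circles coming from $D_S$, and has negative sign on the one extra circle. The map $\beta_h$ is induced by sending an enhanced state of $D\#D_h$ having positive markers at both crossings of the added Hopf link and positive sign on the extra circle to the enhanced state of $D$ obtained by deleting the extra circle, and all other enhanced states to $0$.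
   Context: Khovanov homology (framed unoriented version). A link diagram $D$ is a diagram on the disc of an unoriented framed link in the 3-ball. A Kauffman state $s$ of $D$ assigns to each crossing a marker $+1$ or $-1$. The smoothing of a crossing given by a positive marker joins the two regions swept out when the over-strand is rotated counterclockwise towards the under-strand (Kauffman's $A$-smoothing); a negative marker gives the other smoothing. $D_s$ is the system of circles obtained by smoothing all crossings according to $s$, and $\sigma(s)$ is the number of positive markers minus the number of negative markers. An enhanced state $S$ is a Kauffman state $s$ with a sign $+$ or $-$ assigned to each circle of $D_s$; $D_S=D_s$, $\sigma(S)=\sigma(s)$, and $\tau(S)$ is the number of positive circles minus the number of negative circles. $\mathcal{C}_{i,j}(D)$ is the free abelian group (with coefficients in $\mathcal{R}$: the free $\mathcal{R}$-module) on the enhanced states $S$ with $\sigma(S)=i$ and $\sigma(S)+2\tau(S)=j$. After ordering the crossings, $d_{i,j}:\mathcal{C}_{i,j}(D)\to\mathcal{C}_{i-2,j}(D)$ is $d(S)=\sum_{S'}(-1)^{t(S:S')}[S:S']S'$, summed over enhanced states $S'$ generating $\mathcal{C}_{i-2,j}(D)$, where $[S:S']=1$ if the markers of $S$ and $S'$ differ at exactly one crossing $c$ and all circles of $D_S$ and $D_{S'}$ not touching $c$ have the same signs in $S$ and $S'$, and $[S:S']=0$ otherwise; $t(S:S')$ is the number of negative markers of $S$ at crossings bigger than $c$. $H_{i,j}(D)=\ker(d_{i,j})/d_{i+2,j}(\mathcal{C}_{i+2,j}(D))$. Hopf link addition. $D_h$ is the standard 2-crossing diagram of the Hopf link. $D\#D_h$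 is obtained from $D$ by choosing a non-crossing point of $D$ and adding a new small circle component meeting a short arc of $D$ around this point in exactly two crossings, passing over the arc at one of them and under it at the other. The two new crossings come first in the ordering of crossings, followed by the crossings of $D$ in their order. If the markers at the two new crossings are both positive or both negative, then the circles of the resulting smoothing of $D\#D_h$ are those of the corresponding smoothing of $D$ together with exactly one extra circle. *)

theory Defs
  imports "HOL-Combinatorics.Orbits" "HOL-Algebra.Module" "HOL-Algebra.AbelCoset"
begin

section \<open>Link diagrams\<close>

text \<open>
  Diagrams are planar diagram codes without orientations.  \<open>Crossing a b c d\<close> lists the four
  arcs at a crossing counterclockwise, starting with one of the two ends of the under-strand: the
  under-strand runs from \<open>a\<close> to \<open>c\<close>, the over-strand from \<open>b\<close> to \<open>d\<close>.  The list of crossings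
  carries the chosen ordering of the crossings.  An element of \<open>edges\<close> that occurs at no crossing
  is a crossingless component.
\<close>

datatype 'e crossing = Crossing 'e 'e 'e 'e

record 'e diagram =
  edges :: "'e set"
  crossings :: "'e crossing list"

fun ends :: "'e crossing \<Rightarrow> 'e list" where
  "ends (Crossing a b c d) = [a, b, c, d]"

text \<open>A dart \<open>(k, p)\<close> is the \<open>p\<close>-th of the four ends of arcs at the \<open>k\<close>-th crossing.\<close>

definition darts :: "'e diagram \<Rightarrow> (nat \<times> nat) set" where
  "darts D = {..<length (crossings D)} \<times> {..<4}"

definition edge_at :: "'e diagram \<Rightarrow> nat \<times> nat \<Rightarrow> 'e" where
  "edge_at D d = ends (crossings D ! fst d) ! snd d"

definition mate :: "'e diagram \<Rightarrow> nat \<times> nat \<Rightarrow> nat \<times> nat" where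
  "mate D d = (THE d'. d' \<in> darts D \<and> d' \<noteq> d \<and> edge_at D d' = edge_at D d)"

text \<open>
  Regions of the complement correspond to orbits of: cross to the other end of the arc, then turn
  counterclockwise to the next end at the crossing reached.
\<close>

definition face_step :: "'e diagram \<Rightarrow> nat \<times> nat \<Rightarrow> nat \<times> nat" where
  "face_step D d = (case mate D d of (k, p) \<Rightarrow> (k, (p + 1) mod 4))"

definition faces :: "'e diagram \<Rightarrow> (nat \<times> nat) set set" where
  "faces D = orbit (face_step D) ` darts D"

definition components :: "'e diagram \<Rightarrow> nat set set" where
  "components D = {..<length (crossings D)} //
     {(k, l). k < length (crossings D) \<and> l < length (crossings D) \<and>
        set_crossing (crossings D ! k) \<inter> set_crossing (crossings D ! l) \<noteq> {}}\<^sup>*"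

text \<open>
  Each connected component of the underlying 4-valent graph, with its cyclic orders at the vertices,
  has \<open>V - E + F \<le> 2\<close>, with equality iff it embeds in the sphere (hence in the disc), so
  the sum over all components detects planarity.  Without this condition one would obtain virtual
  link diagrams.
\<close>

definition planar :: "'e diagram \<Rightarrow> bool" where
  "planar D \<longleftrightarrow>
     int (length (crossings D)) - int (card (edge_at D ` darts D)) + int (card (faces D))
       = 2 * int (card (components D))"

definition link_diagram :: "'e diagram \<Rightarrow> bool" where
  "link_diagram D \<longleftrightarrow>
     finite (edges D) \<and> edge_at D ` darts D \<subseteq> edges D \<and>
     (\<forall>e \<in> edges D. card {d \<in> darts D. edge_at D d = e} \<in> {0, 2}) \<and>
     planar D"

section \<open>Kauffman states and enhanced states\<close>

text \<open>
  \<open>True\<close> is the positive marker.  Rotating the over-strand \<open>b\<close>--\<open>d\<close> counterclockwise sweeps out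
  the region between \<open>b\<close> and \<open>c\<close> and the one between \<open>d\<close> and \<open>a\<close>; joining these two regions
  leaves the arcs \<open>a\<close>--\<open>b\<close> and \<open>c\<close>--\<open>d\<close>.
\<close>

fun smoothing :: "bool \<Rightarrow> 'e crossing \<Rightarrow> ('e \<times> 'e) set" where
  "smoothing True (Crossing a b c d) = {(a, b), (c, d)}"
| "smoothing False (Crossing a b c d) = {(a, d), (b, c)}"

definition joined :: "'e diagram \<Rightarrow> bool list \<Rightarrow> ('e \<times> 'e) set" where
  "joined D s = (\<Union>k < length (crossings D). smoothing (s ! k) (crossings D ! k))"

text \<open>A circle of the smoothed diagram is represented by the set of arcs of the diagram on it.\<close>

definition circles :: "'e diagram \<Rightarrow> bool list \<Rightarrow> 'e set set" where
  "circles D s = edges D // (joined D s \<union> (joined D s)\<inverse>)\<^sup>*"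

definition kauffman_states :: "'e diagram \<Rightarrow> bool list set" where
  "kauffman_states D = {s. length s = length (crossings D)}"

text \<open>An enhanced state is a Kauffman state together with its set of positive circles.\<close>

type_synonym 'e enhanced_state = "bool list \<times> 'e set set"

definition enhanced_states :: "'e diagram \<Rightarrow> 'e enhanced_state set" where
  "enhanced_states D = {(s, P). s \<in> kauffman_states D \<and> P \<subseteq> circles D s}"

definition sigma :: "'e enhanced_state \<Rightarrow> int" where
  "sigma S = int (count_list (fst S) True) - int (count_list (fst S) False)"

definition tau :: "'e diagram \<Rightarrow> 'e enhanced_state \<Rightarrow> int" where
  "tau D S = int (card (snd S)) - int (card (circles D (fst S) - snd S))"

definition generators :: "'e diagram \<Rightarrow> int \<Rightarrow> int \<Rightarrow> 'e enhanced_state set" where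
  "generators D i j = {S \<in> enhanced_states D. sigma S = i \<and> sigma S + 2 * tau D S = j}"

section \<open>Modules\<close>

text \<open>
  Module records extend ring records; their fields \<open>mult\<close> and \<open>one\<close> play no role and are left
  \<open>undefined\<close> below.
\<close>

definition free_module :: "('r, 'm) ring_scheme \<Rightarrow> 'b set \<Rightarrow> ('r, 'b \<Rightarrow> 'r) module" where
  "free_module R B =
     \<lparr>carrier = B \<rightarrow>\<^sub>E carrier R, mult = undefined, one = undefined,
      zero = (\<lambda>b\<in>B. \<zero>\<^bsub>R\<^esub>), add = (\<lambda>x y. \<lambda>b\<in>B. x b \<oplus>\<^bsub>R\<^esub> y b),
      smult = (\<lambda>a x. \<lambda>b\<in>B. a \<otimes>\<^bsub>R\<^esub> x b)\<rparr>"

text \<open>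
  The linear map between the free modules on \<open>A\<close> and \<open>B\<close> sending each generator \<open>a\<close> to
  \<open>\<Sum>b. m a b b\<close>.
\<close>

definition linear_extension ::
  "('r, 'm) ring_scheme \<Rightarrow> 'a set \<Rightarrow> 'b set \<Rightarrow> ('a \<Rightarrow> 'b \<Rightarrow> 'r) \<Rightarrow> ('a \<Rightarrow> 'r) \<Rightarrow> ('b \<Rightarrow> 'r)" where
  "linear_extension R A B m x = (\<lambda>b\<in>B. \<Oplus>\<^bsub>R\<^esub>a\<in>A. m a b \<otimes>\<^bsub>R\<^esub> x a)"

definition quotient_module :: "('r, 'b) module \<Rightarrow> 'b set \<Rightarrow> ('r, 'b set) module" where
  "quotient_module M N =
     \<lparr>carrier = a_rcosets\<^bsub>M\<^esub> N, mult = undefined, one = undefined,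
      zero = N, add = set_add M,
      smult = (\<lambda>a X. \<Union>x\<in>X. N +>\<^bsub>M\<^esub> (a \<odot>\<^bsub>M\<^esub> x))\<rparr>"

definition direct_sum :: "('r, 'b) module \<Rightarrow> ('r, 'c) module \<Rightarrow> ('r, 'b \<times> 'c) module" where
  "direct_sum M N =
     \<lparr>carrier = carrier M \<times> carrier N, mult = undefined, one = undefined,
      zero = (\<zero>\<^bsub>M\<^esub>, \<zero>\<^bsub>N\<^esub>),
      add = (\<lambda>(x, y) (x', y'). (x \<oplus>\<^bsub>M\<^esub> x', y \<oplus>\<^bsub>N\<^esub> y')),
      smult = (\<lambda>a (x, y). (a \<odot>\<^bsub>M\<^esub> x, a \<odot>\<^bsub>N\<^esub> y))\<rparr>"

definition linear_maps ::
  "('r, 'm) ring_scheme \<Rightarrow> ('r, 'b) module \<Rightarrow> ('r, 'c) module \<Rightarrow> ('b \<Rightarrow> 'c) set" where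
  "linear_maps R M N =
     {f \<in> hom (add_monoid M) (add_monoid N).
        \<forall>a \<in> carrier R. \<forall>x \<in> carrier M. f (a \<odot>\<^bsub>M\<^esub> x) = a \<odot>\<^bsub>N\<^esub> f x}"

definition isomorphic_modules ::
  "('r, 'm) ring_scheme \<Rightarrow> ('r, 'b) module \<Rightarrow> ('r, 'c) module \<Rightarrow> bool" where
  "isomorphic_modules R M N \<longleftrightarrow>
     (\<exists>f \<in> linear_maps R M N. bij_betw f (carrier M) (carrier N))"

definition short_exact ::
  "('r, 'm) ring_scheme \<Rightarrow> ('r, 'a) module \<Rightarrow> ('a \<Rightarrow> 'b) \<Rightarrow> ('r, 'b) module \<Rightarrow> ('b \<Rightarrow> 'c) \<Rightarrow>
     ('r, 'c) module \<Rightarrow> bool" where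
  "short_exact R L f M g N \<longleftrightarrow>
     module R L \<and> module R M \<and> module R N \<and>
     f \<in> linear_maps R L M \<and> g \<in> linear_maps R M N \<and>
     inj_on f (carrier L) \<and> f ` carrier L = a_kernel M N g \<and> g ` carrier M = carrier N"

definition split_short_exact ::
  "('r, 'm) ring_scheme \<Rightarrow> ('r, 'a) module \<Rightarrow> ('a \<Rightarrow> 'b) \<Rightarrow> ('r, 'b) module \<Rightarrow> ('b \<Rightarrow> 'c) \<Rightarrow>
     ('r, 'c) module \<Rightarrow> bool" where
  "split_short_exact R L f M g N \<longleftrightarrow>
     short_exact R L f M g N \<and>
     (\<exists>s \<in> linear_maps R N M. \<forall>x \<in> carrier N. g (s x) = x)"

section \<open>Khovanov homology\<close>

abbreviation chains ::
  "('r, 'm) ring_scheme \<Rightarrow> 'e diagram \<Rightarrow> int \<Rightarrow> int \<Rightarrow> ('r, 'e enhanced_state \<Rightarrow> 'r) module" where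
  "chains R D i j \<equiv> free_module R (generators D i j)"

text \<open>
  \<open>adjacent D c S S'\<close>: the markers of \<open>S\<close> and \<open>S'\<close> differ exactly at \<open>c\<close>, and all circles not
  touching \<open>c\<close> have the same sign.
\<close>

definition adjacent ::
  "'e diagram \<Rightarrow> nat \<Rightarrow> 'e enhanced_state \<Rightarrow> 'e enhanced_state \<Rightarrow> bool" where
  "adjacent D c S S' \<longleftrightarrow>
     c < length (crossings D) \<and>
     (\<forall>k < length (crossings D). fst S ! k \<noteq> fst S' ! k \<longleftrightarrow> k = c) \<and>
     (\<forall>C \<in> circles D (fst S) \<union> circles D (fst S').
        C \<inter> set_crossing (crossings D ! c) = {} \<longrightarrow> (C \<in> snd S \<longleftrightarrow> C \<in> snd S'))"

definition negative_after :: "nat \<Rightarrow> 'e enhanced_state \<Rightarrow> nat" where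
  "negative_after c S = count_list (drop (Suc c) (fst S)) False"

definition incidence ::
  "('r, 'm) ring_scheme \<Rightarrow> 'e diagram \<Rightarrow> 'e enhanced_state \<Rightarrow> 'e enhanced_state \<Rightarrow> 'r" where
  "incidence R D S S' =
     (if \<exists>c. adjacent D c S S'
      then (\<ominus>\<^bsub>R\<^esub> \<one>\<^bsub>R\<^esub>) [^]\<^bsub>R\<^esub> negative_after (THE c. adjacent D c S S') S
      else \<zero>\<^bsub>R\<^esub>)"

definition boundary ::
  "('r, 'm) ring_scheme \<Rightarrow> 'e diagram \<Rightarrow> int \<Rightarrow> int \<Rightarrow>
     ('e enhanced_state \<Rightarrow> 'r) \<Rightarrow> ('e enhanced_state \<Rightarrow> 'r)" where
  "boundary R D i j =
     linear_extension R (generators D i j) (generators D (i - 2) j) (incidence R D)"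

definition cycles ::
  "('r, 'm) ring_scheme \<Rightarrow> 'e diagram \<Rightarrow> int \<Rightarrow> int \<Rightarrow> ('e enhanced_state \<Rightarrow> 'r) set" where
  "cycles R D i j = a_kernel (chains R D i j) (chains R D (i - 2) j) (boundary R D i j)"

definition boundaries ::
  "('r, 'm) ring_scheme \<Rightarrow> 'e diagram \<Rightarrow> int \<Rightarrow> int \<Rightarrow> ('e enhanced_state \<Rightarrow> 'r) set" where
  "boundaries R D i j = boundary R D (i + 2) j ` carrier (chains R D (i + 2) j)"

definition khovanov ::
  "('r, 'm) ring_scheme \<Rightarrow> 'e diagram \<Rightarrow> int \<Rightarrow> int \<Rightarrow>
     ('r, ('e enhanced_state \<Rightarrow> 'r) set) module" where
  "khovanov R D i j =
     quotient_module ((chains R D i j)\<lparr>carrier := cycles R D i j\<rparr>) (boundaries R D i j)"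

text \<open>
  The map into \<open>H\<^bsub>i,j\<^esub>(D)\<close> induced by a map \<open>f\<close> of chains: the class of \<open>x\<close> goes to the class of
  \<open>f x\<close>.  The union over all representatives is a homology class only if the latter does not depend
  on the choice of \<open>x\<close>.
\<close>

definition induced ::
  "('r, 'm) ring_scheme \<Rightarrow> 'e diagram \<Rightarrow> int \<Rightarrow> int \<Rightarrow> ('x \<Rightarrow> ('e enhanced_state \<Rightarrow> 'r)) \<Rightarrow>
     'x set \<Rightarrow> ('e enhanced_state \<Rightarrow> 'r) set" where
  "induced R D i j f X = (\<Union>x\<in>X. boundaries R D i j +>\<^bsub>chains R D i j\<^esub> f x)"

section \<open>Adding a Hopf link\<close>

text \<open>
  A non-crossing point on a diagram lies on a crossingless component or on an arc with two ends.
  In the latter case it is given by a dart, i.e. by the arc and a direction on it, towards the dart.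
\<close>

datatype 'e point = On_circle 'e | On_edge "nat \<times> nat"

fun point_of :: "'e diagram \<Rightarrow> 'e point \<Rightarrow> bool" where
  "point_of D (On_circle e) \<longleftrightarrow> e \<in> edges D - edge_at D ` darts D"
| "point_of D (On_edge d) \<longleftrightarrow> d \<in> darts D"

datatype 'e hopf_edge = Old 'e | Far | Mid | Upper | Lower

text \<open>
  Draw the arc horizontally from \<open>e\<close> in the west, through \<open>Mid\<close> inside the added circle, to \<open>f\<close> in
  the east; the added circle consists of \<open>Upper\<close> in the north and \<open>Lower\<close> in the south.  The flag
  says whether the added circle passes over the arc at the first (western) or at the second
  (eastern) crossing.
\<close>

fun hopf_crossings :: "bool \<Rightarrow> 'e hopf_edge \<Rightarrow> 'e hopf_edge \<Rightarrow> 'e hopf_edge crossing list" where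
  "hopf_crossings True e f = [Crossing e Lower Mid Upper, Crossing Upper Mid Lower f]"
| "hopf_crossings False e f = [Crossing Upper e Lower Mid, Crossing Mid Lower f Upper]"

fun replace_end :: "'e \<Rightarrow> nat \<Rightarrow> 'e crossing \<Rightarrow> 'e crossing" where
  "replace_end f p (Crossing a b c d) =
     Crossing (if p = 0 then f else a) (if p = 1 then f else b)
       (if p = 2 then f else c) (if p = 3 then f else d)"

text \<open>
  The arc \<open>e\<close> containing the point is cut: its end at the dart \<open>(k, p)\<close> is renamed to \<open>Far\<close>, the rest
  is still called \<open>e\<close>.  A crossingless component becomes a single arc from the first new crossing
  to the second.  The choice of direction on the arc and the flag together account for both orders
  of the two new crossings and for both choices of the crossing at which the added circle is over.
\<close>

fun hopf_sum :: "'e diagram \<Rightarrow> 'e point \<Rightarrow> bool \<Rightarrow> 'e hopf_edge diagram" where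
  "hopf_sum D (On_circle e) v =
     \<lparr>edges = Old ` edges D \<union> {Mid, Upper, Lower},
      crossings = hopf_crossings v (Old e) (Old e) @ map (map_crossing Old) (crossings D)\<rparr>"
| "hopf_sum D (On_edge (k, p)) v =
     \<lparr>edges = Old ` edges D \<union> {Far, Mid, Upper, Lower},
      crossings = hopf_crossings v (Old (edge_at D (k, p))) Far @
        (map (map_crossing Old) (crossings D))
          [k := replace_end Far p (map_crossing Old (crossings D ! k))]\<rparr>"

text \<open>
  Below, \<open>E\<close> is a Hopf sum of \<open>D\<close>.  If the two new crossings have equal markers, a circle
  \<open>C\<close> of \<open>D\<close> becomes the circle of \<open>E\<close> containing \<open>Old ` C\<close>, and the extra circle, which is the one
  containing \<open>Mid\<close>, contains no old arc.
\<close>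

definition add_hopf :: "'e hopf_edge diagram \<Rightarrow> 'e enhanced_state \<Rightarrow> 'e hopf_edge enhanced_state"
  where
  "add_hopf E S =
     (let s' = False # False # fst S
      in (s', {C' \<in> circles E s'. \<exists>C \<in> snd S. Old ` C \<subseteq> C'}))"

definition extra_positive :: "'e hopf_edge enhanced_state \<Rightarrow> bool" where
  "extra_positive S' \<longleftrightarrow> (\<exists>C' \<in> snd S'. Mid \<in> C')"

definition delete_hopf :: "'e diagram \<Rightarrow> 'e hopf_edge enhanced_state \<Rightarrow> 'e enhanced_state" where
  "delete_hopf D S' =
     (let s = drop 2 (fst S')
      in (s, {C \<in> circles D s. \<exists>C' \<in> snd S'. Old ` C \<subseteq> C'}))"

definition alpha_chain ::
  "('r, 'm) ring_scheme \<Rightarrow> 'e diagram \<Rightarrow> 'e hopf_edge diagram \<Rightarrow> int \<Rightarrow> int \<Rightarrow>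
     ('e enhanced_state \<Rightarrow> 'r) \<Rightarrow> ('e hopf_edge enhanced_state \<Rightarrow> 'r)" where
  "alpha_chain R D E i j =
     linear_extension R (generators D (i + 2) (j + 4)) (generators E i j)
       (\<lambda>S S'. if S' = add_hopf E S then \<one>\<^bsub>R\<^esub> else \<zero>\<^bsub>R\<^esub>)"

definition beta_chain ::
  "('r, 'm) ring_scheme \<Rightarrow> 'e diagram \<Rightarrow> 'e hopf_edge diagram \<Rightarrow> int \<Rightarrow> int \<Rightarrow>
     ('e hopf_edge enhanced_state \<Rightarrow> 'r) \<Rightarrow> ('e enhanced_state \<Rightarrow> 'r)" where
  "beta_chain R D E i j =
     linear_extension R (generators E i j) (generators D (i - 2) (j - 4))
       (\<lambda>S' S. if take 2 (fst S') = [True, True] \<and> extra_positive S' \<and> S = delete_hopf D S'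
               then \<one>\<^bsub>R\<^esub> else \<zero>\<^bsub>R\<^esub>)"

definition alpha_h ::
  "('r, 'm) ring_scheme \<Rightarrow> 'e diagram \<Rightarrow> 'e hopf_edge diagram \<Rightarrow> int \<Rightarrow> int \<Rightarrow>
     ('e enhanced_state \<Rightarrow> 'r) set \<Rightarrow> ('e hopf_edge enhanced_state \<Rightarrow> 'r) set" where
  "alpha_h R D E i j = induced R E i j (alpha_chain R D E i j)"

definition beta_h ::
  "('r, 'm) ring_scheme \<Rightarrow> 'e diagram \<Rightarrow> 'e hopf_edge diagram \<Rightarrow> int \<Rightarrow> int \<Rightarrow>
     ('e hopf_edge enhanced_state \<Rightarrow> 'r) set \<Rightarrow> ('e enhanced_state \<Rightarrow> 'r) set" where
  "beta_h R D E i j = induced R D (i - 2) (j - 4) (beta_chain R D E i j)"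

end

theory Submission
  imports Defs
begin

text \<open>
  Write \<open>C\<close> for the chain complex of \<open>D\<close>, \<open>e\<close> for the arc that carries the added circle, and let
  \<open>A = R[X]/(X\<^sup>2)\<close>, where a circle with sign \<open>-\<close> stands for \<open>1\<close> and one with sign \<open>+\<close> for \<open>X\<close>.  In this
  language merging two circles is the multiplication of \<open>A\<close>, and splitting one is the comultiplication
  \<open>1 \<mapsto> 1 \<otimes> X + X \<otimes> 1\<close>, \<open>X \<mapsto> X \<otimes> X\<close>.  The four choices of markers at the two new crossings give, up to
  signs, the complex
    \<open>C \<otimes> A \<longrightarrow> C \<oplus> C \<longrightarrow> C \<otimes> A\<close>,
  where the factor \<open>A\<close> belongs to the extra circle, the first map merges the extra circle into the
  circle through \<open>e\<close>, and the second one splits it off.  So a chain of the Hopf sum has six components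
  \<open>(p, q, t, u, v, w)\<close>: markers \<open>++\<close> with extra sign \<open>+\<close> and \<open>-\<close>, markers \<open>+-\<close> and \<open>-+\<close>, markers \<open>--\<close>
  with extra sign \<open>+\<close> and \<open>-\<close>.  With \<open>X\<close> acting on \<open>C\<close> at \<open>e\<close>, and with \<open>\<epsilon>\<close> multiplying a state by
  \<open>-1\<close> to the number of its negative markers, the boundary map is (\<open>boundary_hopf\<close>)
    \<open>(dp, dq, dt + \<epsilon>(q + Xp), du + \<epsilon>(q + Xp), dv + \<epsilon>(u - t), dw + \<epsilon>X(u - t))\<close>.

  The chain maps of the theorem are \<open>\<alpha> w = (0, 0, 0, 0, 0, w)\<close> and \<open>\<beta> (p, \<dots>, w) = p\<close>.  Since \<open>X\<close>
  commutes with \<open>d\<close> (\<open>base_action_boundary\<close>), the kernel of the merging map and the cokernel of the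
  splitting map provide two more chain maps, a section \<open>s p = (p, -Xp, 0, 0, 0, 0)\<close> of \<open>\<beta>\<close> and a
  retraction \<open>r (p, \<dots>, w) = w - Xv\<close> of \<open>\<alpha>\<close>.  Since \<open>\<epsilon>\<close> anticommutes with \<open>d\<close>, the map
  \<open>h (p, \<dots>, w) = (0, \<epsilon>t, 0, \<epsilon>v, 0, 0)\<close> satisfies \<open>d h + h d = 1 - \<alpha> r - s \<beta>\<close>,
  which is applied to cycles (\<open>cycle_decomposition\<close>).  On homology \<open>\<alpha>\<close>, \<open>\<beta>\<close>, \<open>r\<close>, \<open>s\<close> therefore exhibit a direct sum
  (\<open>split_short_exact_biproduct\<close>).

  Two facts about circles make this precise.  The circles of a smoothing of the Hopf sum are, apart
  from the extra circle, in bijection with those of the smoothing of \<open>D\<close> (\<open>circles_E\<close>), which turns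
  incidence numbers of the Hopf sum into incidence numbers of \<open>D\<close>.  And a state in which the circle
  through \<open>e\<close> is positive only has such states in its boundary (\<open>positive_preserved\<close>), which is why
  \<open>X\<close> commutes with \<open>d\<close>.
\<close>

section \<open>Split exact sequences of modules\<close>

lemma linear_mapsD:
  assumes "f \<in> linear_maps R M N"
  shows "x \<in> carrier M \<Longrightarrow> f x \<in> carrier N"
    and "x \<in> carrier M \<Longrightarrow> y \<in> carrier M \<Longrightarrow> f (x \<oplus>\<^bsub>M\<^esub> y) = f x \<oplus>\<^bsub>N\<^esub> f y"
    and "a \<in> carrier R \<Longrightarrow> x \<in> carrier M \<Longrightarrow> f (a \<odot>\<^bsub>M\<^esub> x) = a \<odot>\<^bsub>N\<^esub> f x"
  using assms by (auto simp: linear_maps_def hom_def)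

lemma linear_mapsI:
  assumes "\<And>x. x \<in> carrier M \<Longrightarrow> f x \<in> carrier N"
    and "\<And>x y. x \<in> carrier M \<Longrightarrow> y \<in> carrier M \<Longrightarrow> f (x \<oplus>\<^bsub>M\<^esub> y) = f x \<oplus>\<^bsub>N\<^esub> f y"
    and "\<And>a x. a \<in> carrier R \<Longrightarrow> x \<in> carrier M \<Longrightarrow> f (a \<odot>\<^bsub>M\<^esub> x) = a \<odot>\<^bsub>N\<^esub> f x"
  shows "f \<in> linear_maps R M N"
  using assms by (auto simp: linear_maps_def hom_def)

lemma linear_maps_zero:
  assumes "f \<in> linear_maps R M N" "module R M" "module R N"
  shows "f \<zero>\<^bsub>M\<^esub> = \<zero>\<^bsub>N\<^esub>"
proof -
  interpret M: module R M by fact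
  interpret N: module R N by fact
  have "f \<zero>\<^bsub>M\<^esub> = f (\<zero>\<^bsub>R\<^esub> \<odot>\<^bsub>M\<^esub> \<zero>\<^bsub>M\<^esub>)" by simp
  also have "\<dots> = \<zero>\<^bsub>R\<^esub> \<odot>\<^bsub>N\<^esub> f \<zero>\<^bsub>M\<^esub>"
    using linear_mapsD(3)[OF assms(1)] M.R.zero_closed M.M.zero_closed by blast
  also have "\<dots> = \<zero>\<^bsub>N\<^esub>"
    using linear_mapsD(1)[OF assms(1) M.M.zero_closed] by (rule N.smult_l_null)
  finally show ?thesis .
qed

text \<open>
  The decomposition applied to \<open>s z\<close> gives \<open>f (r (s z)) = 0\<close>, hence \<open>r s = 0\<close>.  So \<open>M\<close> is the biproduct
  of \<open>L\<close> and \<open>N\<close>, from which exactness and both forms of the splitting can be read off.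
\<close>

lemma split_short_exact_biproduct:
  assumes L: "module R L" and M: "module R M" and N: "module R N"
    and f: "f \<in> linear_maps R L M" and g: "g \<in> linear_maps R M N"
    and r: "r \<in> linear_maps R M L" and s: "s \<in> linear_maps R N M"
    and rf: "\<And>x. x \<in> carrier L \<Longrightarrow> r (f x) = x"
    and gs: "\<And>z. z \<in> carrier N \<Longrightarrow> g (s z) = z"
    and gf: "\<And>x. x \<in> carrier L \<Longrightarrow> g (f x) = \<zero>\<^bsub>N\<^esub>"
    and decomposition: "\<And>y. y \<in> carrier M \<Longrightarrow> y = f (r y) \<oplus>\<^bsub>M\<^esub> s (g y)"
  shows "split_short_exact R L f M g N \<and> isomorphic_modules R M (direct_sum L N)"
proof -
  interpret L: module R L by fact
  interpret M: module R M by fact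
  interpret N: module R N by fact
  note [simp] = linear_mapsD(1)[OF f] linear_mapsD(1)[OF g] linear_mapsD(1)[OF r]
    linear_mapsD(1)[OF s] rf gs gf
  note zeros = linear_maps_zero[OF f L M] linear_maps_zero[OF g M N] linear_maps_zero[OF r M L]
    linear_maps_zero[OF s N M]
  have rs: "r (s z) = \<zero>\<^bsub>L\<^esub>" if z: "z \<in> carrier N" for z
  proof -
    have "s z = f (r (s z)) \<oplus>\<^bsub>M\<^esub> s z" using decomposition[of "s z"] z by simp
    then have "f (r (s z)) = \<zero>\<^bsub>M\<^esub>"
      using z by (metis M.M.add.r_cancel_one' linear_mapsD(1)[OF f] linear_mapsD(1)[OF r] linear_mapsD(1)[OF s])
    then show ?thesis using rf[of "r (s z)"] z zeros by simp
  qed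
  have inj: "inj_on f (carrier L)" by (rule inj_on_inverseI[of _ r]) simp
  have img: "f ` carrier L = a_kernel M N g"
  proof
    show "f ` carrier L \<subseteq> a_kernel M N g" by (auto simp: a_kernel_def')
    show "a_kernel M N g \<subseteq> f ` carrier L"
    proof
      fix y assume "y \<in> a_kernel M N g"
      then have y: "y \<in> carrier M" "g y = \<zero>\<^bsub>N\<^esub>" by (auto simp: a_kernel_def')
      then have "y = f (r y)" using decomposition[OF y(1)] zeros by simp
      then show "y \<in> f ` carrier L" using y(1) by (metis imageI linear_mapsD(1)[OF r])
    qed
  qed
  have surj: "g ` carrier M = carrier N"
    using gs by (force intro!: image_eqI[of z g "s z" for z])
  have split: "split_short_exact R L f M g N"
    unfolding split_short_exact_def short_exact_def 
    using L M N f g inj img surj s gs by blast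
  have lin: "(\<lambda>y. (r y, g y)) \<in> linear_maps R M (direct_sum L N)"
    by (rule linear_mapsI)
      (simp_all add: direct_sum_def linear_mapsD(2,3)[OF r] linear_mapsD(2,3)[OF g])
  have bij: "bij_betw (\<lambda>y. (r y, g y)) (carrier M) (carrier (direct_sum L N))"
  proof (rule bij_betwI[where g = "\<lambda>(x, z). f x \<oplus>\<^bsub>M\<^esub> s z"])
    show "(\<lambda>y. (r y, g y)) \<in> carrier M \<rightarrow> carrier (direct_sum L N)"
      by (simp add: direct_sum_def)
    show "(\<lambda>(x, z). f x \<oplus>\<^bsub>M\<^esub> s z) \<in> carrier (direct_sum L N) \<rightarrow> carrier M"
      by (auto simp: direct_sum_def)
    show "(case (r y, g y) of (x, z) \<Rightarrow> f x \<oplus>\<^bsub>M\<^esub> s z) = y" if "y \<in> carrier M" for y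
      using decomposition[OF that] by simp
    show "(r (case p of (x, z) \<Rightarrow> f x \<oplus>\<^bsub>M\<^esub> s z), g (case p of (x, z) \<Rightarrow> f x \<oplus>\<^bsub>M\<^esub> s z)) = p"
      if "p \<in> carrier (direct_sum L N)" for p
      using that
      by (auto simp: direct_sum_def linear_mapsD(2)[OF r] linear_mapsD(2)[OF g] rs)
  qed
  show ?thesis using split lin bij unfolding isomorphic_modules_def by blast
qed

section \<open>Homology as a subquotient\<close>

text \<open>
  \<open>Z\<close> and \<open>B\<close> stand for cycles and boundaries.  The module \<open>H\<close> below is the image of \<open>Z\<close> in the
  quotient by \<open>B\<close>, for an arbitrary pair of submodules.
\<close>

locale subquotient = module R M for R :: "('r, 'm) ring_scheme" (structure) and M :: "('r, 'b) module" (structure) +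
  fixes Z B
  assumes Z: "submodule Z R M" and B: "submodule B R M"
begin

abbreviation H where "H \<equiv> quotient_module (M\<lparr>carrier := Z\<rparr>) B"
abbreviation cls where "cls z \<equiv> B +>\<^bsub>M\<^esub> z"

sublocale B: abelian_subgroup B M
  by (intro abelian_subgroupI3 additive_subgroup.intro submodule.axioms(1)[OF B] M.abelian_group_axioms)

lemma Z_carrier: "z \<in> Z \<Longrightarrow> z \<in> carrier M"
  using submoduleE(1)[OF Z] by blast

lemma B_carrier: "z \<in> B \<Longrightarrow> z \<in> carrier M"
  using submoduleE(1)[OF B] by blast

lemma Z_closed:
  "\<zero>\<^bsub>M\<^esub> \<in> Z" "x \<in> Z \<Longrightarrow> y \<in> Z \<Longrightarrow> x \<oplus>\<^bsub>M\<^esub> y \<in> Z" "x \<in> Z \<Longrightarrow> \<ominus>\<^bsub>M\<^esub> x \<in> Z"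
  "a \<in> carrier R \<Longrightarrow> x \<in> Z \<Longrightarrow> a \<odot>\<^bsub>M\<^esub> x \<in> Z"
  using submoduleE[OF Z] subgroup.one_closed[OF submodule.axioms(1)[OF Z]] by auto

lemma cls_add_boundary:
  assumes "b \<in> B" "z \<in> carrier M"
  shows "cls (b \<oplus>\<^bsub>M\<^esub> z) = cls z"
proof -
  have "b \<oplus>\<^bsub>M\<^esub> z \<in> cls z" using assms by (auto simp: a_r_coset_def')
  then show ?thesis using B.a_repr_independence' assms(2) by blast
qed

lemma cls_memE:
  assumes "x \<in> cls z" obtains b where "b \<in> B" "x = b \<oplus>\<^bsub>M\<^esub> z"
  using assms by (auto simp: a_r_coset_def')

lemma cls_self: "z \<in> carrier M \<Longrightarrow> z \<in> cls z"
  by (rule B.a_rcos_self)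

lemma r_coset_restrict: "B +>\<^bsub>M\<lparr>carrier := Z\<rparr>\<^esub> z = cls z"
  by (simp add: a_r_coset_def')

lemma carrier_H: "carrier H = cls ` Z"
  by (auto simp: quotient_module_def A_RCOSETS_def' r_coset_restrict)

lemma zero_H: "\<zero>\<^bsub>H\<^esub> = cls \<zero>\<^bsub>M\<^esub>"
  using B.a_subset by (simp add: quotient_module_def)

lemma add_H: "x \<in> carrier M \<Longrightarrow> y \<in> carrier M \<Longrightarrow> cls x \<oplus>\<^bsub>H\<^esub> cls y = cls (x \<oplus>\<^bsub>M\<^esub> y)"
  using B.a_rcos_sum[of x y] by (simp add: quotient_module_def set_add_def')

lemma smult_H:
  assumes a: "a \<in> carrier R" and x: "x \<in> carrier M"
  shows "a \<odot>\<^bsub>H\<^esub> cls x = cls (a \<odot>\<^bsub>M\<^esub> x)"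
proof -
  have "cls (a \<odot>\<^bsub>M\<^esub> y) = cls (a \<odot>\<^bsub>M\<^esub> x)" if "y \<in> cls x" for y
  proof -
    from that obtain b where b: "b \<in> B" "y = b \<oplus>\<^bsub>M\<^esub> x" by (rule cls_memE)
    then have "a \<odot>\<^bsub>M\<^esub> y = a \<odot>\<^bsub>M\<^esub> b \<oplus>\<^bsub>M\<^esub> a \<odot>\<^bsub>M\<^esub> x"
      using a x B_carrier smult_r_distr by simp
    then show ?thesis using cls_add_boundary submoduleE(4)[OF B] a b(1) x by simp
  qed
  then have "(\<Union>y\<in>cls x. cls (a \<odot>\<^bsub>M\<^esub> y)) = cls (a \<odot>\<^bsub>M\<^esub> x)"
    using cls_self[OF x] by blast
  then show ?thesis by (simp add: quotient_module_def r_coset_restrict)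
qed

lemma module_H: "module R H"
proof (rule moduleI)
  show "abelian_group H"
  proof (rule abelian_groupI)
    fix X assume "X \<in> carrier H"
    then obtain z where z: "z \<in> Z" "X = cls z" by (auto simp: carrier_H)
    have "cls (\<ominus>\<^bsub>M\<^esub> z) \<in> carrier H" "cls (\<ominus>\<^bsub>M\<^esub> z) \<oplus>\<^bsub>H\<^esub> X = \<zero>\<^bsub>H\<^esub>"
      using z Z_carrier Z_closed by (auto simp: carrier_H add_H zero_H M.l_neg)
    then show "\<exists>y\<in>carrier H. y \<oplus>\<^bsub>H\<^esub> X = \<zero>\<^bsub>H\<^esub>" by blast
  qed (use Z_closed Z_carrier in \<open>auto simp: carrier_H zero_H add_H M.a_ac\<close>)
qed (use Z_closed Z_carrier smult_l_distr smult_r_distr smult_assoc1 in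
    \<open>auto simp: carrier_H add_H smult_H R.cring_axioms R.is_cring\<close>)

end

text \<open>
  The map on homology is given by a union over all representatives, as for \<open>induced\<close>.  It is a single
  coset because boundaries are sent to boundaries.
\<close>

locale chain_map =
  M: subquotient R M Z B + N: subquotient R N Z' B'
  for R :: "('r, 'm) ring_scheme" (structure) and M :: "('r, 'b) module" and Z B
    and N :: "('r, 'c) module" and Z' B' +
  fixes f
  assumes linear: "f \<in> linear_maps R M N"
    and on_cycles: "z \<in> Z \<Longrightarrow> f z \<in> Z'"
    and on_boundaries: "b \<in> B \<Longrightarrow> f b \<in> B'"
begin

definition on_homology where "on_homology X = (\<Union>x\<in>X. N.cls (f x))"

lemma on_homology_cls:
  assumes z: "z \<in> carrier M"
  shows "on_homology (M.cls z) = N.cls (f z)"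
proof -
  have "N.cls (f x) = N.cls (f z)" if "x \<in> M.cls z" for x
  proof -
    from that obtain b where b: "b \<in> B" "x = b \<oplus>\<^bsub>M\<^esub> z" by (rule M.cls_memE)
    then have "f x = f b \<oplus>\<^bsub>N\<^esub> f z" using linear_mapsD(2)[OF linear] M.B_carrier z by blast
    then show ?thesis using N.cls_add_boundary on_boundaries b(1) linear_mapsD(1)[OF linear z] by simp
  qed
  then show ?thesis using M.cls_self[OF z] unfolding on_homology_def by blast
qed

lemma on_homology_linear: "on_homology \<in> linear_maps R M.H N.H"
proof (rule linear_mapsI)
  show "on_homology X \<in> carrier N.H" if "X \<in> carrier M.H" for X
    using that M.Z_carrier on_cycles by (auto simp: M.carrier_H N.carrier_H on_homology_cls)
qed (auto simp: M.carrier_H on_homology_cls M.add_H M.smult_H N.add_H N.smult_H M.Z_carrier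
    linear_mapsD[OF linear])

end

text \<open>
  On chains only \<open>r f = 1\<close>, \<open>g s = 1\<close> and \<open>g f = 0\<close> hold on the nose; \<open>f r + s g = 1\<close> holds for cycles up
  to a boundary, as provided by a chain homotopy.
\<close>

lemma split_exact_homology:
  assumes f: "chain_map R L ZL BL M ZM BM f" and g: "chain_map R M ZM BM N ZN BN g"
    and r: "chain_map R M ZM BM L ZL BL r" and s: "chain_map R N ZN BN M ZM BM s"
    and rf: "\<And>x. x \<in> carrier L \<Longrightarrow> r (f x) = x"
    and gs: "\<And>z. z \<in> carrier N \<Longrightarrow> g (s z) = z"
    and gf: "\<And>x. x \<in> carrier L \<Longrightarrow> g (f x) = \<zero>\<^bsub>N\<^esub>"
    and decomposition:
      "\<And>y. y \<in> ZM \<Longrightarrow> \<exists>b\<in>BM. y = b \<oplus>\<^bsub>M\<^esub> (f (r y) \<oplus>\<^bsub>M\<^esub> s (g y))"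
  shows "split_short_exact R (quotient_module (L\<lparr>carrier := ZL\<rparr>) BL) (\<lambda>X. \<Union>x\<in>X. BM +>\<^bsub>M\<^esub> f x)
      (quotient_module (M\<lparr>carrier := ZM\<rparr>) BM) (\<lambda>X. \<Union>x\<in>X. BN +>\<^bsub>N\<^esub> g x)
      (quotient_module (N\<lparr>carrier := ZN\<rparr>) BN)
    \<and> isomorphic_modules R (quotient_module (M\<lparr>carrier := ZM\<rparr>) BM)
      (direct_sum (quotient_module (L\<lparr>carrier := ZL\<rparr>) BL) (quotient_module (N\<lparr>carrier := ZN\<rparr>) BN))"
proof -
  interpret f: chain_map R L ZL BL M ZM BM f by fact
  interpret g: chain_map R M ZM BM N ZN BN g by fact
  interpret r: chain_map R M ZM BM L ZL BL r by fact
  interpret s: chain_map R N ZN BN M ZM BM s by fact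
  note simps = f.on_homology_cls g.on_homology_cls r.on_homology_cls s.on_homology_cls
    linear_mapsD(1)[OF f.linear] linear_mapsD(1)[OF g.linear] linear_mapsD(1)[OF r.linear]
    linear_mapsD(1)[OF s.linear] f.M.Z_carrier f.N.Z_carrier g.N.Z_carrier
  have "split_short_exact R f.M.H f.on_homology f.N.H g.on_homology g.N.H
    \<and> isomorphic_modules R f.N.H (direct_sum f.M.H g.N.H)"
  proof (rule split_short_exact_biproduct[OF f.M.module_H f.N.module_H g.N.module_H
        f.on_homology_linear g.on_homology_linear r.on_homology_linear s.on_homology_linear])
    fix Y assume "Y \<in> carrier f.N.H"
    then obtain y where y: "y \<in> ZM" "Y = f.N.cls y" by (auto simp: f.N.carrier_H)
    then obtain b where b: "b \<in> BM" "y = b \<oplus>\<^bsub>M\<^esub> (f (r y) \<oplus>\<^bsub>M\<^esub> s (g y))"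
      using decomposition by blast
    have "Y = f.N.cls (f (r y) \<oplus>\<^bsub>M\<^esub> s (g y))"
      using f.N.cls_add_boundary[OF b(1), of "f (r y) \<oplus>\<^bsub>M\<^esub> s (g y)"] b(2) y by (simp add: simps)
    moreover have "f.on_homology (r.on_homology Y) \<oplus>\<^bsub>f.N.H\<^esub> s.on_homology (g.on_homology Y)
        = f.N.cls (f (r y) \<oplus>\<^bsub>M\<^esub> s (g y))"
      unfolding y(2) using y(1) by (simp add: simps f.N.add_H)
    ultimately show "Y = f.on_homology (r.on_homology Y) \<oplus>\<^bsub>f.N.H\<^esub> s.on_homology (g.on_homology Y)"
      by simp
  qed (auto simp: f.M.carrier_H g.N.carrier_H g.N.zero_H simps rf gs gf)
  then show ?thesis
    unfolding f.on_homology_def[abs_def] g.on_homology_def[abs_def] .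
qed

section \<open>Free modules\<close>

lemma free_module_simps:
  "carrier (free_module R A) = A \<rightarrow>\<^sub>E carrier R"
  "\<zero>\<^bsub>free_module R A\<^esub> = (\<lambda>a\<in>A. \<zero>\<^bsub>R\<^esub>)"
  "x \<oplus>\<^bsub>free_module R A\<^esub> y = (\<lambda>a\<in>A. x a \<oplus>\<^bsub>R\<^esub> y a)"
  "c \<odot>\<^bsub>free_module R A\<^esub> x = (\<lambda>a\<in>A. c \<otimes>\<^bsub>R\<^esub> x a)"
  by (simp_all add: free_module_def)

lemma module_free_module:
  assumes "cring R" shows "module R (free_module R A)"
proof -
  interpret cring R by fact
  show ?thesis
  proof (rule moduleI)
    show "abelian_group (free_module R A)"
    proof (rule abelian_groupI)
      fix x assume x: "x \<in> carrier (free_module R A)"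
      then have "(\<lambda>a\<in>A. \<ominus>\<^bsub>R\<^esub> x a) \<in> carrier (free_module R A)"
        "(\<lambda>a\<in>A. \<ominus>\<^bsub>R\<^esub> x a) \<oplus>\<^bsub>free_module R A\<^esub> x = \<zero>\<^bsub>free_module R A\<^esub>"
        by (auto simp: free_module_simps l_neg PiE_iff intro!: restrict_ext)
      then show "\<exists>y\<in>carrier (free_module R A). y \<oplus>\<^bsub>free_module R A\<^esub> x = \<zero>\<^bsub>free_module R A\<^esub>"
        by blast
    qed (auto simp: free_module_simps a_ac PiE_iff extensional_def fun_eq_iff)
  qed (auto simp: free_module_simps assms l_distr r_distr m_assoc PiE_iff extensional_def fun_eq_iff)
qed

lemma linear_extension_linear:
  fixes R (structure)
  assumes "cring R" "\<And>a b. a \<in> A \<Longrightarrow> b \<in> B \<Longrightarrow> m a b \<in> carrier R"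
  shows "linear_extension R A B m \<in> linear_maps R (free_module R A) (free_module R B)"
proof -
  interpret cring R by fact
  show ?thesis
  proof (rule linear_mapsI)
    fix x y assume xy: "x \<in> carrier (free_module R A)" "y \<in> carrier (free_module R A)"
    have "(\<Oplus>a\<in>A. m a b \<otimes> (x a \<oplus> y a)) = (\<Oplus>a\<in>A. m a b \<otimes> x a) \<oplus> (\<Oplus>a\<in>A. m a b \<otimes> y a)"
      if "b \<in> B" for b
    proof -
      have "(\<Oplus>a\<in>A. m a b \<otimes> (x a \<oplus> y a)) = (\<Oplus>a\<in>A. m a b \<otimes> x a \<oplus> m a b \<otimes> y a)"
        using xy assms(2) that by (intro finsum_cong') (auto simp: free_module_simps PiE_iff r_distr)
      also have "\<dots> = (\<Oplus>a\<in>A. m a b \<otimes> x a) \<oplus> (\<Oplus>a\<in>A. m a b \<otimes> y a)"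
        using xy assms(2) that by (intro finsum_addf) (auto simp: free_module_simps PiE_iff)
      finally show ?thesis .
    qed
    moreover have "(\<Oplus>a\<in>A. m a b \<otimes> (\<lambda>a\<in>A. x a \<oplus> y a) a) = (\<Oplus>a\<in>A. m a b \<otimes> (x a \<oplus> y a))"
      if "b \<in> B" for b
      using xy assms(2) that by (intro finsum_cong') (auto simp: free_module_simps PiE_iff)
    ultimately show "linear_extension R A B m (x \<oplus>\<^bsub>free_module R A\<^esub> y)
        = linear_extension R A B m x \<oplus>\<^bsub>free_module R B\<^esub> linear_extension R A B m y"
      by (auto simp: free_module_simps linear_extension_def fun_eq_iff)
  next
    fix c x assume c: "c \<in> carrier R" and x: "x \<in> carrier (free_module R A)"
    have "(\<Oplus>a\<in>A. m a b \<otimes> (\<lambda>a\<in>A. c \<otimes> x a) a) = c \<otimes> (\<Oplus>a\<in>A. m a b \<otimes> x a)" if "b \<in> B" for b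
    proof (cases "finite A")
      case True
      then show ?thesis using x c assms(2) that
        by (subst finsum_rdistr)
          (auto simp: free_module_simps PiE_iff m_lcomm intro!: finsum_cong')
    qed (simp add: c)
    then show "linear_extension R A B m (c \<odot>\<^bsub>free_module R A\<^esub> x)
        = c \<odot>\<^bsub>free_module R B\<^esub> linear_extension R A B m x"
      by (auto simp: free_module_simps linear_extension_def fun_eq_iff)
  next
    fix x assume "x \<in> carrier (free_module R A)"
    then show "linear_extension R A B m x \<in> carrier (free_module R B)"
      using assms(2) by (auto simp: free_module_simps linear_extension_def PiE_iff intro!: finsum_closed)
  qed
qed

lemma kernel_submodule:
  assumes M: "module R M" and N: "module R N" and f: "f \<in> linear_maps R M N"
  shows "submodule (a_kernel M N f) R M"
proof -
  interpret M: module R M by fact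
  interpret N: module R N by fact
  show ?thesis
  proof (rule M.submoduleI)
    fix a assume "a \<in> a_kernel M N f"
    then have a: "a \<in> carrier M" "f a = \<zero>\<^bsub>N\<^esub>" by (auto simp: a_kernel_def')
    have "f (\<ominus>\<^bsub>M\<^esub> a) = \<ominus>\<^bsub>R\<^esub> \<one>\<^bsub>R\<^esub> \<odot>\<^bsub>N\<^esub> f a"
      using linear_mapsD(3)[OF f, of "\<ominus>\<^bsub>R\<^esub> \<one>\<^bsub>R\<^esub>" a] a M.smult_l_minus[of "\<one>\<^bsub>R\<^esub>" a] by simp
    then show "\<ominus>\<^bsub>M\<^esub> a \<in> a_kernel M N f" using a by (simp add: a_kernel_def')
  qed (auto simp: a_kernel_def' linear_maps_zero[OF f M N] linear_mapsD(2,3)[OF f])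
qed

lemma image_submodule:
  assumes M: "module R M" and N: "module R N" and f: "f \<in> linear_maps R M N"
  shows "submodule (f ` carrier M) R N"
proof -
  interpret M: module R M by fact
  interpret N: module R N by fact
  show ?thesis
  proof (rule N.submoduleI)
    fix a assume "a \<in> f ` carrier M"
    then obtain x where x: "x \<in> carrier M" "a = f x" by auto
    have "f (\<ominus>\<^bsub>M\<^esub> x) = \<ominus>\<^bsub>N\<^esub> a"
      using linear_mapsD(3)[OF f, of "\<ominus>\<^bsub>R\<^esub> \<one>\<^bsub>R\<^esub>" x] x M.smult_l_minus[of "\<one>\<^bsub>R\<^esub>" x]
        N.smult_l_minus[of "\<one>\<^bsub>R\<^esub>" a] linear_mapsD(1)[OF f x(1)] by simp
    then show "\<ominus>\<^bsub>N\<^esub> a \<in> f ` carrier M" using x(1) by (metis M.M.a_inv_closed imageI)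
  next
    show "\<zero>\<^bsub>N\<^esub> \<in> f ` carrier M"
      using linear_maps_zero[OF f M N] M.M.zero_closed by (metis imageI)
  qed (use linear_mapsD[OF f] in \<open>force simp flip: linear_mapsD(2,3)[OF f]\<close>)+
qed

section \<open>Circles of a smoothing\<close>

definition linked :: "'e diagram \<Rightarrow> bool list \<Rightarrow> ('e \<times> 'e) set" where
  "linked D s = (joined D s \<union> (joined D s)\<inverse>)\<^sup>*"

definition circle_of :: "'e diagram \<Rightarrow> bool list \<Rightarrow> 'e \<Rightarrow> 'e set" where
  "circle_of D s x = linked D s `` {x}"

lemma linked_refl [simp]: "(x, x) \<in> linked D s"
  by (simp add: linked_def)

lemma linked_sym: "(x, y) \<in> linked D s \<Longrightarrow> (y, x) \<in> linked D s"
  unfolding linked_def by (rule symD[OF sym_rtrancl]) (auto simp: sym_def)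

lemma linked_trans: "(x, y) \<in> linked D s \<Longrightarrow> (y, z) \<in> linked D s \<Longrightarrow> (x, z) \<in> linked D s"
  unfolding linked_def by (rule rtrancl_trans)

lemma linked_joined: "(x, y) \<in> joined D s \<Longrightarrow> (x, y) \<in> linked D s"
  by (auto simp: linked_def)

text \<open>
  Being on one circle is the least equivalence relation that contains the smoothed crossings; this
  is how circles of different diagrams are compared.
\<close>

lemma linked_least:
  assumes "(x, y) \<in> linked D s" "equivp r" "\<And>a b. (a, b) \<in> joined D s \<Longrightarrow> r a b"
  shows "r x y"
  using assms(1) unfolding linked_def
proof (induction rule: rtrancl_induct)
  case base
  show ?case using assms(2) by (rule equivp_reflp)
next
  case (step y z)
  then have "r y z" using assms(3) equivp_symp[OF assms(2)] by blast
  then show ?case using step.IH equivp_transp[OF assms(2)] by blast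
qed

lemma mem_circle_of: "y \<in> circle_of D s x \<longleftrightarrow> (x, y) \<in> linked D s"
  by (simp add: circle_of_def)

lemma circle_of_self [simp]: "x \<in> circle_of D s x"
  by (simp add: mem_circle_of)

lemma circle_of_eq_iff: "circle_of D s x = circle_of D s y \<longleftrightarrow> (x, y) \<in> linked D s"
  by (auto simp: set_eq_iff mem_circle_of intro: linked_trans linked_sym)

lemma circles_eq: "circles D s = circle_of D s ` edges D"
  by (auto simp: circles_def quotient_def circle_of_def linked_def)

lemma circle_eq_circle_of: "C \<in> circles D s \<Longrightarrow> x \<in> C \<Longrightarrow> C = circle_of D s x"
  unfolding circles_eq by (metis circle_of_eq_iff imageE mem_circle_of)

lemma circle_of_in_circles: "x \<in> edges D \<Longrightarrow> circle_of D s x \<in> circles D s"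
  by (simp add: circles_eq)

lemma circles_nonempty: "C \<in> circles D s \<Longrightarrow> C \<noteq> {}"
  using circle_of_self unfolding circles_eq by (metis empty_iff imageE)

lemma smoothing_subset: "(x, y) \<in> smoothing m c \<Longrightarrow> x \<in> set_crossing c \<and> y \<in> set_crossing c"
  by (cases c; cases m) auto

locale diagram =
  fixes D :: "'e diagram"
  assumes finite_edges: "finite (edges D)"
    and crossing_edges: "c \<in> set (crossings D) \<Longrightarrow> set_crossing c \<subseteq> edges D"
begin

lemma joined_edges: "(x, y) \<in> joined D s \<Longrightarrow> x \<in> edges D \<and> y \<in> edges D"
  using smoothing_subset crossing_edges nth_mem unfolding joined_def by fast

lemma circle_subset: "C \<in> circles D s \<Longrightarrow> C \<subseteq> edges D"
proof
  fix y assume "C \<in> circles D s" "y \<in> C"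
  then obtain x where "x \<in> edges D" "(x, y) \<in> linked D s" by (auto simp: circles_eq mem_circle_of)
  then show "y \<in> edges D"
    unfolding linked_def by (metis Un_iff converse_iff joined_edges rtranclE)
qed

lemma finite_circles: "finite (circles D s)"
  using finite_edges by (simp add: circles_eq)

lemma finite_enhanced_states: "finite (enhanced_states D)"
proof -
  have "finite (kauffman_states D)"
    using finite_lists_length_eq[of "UNIV :: bool set" "length (crossings D)"]
    by (simp add: kauffman_states_def)
  moreover have "enhanced_states D = (SIGMA s : kauffman_states D. Pow (circles D s))"
    by (auto simp: enhanced_states_def)
  ultimately show ?thesis by (simp add: finite_circles finite_SigmaI)
qed

lemma finite_generators [simp]: "finite (generators D i j)"
  using finite_enhanced_states by (simp add: generators_def)

lemma tau_eq:
  assumes "P \<subseteq> circles D s"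
  shows "tau D (s, P) = 2 * int (card P) - int (card (circles D s))"
  using card_mono[OF finite_circles assms] card_Diff_subset[OF finite_subset[OF assms finite_circles] assms]
  by (simp add: tau_def)

end

section \<open>Changing one marker\<close>

definition touching :: "'e diagram \<Rightarrow> bool list \<Rightarrow> nat \<Rightarrow> 'e set set" where
  "touching D s c = {C \<in> circles D s. C \<inter> set_crossing (crossings D ! c) \<noteq> {}}"

context diagram
begin

text \<open>
  A smoothed crossing consists of two pieces of curve, which lie on one circle or on two.
\<close>

lemma card_touching:
  assumes "c < length (crossings D)"
  shows "card (touching D s c) \<in> {1, 2}"
proof -
  obtain w x y z where c: "crossings D ! c = Crossing w x y z" by (cases "crossings D ! c")
  have e: "{w, x, y, z} \<subseteq> edges D" using crossing_edges[OF nth_mem[OF assms]] c by simp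
  have sub: "smoothing (s ! c) (crossings D ! c) \<subseteq> joined D s"
    using assms by (auto simp: joined_def)
  have t: "touching D s c = circle_of D s ` {w, x, y, z}"
  proof (intro equalityI subsetI)
    fix C assume "C \<in> touching D s c"
    then show "C \<in> circle_of D s ` {w, x, y, z}"
      using circle_eq_circle_of[of C D s] by (auto simp: touching_def c simp del: circle_of_eq_iff)
  next
    fix C assume "C \<in> circle_of D s ` {w, x, y, z}"
    then show "C \<in> touching D s c"
      using e circle_of_self[of _ D s] by (fastforce simp: touching_def c intro: circle_of_in_circles)
  qed
  have "\<exists>a b. touching D s c = {circle_of D s a, circle_of D s b}"
  proof (cases "s ! c")
    case True
    then have "(w, x) \<in> linked D s" "(y, z) \<in> linked D s" using sub c by (auto intro: linked_joined)
    then have "touching D s c = {circle_of D s w, circle_of D s y}"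
      unfolding t by (auto simp flip: circle_of_eq_iff)
    then show ?thesis by blast
  next
    case False
    then have "(w, z) \<in> linked D s" "(x, y) \<in> linked D s" using sub c by (auto intro: linked_joined)
    then have "touching D s c = {circle_of D s w, circle_of D s x}"
      unfolding t by (auto simp flip: circle_of_eq_iff)
    then show ?thesis by blast
  qed
  then obtain C C' where "touching D s c = {C, C'}" by blast
  then show ?thesis by (cases "C = C'") auto
qed

text \<open>
  A circle that avoids the crossing \<open>c\<close> is traced out by the other crossings alone, whose smoothings
  are the same in both states.
\<close>

lemma untouched_circle:
  assumes "\<And>k. k < length (crossings D) \<Longrightarrow> k \<noteq> c \<Longrightarrow> s ! k = s' ! k"
    and C: "C \<in> circles D s" "C \<inter> set_crossing (crossings D ! c) = {}"
  shows "C \<in> circles D s'"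
proof -
  let ?X = "set_crossing (crossings D ! c)"
  have step: "(a, b) \<in> joined D t'"
    if "(a, b) \<in> joined D t" "{t, t'} = {s, s'}" "a \<notin> ?X \<or> b \<notin> ?X" for a b t t'
  proof -
    obtain k where k: "k < length (crossings D)" "(a, b) \<in> smoothing (t ! k) (crossings D ! k)"
      using \<open>(a, b) \<in> joined D t\<close> by (auto simp: joined_def)
    then have "k \<noteq> c" using that(3) smoothing_subset by metis
    then have "t ! k = t' ! k" using assms(1)[of k] k that(2) by (auto simp: doubleton_eq_iff)
    then show ?thesis using k by (auto simp: joined_def)
  qed
  have edge: "(a, b) \<in> joined D t' \<union> (joined D t')\<inverse>"
    if "(a, b) \<in> joined D t \<union> (joined D t)\<inverse>" "{t, t'} = {s, s'}" "a \<notin> ?X" for a b t t'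
    using that step[of _ _ t t'] by blast
  obtain x where x: "x \<in> edges D" "C = circle_of D s x" using C by (auto simp: circles_eq)
  have 1: "(x, y) \<in> linked D s \<and> y \<notin> ?X" if "(x, y) \<in> linked D s'" for y
    using that unfolding linked_def
  proof (induction rule: rtrancl_induct)
    case base
    show ?case using C x by auto
  next
    case (step y z)
    then have "(y, z) \<in> joined D s \<union> (joined D s)\<inverse>" using edge[of y z s' s] by auto
    then have "(x, z) \<in> linked D s"
      using step.IH unfolding linked_def by (meson rtrancl.rtrancl_into_rtrancl)
    then show ?case using C x by (auto simp: mem_circle_of linked_def)
  qed
  have 2: "(x, y) \<in> linked D s'" if "(x, y) \<in> linked D s" for y
    using that unfolding linked_def
  proof (induction rule: rtrancl_induct)
    case (step y z)
    then have "(x, y) \<in> linked D s'" by (simp add: linked_def)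
    then have "(y, z) \<in> joined D s' \<union> (joined D s')\<inverse>" using edge[of y z s s'] step 1 by auto
    then show ?case using step.IH by (meson rtrancl.rtrancl_into_rtrancl)
  qed simp
  have "C = circle_of D s' x" using 1 2 x by (auto simp: mem_circle_of)
  then show ?thesis using x by (simp add: circles_eq)
qed

lemma adjacent_untouched:
  assumes "adjacent D c S S'" "C \<inter> set_crossing (crossings D ! c) = {}"
  shows "C \<in> circles D (fst S) \<longleftrightarrow> C \<in> circles D (fst S')"
  using untouched_circle[of c "fst S" "fst S'" C] untouched_circle[of c "fst S'" "fst S" C] assms
  by (auto simp: adjacent_def)

end

section \<open>Positivity at a base point\<close>

text \<open>
  In terms of the algebra \<open>A\<close>, the state has the factor \<open>X\<close> on the circle through \<open>e\<close>; \<open>raise\<close> and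
  \<open>lower\<close> exchange the factors \<open>1\<close> and \<open>X\<close> there.
\<close>

definition positive_at :: "'e diagram \<Rightarrow> 'e \<Rightarrow> 'e enhanced_state \<Rightarrow> bool" where
  "positive_at D e S \<longleftrightarrow> circle_of D (fst S) e \<in> snd S"

definition raise :: "'e diagram \<Rightarrow> 'e \<Rightarrow> 'e enhanced_state \<Rightarrow> 'e enhanced_state" where
  "raise D e S = (fst S, insert (circle_of D (fst S) e) (snd S))"

definition lower :: "'e diagram \<Rightarrow> 'e \<Rightarrow> 'e enhanced_state \<Rightarrow> 'e enhanced_state" where
  "lower D e S = (fst S, snd S - {circle_of D (fst S) e})"

lemma fst_raise [simp]: "fst (raise D e S) = fst S" and fst_lower [simp]: "fst (lower D e S) = fst S"
  by (simp_all add: raise_def lower_def)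

lemma positive_raise [simp]: "positive_at D e (raise D e S)"
  and positive_lower [simp]: "\<not> positive_at D e (lower D e S)"
  by (simp_all add: positive_at_def raise_def lower_def)

lemma lower_raise: "\<not> positive_at D e S \<Longrightarrow> lower D e (raise D e S) = S"
  and raise_lower: "positive_at D e S \<Longrightarrow> raise D e (lower D e S) = S"
  by (auto simp: positive_at_def raise_def lower_def intro!: prod_eqI)

locale pointed_diagram = diagram D for D :: "'e diagram" +
  fixes e :: 'e
  assumes point: "e \<in> edges D"
begin

text \<open>
  Merging and splitting are linear over \<open>A\<close>, so multiples of \<open>X\<close> stay multiples of \<open>X\<close>.  In the
  combinatorial description the reason is a count: circles that avoid \<open>c\<close> keep their signs, so the
  increase of \<open>\<tau>\<close> happens on the one or two circles touching \<open>c\<close>, and if one of them is positive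
  before, then all of them are positive afterwards.
\<close>

lemma positive_preserved:
  assumes S: "S \<in> enhanced_states D" and S': "S' \<in> enhanced_states D"
    and adj: "adjacent D c S S'" and tau: "tau D S' = tau D S + 1"
    and pos: "positive_at D e S"
  shows "positive_at D e S'"
proof -
  let ?X = "set_crossing (crossings D ! c)"
  obtain s P s' P' where eqs: "S = (s, P)" "S' = (s', P')" by (cases S, cases S')
  note untouched = adjacent_untouched[OF adj, unfolded eqs fst_conv]
  have P: "P \<subseteq> circles D s" and P': "P' \<subseteq> circles D s'"
    using S S' by (auto simp: enhanced_states_def eqs)
  have c: "c < length (crossings D)" using adj by (simp add: adjacent_def)
  have e: "circle_of D s e \<in> circles D s" "circle_of D s' e \<in> circles D s'"
    using point by (auto intro: circle_of_in_circles)
  show ?thesis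
  proof (cases "circle_of D s e \<inter> ?X = {}")
    case True
    then have "circle_of D s e = circle_of D s' e"
      using untouched e(1) circle_eq_circle_of circle_of_self by metis
    then show ?thesis using adj True e pos by (auto simp: adjacent_def positive_at_def eqs)
  next
    case False
    define A A' U where "A = touching D s c" and "A' = touching D s' c" and "U = circles D s - A"
    have U': "U = circles D s' - A'"
      using untouched unfolding U_def A_def A'_def touching_def by blast
    have "A \<subseteq> circles D s" "A' \<subseteq> circles D s'" by (auto simp: A_def A'_def touching_def)
    then have AU: "circles D s = A \<union> U" "circles D s' = A' \<union> U" "A \<inter> U = {}" "A' \<inter> U = {}"
      using U_def U' by blast+
    have fin: "finite A" "finite A'" "finite U" "finite P" "finite P'"
      using AU finite_circles[of s] finite_circles[of s'] P P' by (auto intro: finite_subset)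
    have same: "P \<inter> U = P' \<inter> U"
      using adj U' unfolding U_def A_def A'_def touching_def adjacent_def eqs by auto
    have "circle_of D s e \<in> P \<inter> A"
      using False e pos by (auto simp: positive_at_def eqs A_def touching_def)
    then have p: "card (P \<inter> A) \<noteq> 0" using fin by auto
    have "circle_of D s' e = circle_of D s e" if "circle_of D s' e \<inter> ?X = {}"
      using untouched[OF that] e(2) by (simp add: circle_eq_circle_of)
    then have e': "circle_of D s' e \<in> A'"
      using False e(2) by (auto simp: A'_def touching_def)
    have "P = P \<inter> A \<union> P \<inter> U" "P' = P' \<inter> A' \<union> P' \<inter> U" using AU P P' by blast+
    then have "card P = card (P \<inter> A) + card (P \<inter> U)" "card P' = card (P' \<inter> A') + card (P' \<inter> U)"
      using AU fin by (metis card_Un_disjoint finite_Int inf_assoc inf_bot_right inf_left_commute)+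
    moreover have "card (circles D s) = card A + card U" "card (circles D s') = card A' + card U"
      using AU fin by (auto simp: card_Un_disjoint)
    ultimately have "2 * int (card (P' \<inter> A')) - int (card A') = 2 * int (card (P \<inter> A)) - int (card A) + 1"
      using tau same by (simp add: eqs tau_eq P P')
    moreover have "card A \<in> {1, 2}" "card A' \<in> {1, 2}"
      unfolding A_def A'_def using card_touching[OF c] by auto
    \<comment> \<open>If the number of touched circles did not change, both sides of the displayed equation would
      have different parity; so two circles merge or one splits.\<close>
    ultimately have "card A' \<le> card (P' \<inter> A')" using p by auto
    then have "P' \<inter> A' = A'" using fin by (intro card_seteq) auto
    then show ?thesis using e' by (auto simp: positive_at_def eqs)
  qed
qed

lemma adjacent_raise_lower:
  assumes "\<not> positive_at D e S" "positive_at D e S'"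
  shows "adjacent D c (raise D e S) S' \<longleftrightarrow> adjacent D c S (lower D e S')"
proof -
  have "(C \<in> snd (raise D e S) \<longleftrightarrow> C \<in> snd S') \<longleftrightarrow> (C \<in> snd S \<longleftrightarrow> C \<in> snd (lower D e S'))"
    if C: "C \<in> circles D (fst S) \<union> circles D (fst S')" "C \<inter> set_crossing (crossings D ! c) = {}"
      and "\<forall>k<length (crossings D). (fst S ! k \<noteq> fst S' ! k) = (k = c)" for C
  proof -
    have "C \<in> circles D (fst S)" "C \<in> circles D (fst S')"
      using C that(3) untouched_circle[of c "fst S" "fst S'" C] untouched_circle[of c "fst S'" "fst S" C]
      by auto
    then have "C = circle_of D (fst S) e \<longleftrightarrow> e \<in> C" "C = circle_of D (fst S') e \<longleftrightarrow> e \<in> C"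
      using circle_eq_circle_of circle_of_self by metis+
    then show ?thesis using assms by (auto simp: raise_def lower_def positive_at_def)
  qed
  then show ?thesis unfolding adjacent_def fst_raise fst_lower by blast
qed

lemma incidence_raise_lower:
  assumes "\<not> positive_at D e S" "positive_at D e S'"
  shows "incidence R D (raise D e S) S' = incidence R D S (lower D e S')"
  by (simp add: incidence_def adjacent_raise_lower[OF assms] negative_after_def)

lemma tau_raise:
  assumes "S \<in> enhanced_states D" "\<not> positive_at D e S"
  shows "tau D (raise D e S) = tau D S + 2"
proof -
  obtain s P where S: "S = (s, P)" by (cases S)
  have P: "P \<subseteq> circles D s" "insert (circle_of D s e) P \<subseteq> circles D s" "circle_of D s e \<notin> P"
    using assms point by (auto simp: enhanced_states_def positive_at_def S intro: circle_of_in_circles)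
  then have "finite P" using finite_circles finite_subset by blast
  then show ?thesis using P by (simp add: S raise_def tau_eq)
qed

lemma raise_enhanced: "S \<in> enhanced_states D \<Longrightarrow> raise D e S \<in> enhanced_states D"
  and lower_enhanced: "S \<in> enhanced_states D \<Longrightarrow> lower D e S \<in> enhanced_states D"
  using point by (auto simp: enhanced_states_def raise_def lower_def intro: circle_of_in_circles)

lemma raise_generators:
  assumes "S \<in> generators D i j" "\<not> positive_at D e S"
  shows "raise D e S \<in> generators D i (j + 4)"
  using assms by (auto simp: generators_def tau_raise raise_enhanced sigma_def)

lemma lower_generators:
  assumes "S \<in> generators D i (j + 4)" "positive_at D e S"
  shows "lower D e S \<in> generators D i j"
  using assms tau_raise[of "lower D e S"]
  by (auto simp: generators_def lower_enhanced raise_lower sigma_def)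

end

section \<open>The boundary map\<close>

lemma count_list_bool: "count_list s True + count_list s False = length s"
  by (induction s) auto

lemma generators_enhanced: "S \<in> generators D i j \<Longrightarrow> S \<in> enhanced_states D"
  by (simp add: generators_def)

lemma sigma_generators: "S \<in> generators D i j \<Longrightarrow> sigma S = i"
  and tau_generators: "S \<in> generators D i j \<Longrightarrow> 2 * tau D S = j - i"
  by (auto simp: generators_def)

lemma incidence_adjacent:
  assumes "adjacent D c S S'"
  shows "incidence R D S S' = (\<ominus>\<^bsub>R\<^esub> \<one>\<^bsub>R\<^esub>) [^]\<^bsub>R\<^esub> negative_after c S"
proof -
  have "(THE c. adjacent D c S S') = c"
    using assms by (rule the_equality) (use assms in \<open>unfold adjacent_def, metis\<close>)
  then show ?thesis using assms by (auto simp: incidence_def)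
qed

lemma (in cring) incidence_closed [simp]: "incidence R D S S' \<in> carrier R"
  by (simp add: incidence_def)

lemma (in cring) boundary_linear:
  "boundary R D i j \<in> linear_maps R (chains R D i j) (chains R D (i - 2) j)"
  unfolding boundary_def by (rule linear_extension_linear[OF is_cring]) simp

lemma boundary_apply:
  "S' \<in> generators D (i - 2) j \<Longrightarrow>
    boundary R D i j x S' = (\<Oplus>\<^bsub>R\<^esub>S\<in>generators D i j. incidence R D S S' \<otimes>\<^bsub>R\<^esub> x S)"
  by (simp add: boundary_def linear_extension_def)

text \<open>
  Multiplication by \<open>X\<close> on the circle through \<open>e\<close>.  On generators it sends \<open>S\<close> to \<open>raise D e S\<close> if the
  circle is negative and to \<open>0\<close> otherwise; the definition lists the resulting coefficients.
\<close>

definition base_action ::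
  "('r, 'm) ring_scheme \<Rightarrow> 'e diagram \<Rightarrow> 'e \<Rightarrow> int \<Rightarrow> int \<Rightarrow> ('e enhanced_state \<Rightarrow> 'r) \<Rightarrow>
     ('e enhanced_state \<Rightarrow> 'r)" where
  "base_action R D e i j z =
     (\<lambda>S\<in>generators D i (j + 4). if positive_at D e S then z (lower D e S) else \<zero>\<^bsub>R\<^esub>)"

text \<open>
  The sign that the boundary map attaches to a change of marker at a crossing that precedes all
  crossings of \<open>D\<close>.
\<close>

definition marker_sign :: "('r, 'm) ring_scheme \<Rightarrow> 'e enhanced_state \<Rightarrow> 'r" where
  "marker_sign R S = (\<ominus>\<^bsub>R\<^esub> \<one>\<^bsub>R\<^esub>) [^]\<^bsub>R\<^esub> count_list (fst S) False"

locale pointed_diagram_over = pointed_diagram D e + cring R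
  for D :: "'e diagram" and e and R :: "('r, 'm) ring_scheme" (structure)
begin

lemma chain_closed: "z \<in> carrier (chains R D i j) \<Longrightarrow> S \<in> generators D i j \<Longrightarrow> z S \<in> carrier R"
  by (auto simp: free_module_simps)

lemma base_action_closed:
  "z \<in> carrier (chains R D i j) \<Longrightarrow> base_action R D e i j z \<in> carrier (chains R D i (j + 4))"
  by (auto simp: free_module_simps base_action_def chain_closed lower_generators)

lemma incidence_positive_zero:
  assumes "S \<in> generators D i j" "S' \<in> generators D (i - 2) j"
    "positive_at D e S" "\<not> positive_at D e S'"
  shows "incidence R D S S' = \<zero>"
  using positive_preserved[of S S'] assms by (auto simp: incidence_def generators_def)

text \<open>
  The coefficient of \<open>S'\<close> on either side is a sum over the states \<open>S\<close> that are negative at \<open>e\<close>.  If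
  \<open>S'\<close> is positive at \<open>e\<close>, the terms agree by \<open>incidence_raise_lower\<close>; the remaining terms vanish
  because positivity at \<open>e\<close> is preserved.
\<close>

lemma base_action_boundary:
  assumes z: "z \<in> carrier (chains R D i j)"
  shows "boundary R D i (j + 4) (base_action R D e i j z)
    = base_action R D e (i - 2) j (boundary R D i j z)"
proof
  fix S'
  let ?G = "generators D i j" and ?G4 = "generators D i (j + 4)"
  let ?N = "{S \<in> ?G. \<not> positive_at D e S}"
  show "boundary R D i (j + 4) (base_action R D e i j z) S'
    = base_action R D e (i - 2) j (boundary R D i j z) S'"
  proof (cases "S' \<in> generators D (i - 2) (j + 4)")
    case S': True
    have zN: "z S \<in> carrier R" if "S \<in> ?G" for S using chain_closed[OF z that] .
    have "boundary R D i (j + 4) (base_action R D e i j z) S'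
        = (\<Oplus>S\<in>?G4. incidence R D S S' \<otimes> base_action R D e i j z S)"
      using S' by (rule boundary_apply)
    also have "\<dots> = (\<Oplus>S\<in>raise D e ` ?N. incidence R D S S' \<otimes> base_action R D e i j z S)"
    proof (rule add.finprod_mono_neutral_cong_right)
      show "raise D e ` ?N \<subseteq> ?G4" by (auto intro: raise_generators)
      show "incidence R D S S' \<otimes> base_action R D e i j z S = \<zero>" if S: "S \<in> ?G4 - raise D e ` ?N" for S
      proof -
        have "\<not> positive_at D e S"
        proof
          assume pos: "positive_at D e S"
          then have "lower D e S \<in> ?N" using S by (auto intro: lower_generators)
          then have "raise D e (lower D e S) \<in> raise D e ` ?N" by (rule imageI)
          then show False using S raise_lower[OF pos] by simp
        qed
        then show ?thesis using S by (simp add: base_action_def)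
      qed
    qed (use base_action_closed[OF z] in \<open>auto simp: free_module_simps\<close>)
    also have "\<dots> = (\<Oplus>S\<in>?N. incidence R D (raise D e S) S' \<otimes> base_action R D e i j z (raise D e S))"
    proof (rule finsum_reindex)
      show "inj_on (raise D e) ?N" by (rule inj_on_inverseI[of _ "lower D e"]) (auto simp: lower_raise)
      show "(\<lambda>S. incidence R D S S' \<otimes> base_action R D e i j z S) \<in> raise D e ` ?N \<rightarrow> carrier R"
        using base_action_closed[OF z] raise_generators[of _ i j]
        by (auto simp: free_module_simps intro!: m_closed elim!: PiE_mem)
    qed
    also have "\<dots> = (\<Oplus>S\<in>?N. incidence R D (raise D e S) S' \<otimes> z S)"
      by (rule finsum_cong') (auto simp: base_action_def raise_generators lower_raise zN)
    also have "\<dots> = base_action R D e (i - 2) j (boundary R D i j z) S'"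
    proof (cases "positive_at D e S'")
      case True
      have l: "lower D e S' \<in> generators D (i - 2) j" using S' True by (rule lower_generators)
      have "(\<Oplus>S\<in>?N. incidence R D (raise D e S) S' \<otimes> z S)
          = (\<Oplus>S\<in>?G. incidence R D S (lower D e S') \<otimes> z S)"
        by (rule add.finprod_mono_neutral_cong_left)
          (auto simp: incidence_raise_lower True zN incidence_positive_zero[OF _ l])
      then show ?thesis using S' True l by (simp add: base_action_def boundary_apply)
    next
      case False
      have "(\<Oplus>S\<in>?N. incidence R D (raise D e S) S' \<otimes> z S) = (\<Oplus>S\<in>?N. \<zero>)"
        by (rule finsum_cong') (auto simp: zN incidence_positive_zero[OF raise_generators S' _ False])
      then show ?thesis using S' False by (simp add: base_action_def)
    qed
    finally show ?thesis .
  qed (simp_all add: base_action_def boundary_def linear_extension_def)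
qed

lemma marker_sign_closed [simp]: "marker_sign R S \<in> carrier R"
  by (simp add: marker_sign_def)

lemma marker_sign_square [simp]: "marker_sign R S \<otimes> marker_sign R S = \<one>"
proof -
  have "(\<ominus> \<one>) [^] n \<otimes> (\<ominus> \<one>) [^] n = \<one>" for n :: nat
  proof -
    have "(\<ominus> \<one>) [^] n \<otimes> (\<ominus> \<one>) [^] n = (\<ominus> \<one> \<otimes> \<ominus> \<one>) [^] n"
      by (rule pow_mult_distrib[symmetric]) (auto simp: m_comm)
    then show ?thesis by (simp add: l_minus)
  qed
  then show ?thesis by (simp add: marker_sign_def)
qed

lemma marker_sign_lower [simp]: "marker_sign R (lower D e S) = marker_sign R S"
  by (simp add: marker_sign_def)

lemma marker_sign_step:
  assumes "S \<in> generators D i j" "S' \<in> generators D (i - 2) j'"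
  shows "marker_sign R S = \<ominus> marker_sign R S'"
proof -
  have "count_list (fst S') False = Suc (count_list (fst S) False)"
    using assms count_list_bool[of "fst S"] count_list_bool[of "fst S'"]
    by (auto simp: generators_def sigma_def enhanced_states_def kauffman_states_def)
  then show ?thesis by (simp add: marker_sign_def l_minus r_minus)
qed

text \<open>
  The boundary map turns one positive marker into a negative one, so the sign anticommutes with it.
\<close>

lemma sign_boundary:
  assumes z: "z \<in> carrier (chains R D i j)" and S': "S' \<in> generators D (i - 2) j"
  shows "boundary R D i j (\<lambda>S\<in>generators D i j. marker_sign R S \<otimes> z S) S'
    = \<ominus> (marker_sign R S' \<otimes> boundary R D i j z S')"
proof -
  have "boundary R D i j (\<lambda>S\<in>generators D i j. marker_sign R S \<otimes> z S) S'
      = (\<Oplus>S\<in>generators D i j. \<ominus> marker_sign R S' \<otimes> (incidence R D S S' \<otimes> z S))"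
    unfolding boundary_apply[OF S']
    by (rule finsum_cong')
      (auto simp: chain_closed[OF z] marker_sign_step[OF _ S'] l_minus r_minus m_lcomm)
  also have "\<dots> = \<ominus> marker_sign R S' \<otimes> boundary R D i j z S'"
    unfolding boundary_apply[OF S']
    by (rule finsum_rdistr[symmetric]) (auto simp: chain_closed[OF z])
  also have "\<dots> = \<ominus> (marker_sign R S' \<otimes> boundary R D i j z S')"
    using S' linear_mapsD(1)[OF boundary_linear z] by (intro l_minus) (auto simp: free_module_simps)
  finally show ?thesis .
qed

end

section \<open>The circles of a Hopf sum\<close>

text \<open>
  Contracting the added circle and rejoining the cut arc turns the Hopf sum back into \<open>D\<close>.
\<close>

fun collapse :: "'e \<Rightarrow> 'e hopf_edge \<Rightarrow> 'e" where
  "collapse e (Old x) = x"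
| "collapse e _ = e"

text \<open>The arc of the added circle that is cut off together with \<open>Mid\<close>.\<close>

definition free_arc :: "bool \<Rightarrow> bool \<Rightarrow> 'e hopf_edge" where
  "free_arc v a = (if v = a then Upper else Lower)"

lemma less_Suc_Suc: "k < Suc (Suc n) \<longleftrightarrow> k = 0 \<or> k = Suc 0 \<or> (\<exists>l<n. k = Suc (Suc l))"
  by (cases k; cases "k - 1") auto

lemma smoothing_map: "smoothing m (map_crossing g c) = map_prod g g ` smoothing m c"
  by (cases c; cases m) auto

text \<open>
  The two kinds of points in \<open>hopf_sum\<close> are treated together: \<open>e\<close> is the arc west of the added circle
  and \<open>f\<close> the one east of it, which is \<open>Far\<close> if the point lies on an arc between crossings and again
  \<open>e\<close> on a crossingless component.  The list \<open>cs\<close> contains the old crossings of the Hopf sum.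
\<close>

locale hopf_addition = pointed_diagram D e for D :: "'e diagram" and e +
  fixes E :: "'e hopf_edge diagram" and f :: "'e hopf_edge" and v :: bool
    and cs :: "'e hopf_edge crossing list"
  assumes far: "f = Old e \<or> f = Far"
    and edges_E: "edges E = Old ` edges D \<union> {f, Mid, Upper, Lower}"
    and crossings_E: "crossings E = hopf_crossings v (Old e) f @ cs"
    and length_cs: "length cs = length (crossings D)"
    and collapse_cs: "k < length (crossings D) \<Longrightarrow> map_crossing (collapse e) (cs ! k) = crossings D ! k"
    and edges_cs: "k < length (crossings D) \<Longrightarrow> set_crossing (cs ! k) \<subseteq> insert f (range Old)"
begin

text \<open>
  For equal markers \<open>a = b\<close> at the new crossings, these are the arcs on the extra circle.
\<close>

definition detached :: "bool \<Rightarrow> bool \<Rightarrow> 'e hopf_edge \<Rightarrow> bool" where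
  "detached a b x \<longleftrightarrow> a = b \<and> (x = Mid \<or> x = free_arc v a)"

definition extra_circle :: "bool \<Rightarrow> 'e hopf_edge set" where
  "extra_circle a = {Mid, free_arc v a}"

text \<open>
  The circle of the Hopf sum that corresponds to the circle \<open>C\<close> of \<open>D\<close>: all new arcs that are not
  detached belong to the circle through \<open>e\<close>.
\<close>

definition lift :: "bool \<Rightarrow> bool \<Rightarrow> 'e set \<Rightarrow> 'e hopf_edge set" where
  "lift a b C = {x \<in> edges E. \<not> detached a b x \<and> collapse e x \<in> C}"

lemma collapse_far [simp]: "collapse e f = e"
  using far by auto

lemma not_detached [simp]: "\<not> detached a b (Old x)" "\<not> detached a b f"
  using far by (auto simp: detached_def free_arc_def)

lemma length_E: "length (crossings E) = Suc (Suc (length (crossings D)))"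
  by (cases v) (auto simp: crossings_E length_cs)

lemma nth_E: "crossings E ! Suc (Suc k) = cs ! k"
  by (cases v) (auto simp: crossings_E)

lemma new_crossings:
  "set_crossing (crossings E ! 0) = {Old e, Mid, Upper, Lower}"
  "set_crossing (crossings E ! Suc 0) = {f, Mid, Upper, Lower}"
  by (cases v; auto simp: crossings_E)+

lemma joined_E:
  "joined E (a # b # s) = smoothing a (crossings E ! 0) \<union> smoothing b (crossings E ! 1)
     \<union> (\<Union>k<length (crossings D). smoothing (s ! k) (cs ! k))"
proof -
  have "{..<Suc (Suc n)} = insert 0 (insert 1 ((\<lambda>k. Suc (Suc k)) ` {..<n}))" for n
    by (auto simp: less_Suc_Suc)
  then show ?thesis unfolding joined_def length_E by (simp add: nth_E Un_assoc)
qed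

lemma set_cs:
  assumes "k < length (crossings D)"
  shows "collapse e ` set_crossing (cs ! k) = set_crossing (crossings D ! k)"
  using collapse_cs[OF assms] by (metis crossing.set_map)

lemma cs_edges:
  assumes k: "k < length (crossings D)" and x: "x \<in> set_crossing (cs ! k)"
  shows "x \<in> edges E" "\<not> detached a b x"
proof -
  have "collapse e x \<in> edges D"
    using set_cs[OF k] x crossing_edges[OF nth_mem[OF k]] by blast
  then show "x \<in> edges E" "\<not> detached a b x" using edges_cs[OF k] x by (auto simp: edges_E)
qed

sublocale E: diagram E
proof
  show "finite (edges E)" using finite_edges by (simp add: edges_E)
  fix c assume "c \<in> set (crossings E)"
  then obtain k where "k < length (crossings E)" "c = crossings E ! k" by (metis in_set_conv_nth)
  then show "set_crossing c \<subseteq> edges E"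
    using point by (auto simp: length_E less_Suc_Suc nth_E new_crossings cs_edges) (auto simp: edges_E)
qed

lemma new_links:
  "circle_of E (a # b # s) (Old e) = circle_of E (a # b # s) (free_arc v (\<not> a))"
  "circle_of E (a # b # s) Mid = circle_of E (a # b # s) (free_arc v a)"
  "circle_of E (a # b # s) f = circle_of E (a # b # s) (free_arc v (\<not> b))"
  "circle_of E (a # b # s) Mid = circle_of E (a # b # s) (free_arc v b)"
proof -
  have link: "circle_of E (a # b # s) x = circle_of E (a # b # s) y"
    if "(x, y) \<in> joined E (a # b # s) \<or> (y, x) \<in> joined E (a # b # s)" for x y
    using that linked_joined linked_sym circle_of_eq_iff by metis
  show "circle_of E (a # b # s) (Old e) = circle_of E (a # b # s) (free_arc v (\<not> a))"
    "circle_of E (a # b # s) Mid = circle_of E (a # b # s) (free_arc v a)"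
    by (rule link; cases v; cases a; simp add: joined_E crossings_E free_arc_def)+
  show "circle_of E (a # b # s) f = circle_of E (a # b # s) (free_arc v (\<not> b))"
    "circle_of E (a # b # s) Mid = circle_of E (a # b # s) (free_arc v b)"
    by (rule link; cases v; cases b; simp add: joined_E crossings_E free_arc_def)+
qed

text \<open>
  At each new crossing the marker joins \<open>Mid\<close> to one of \<open>Upper\<close>, \<open>Lower\<close> and the adjacent outer arc to
  the other one.  For different markers the five arcs \<open>e\<close>, \<open>f\<close>, \<open>Mid\<close>, \<open>Upper\<close>, \<open>Lower\<close> are thus joined
  in a row; for equal markers \<open>e\<close> and \<open>f\<close> are joined to the same arc, and the other one closes up with
  \<open>Mid\<close>.
\<close>

lemma circle_of_attached:
  assumes "x \<in> edges E" "\<not> detached a b x"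
  shows "circle_of E (a # b # s) x = circle_of E (a # b # s) (Old (collapse e x))"
proof -
  have arcs: "x = free_arc v a \<or> x = free_arc v (\<not> a)" if "x \<in> {Upper, Lower}" for x :: "'e hopf_edge"
    using that by (auto simp: free_arc_def)
  have "circle_of E (a # b # s) x = circle_of E (a # b # s) (Old e)" if "x \<in> {f, Mid, Upper, Lower}"
  proof (cases "a = b")
    case True
    then show ?thesis using that arcs[of x] new_links[of a b s] assms(2)
      by (auto simp del: not_detached simp: detached_def)
  next
    case False
    then have "b = (\<not> a)" by auto
    then show ?thesis using that arcs[of x] new_links[of a b s] by auto
  qed
  moreover have "collapse e x = e" if "x \<in> {f, Mid, Upper, Lower}" using that by auto
  moreover have "x = Old (collapse e x)" if "x \<notin> {f, Mid, Upper, Lower}"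
    using that assms(1) by (auto simp: edges_E)
  ultimately show ?thesis by metis
qed

lemma circle_of_detached:
  assumes "detached a b x" "detached a b y"
  shows "circle_of E (a # b # s) x = circle_of E (a # b # s) y"
  using assms new_links(2)[of a b s] by (auto simp: detached_def)

lemma linked_Old:
  assumes "(p, q) \<in> linked D s" shows "circle_of E (a # b # s) (Old p) = circle_of E (a # b # s) (Old q)"
proof -
  let ?c = "circle_of E (a # b # s)"
  show ?thesis
  proof (rule linked_least[OF assms])
    show "equivp (\<lambda>p q. ?c (Old p) = ?c (Old q))" by (auto intro!: equivpI reflpI sympI transpI)
    fix p q assume "(p, q) \<in> joined D s"
    then obtain k where k: "k < length (crossings D)" "(p, q) \<in> smoothing (s ! k) (crossings D ! k)"
      by (auto simp: joined_def)
    then obtain x y where xy: "(x, y) \<in> smoothing (s ! k) (cs ! k)" "p = collapse e x" "q = collapse e y"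
      by (auto simp flip: collapse_cs simp: smoothing_map)
    then have "x \<in> set_crossing (cs ! k)" "y \<in> set_crossing (cs ! k)" using smoothing_subset[OF xy(1)] by auto
    then have "?c x = ?c (Old p)" "?c y = ?c (Old q)"
      using circle_of_attached cs_edges[OF k(1)] xy by auto
    moreover have "?c x = ?c y"
      using k xy by (auto simp: circle_of_eq_iff joined_E intro!: linked_joined)
    ultimately show "?c (Old p) = ?c (Old q)" by simp
  qed
qed

text \<open>
  Collapsing sends each joined pair of attached arcs to a joined or equal pair of arcs of \<open>D\<close>, so it
  cannot bring together arcs of different circles of \<open>D\<close>.
\<close>

lemma linked_E_collapse:
  assumes "(x, y) \<in> linked E (a # b # s)"
  shows "(detached a b x \<longleftrightarrow> detached a b y) \<and>
    (detached a b x \<or> (collapse e x, collapse e y) \<in> linked D s)"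
proof (rule linked_least[OF assms])
  show "equivp (\<lambda>x y. (detached a b x \<longleftrightarrow> detached a b y) \<and>
      (detached a b x \<or> (collapse e x, collapse e y) \<in> linked D s))"
    by (intro equivpI reflpI sympI transpI) (auto intro: linked_sym linked_trans)
  fix x y assume "(x, y) \<in> joined E (a # b # s)"
  then consider "(x, y) \<in> smoothing a (crossings E ! 0) \<union> smoothing b (crossings E ! 1)"
    | k where "k < length (crossings D)" "(x, y) \<in> smoothing (s ! k) (cs ! k)"
    by (auto simp: joined_E)
  then show "(detached a b x \<longleftrightarrow> detached a b y) \<and>
      (detached a b x \<or> (collapse e x, collapse e y) \<in> linked D s)"
  proof cases
    case 1
    then show ?thesis using far unfolding detached_def
      by (cases v; cases a; cases b) (auto simp: crossings_E free_arc_def)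
  next
    case (2 k)
    then have "(collapse e x, collapse e y) \<in> joined D s"
      by (auto simp: joined_def smoothing_map simp flip: collapse_cs intro!: bexI[of _ k])
    then have "(collapse e x, collapse e y) \<in> linked D s" by (rule linked_joined)
    moreover have "\<not> detached a b x" "\<not> detached a b y"
      using smoothing_subset[OF 2(2)] cs_edges(2)[OF 2(1)] by auto
    ultimately show ?thesis by simp
  qed
qed

lemma circle_of_E:
  assumes x: "x \<in> edges E"
  shows "circle_of E (a # b # s) x =
    (if detached a b x then extra_circle a else lift a b (circle_of D s (collapse e x)))"
proof -
  have attached: "(y, z) \<in> linked E (a # b # s)"
    if "y \<in> edges E" "z \<in> edges E" "\<not> detached a b y" "\<not> detached a b z"
      "(collapse e y, collapse e z) \<in> linked D s" for y z
    using that circle_of_attached linked_Old by (metis circle_of_eq_iff)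
  have extra: "extra_circle a = {y. detached a b y}" if "detached a b x"
    using that by (auto simp: extra_circle_def detached_def)
  show ?thesis
  proof (cases "detached a b x")
    case True
    have "y \<in> circle_of E (a # b # s) x \<longleftrightarrow> detached a b y" for y
      using linked_E_collapse[of x y a b s] circle_of_detached[OF True, of y s] True
      by (auto simp: mem_circle_of circle_of_eq_iff)
    then show ?thesis using True extra by auto
  next
    case False
    have "y \<in> edges E" if "(x, y) \<in> linked E (a # b # s)" for y
      using subsetD[OF E.circle_subset[OF circle_of_in_circles[OF x]]] that by (simp add: mem_circle_of)
    then have "y \<in> circle_of E (a # b # s) x \<longleftrightarrow> y \<in> lift a b (circle_of D s (collapse e x))" for y
      using linked_E_collapse[of x y a b s] attached[of x y] False x
      by (auto simp: mem_circle_of lift_def)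
    then show ?thesis using False by auto
  qed
qed

lemma circles_E:
  "circles E (a # b # s) = lift a b ` circles D s \<union> (if a = b then {extra_circle a} else {})"
proof -
  have mid: "Mid \<in> edges E" "detached a b Mid \<longleftrightarrow> a = b" by (auto simp: edges_E detached_def)
  have col: "collapse e x \<in> edges D" if "x \<in> edges E" for x
    using that point by (auto simp: edges_E)
  show ?thesis (is "?l = ?r")
  proof
    show "?l \<subseteq> ?r"
    proof
      fix C assume "C \<in> ?l"
      then obtain x where x: "x \<in> edges E" "C = circle_of E (a # b # s) x" by (auto simp: circles_eq)
      then show "C \<in> ?r" using col[OF x(1)]
        by (auto simp: circle_of_E circles_eq detached_def)
    qed
    have "lift a b (circle_of D s x) \<in> ?l" if "x \<in> edges D" for x
      using that circle_of_E[of "Old x" a b s] circle_of_in_circles[of "Old x" E "a # b # s"]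
      by (auto simp: edges_E)
    moreover have "extra_circle a \<in> ?l" if "a = b"
      using that mid circle_of_E[of Mid a b s] circle_of_in_circles[of Mid E "a # b # s"] by auto
    ultimately show "?r \<subseteq> ?l" by (auto simp: circles_eq)
  qed
qed

lemma Old_in_lift: "C \<subseteq> edges D \<Longrightarrow> Old x \<in> lift a b C \<longleftrightarrow> x \<in> C"
  by (auto simp: lift_def edges_E)

lemma lift_inject: "C \<subseteq> edges D \<Longrightarrow> C' \<subseteq> edges D \<Longrightarrow> lift a b C = lift a b C' \<longleftrightarrow> C = C'"
  using Old_in_lift by (metis equalityI subsetI)

lemma Mid_in_extra: "Mid \<in> extra_circle a"
  by (simp add: extra_circle_def)

lemma Mid_not_in_lift: "Mid \<notin> lift a a C"
  by (simp add: lift_def detached_def)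

lemma extra_neq_lift: "extra_circle a \<noteq> lift a a C"
  using Mid_in_extra Mid_not_in_lift by metis

lemma Old_notin_extra: "Old x \<notin> extra_circle a"
  by (simp add: extra_circle_def free_arc_def)

text \<open>
  A circle that avoids \<open>e\<close> does not notice the new crossings, whatever their markers are.
\<close>

lemma lift_away:
  assumes "C \<subseteq> edges D" "e \<notin> C" shows "lift a b C = Old ` C"
proof
  show "lift a b C \<subseteq> Old ` C"
  proof
    fix x assume "x \<in> lift a b C"
    then show "x \<in> Old ` C" using assms by (cases x) (auto simp: lift_def)
  qed
qed (use assms Old_in_lift in auto)

section \<open>Enhanced states of a Hopf sum\<close>

text \<open>
  The triple consists of the two markers at the new crossings and the sign of the extra circle.  If
  the markers differ, there is no extra circle; then \<open>sectors\<close> contains only the triple with third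
  entry \<open>False\<close>, so that each enhanced state arises exactly once.
\<close>

fun hopf_state :: "bool \<times> bool \<times> bool \<Rightarrow> 'e enhanced_state \<Rightarrow> 'e hopf_edge enhanced_state" where
  "hopf_state (a, b, p) S =
     (a # b # fst S, lift a b ` snd S \<union> (if a = b \<and> p then {extra_circle a} else {}))"

lemma fst_hopf_state: "fst (hopf_state (a, b, p) S) = a # b # fst S"
  by simp

definition sectors :: "(bool \<times> bool \<times> bool) set" where
  "sectors = {(True, True, True), (True, True, False), (True, False, False),
     (False, True, False), (False, False, True), (False, False, False)}"

lemma snd_subset: "S \<in> enhanced_states D \<Longrightarrow> C \<in> snd S \<Longrightarrow> C \<in> circles D (fst S)"
  by (auto simp: enhanced_states_def)

lemma lift_in_hopf_state:
  assumes "S \<in> enhanced_states D" "C \<subseteq> edges D"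
  shows "lift a b C \<in> snd (hopf_state (a, b, p) S) \<longleftrightarrow> C \<in> snd S"
proof -
  have "lift a b C \<in> lift a b ` snd S \<longleftrightarrow> C \<in> snd S"
    using lift_inject[OF assms(2)] circle_subset[OF snd_subset[OF assms(1)]] by blast
  then show ?thesis using extra_neq_lift[of a C] by auto
qed

lemma extra_in_hopf_state:
  "extra_circle a \<in> snd (hopf_state (a, a, p) S) \<longleftrightarrow> p"
  using extra_neq_lift by auto

lemma hopf_state_enhanced: "S \<in> enhanced_states D \<Longrightarrow> hopf_state k S \<in> enhanced_states E"
  by (cases k) (auto simp: enhanced_states_def kauffman_states_def length_E circles_E)

lemma enhanced_state_cases:
  assumes "T \<in> enhanced_states E"
  obtains k S where "k \<in> sectors" "S \<in> enhanced_states D" "T = hopf_state k S"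
proof -
  obtain t Q where T: "T = (t, Q)" by (cases T)
  then have t: "length t = Suc (Suc (length (crossings D)))" and Q: "Q \<subseteq> circles E t"
    using assms by (auto simp: enhanced_states_def kauffman_states_def length_E)
  then obtain a b s where s: "t = a # b # s" "length s = length (crossings D)"
    by (auto simp: length_Suc_conv)
  define P where "P = {C \<in> circles D s. lift a b C \<in> Q}"
  define p where "p \<longleftrightarrow> a = b \<and> extra_circle a \<in> Q"
  have "T = hopf_state (a, b, p) (s, P)"
    using Q by (auto simp: T s circles_E P_def p_def split: if_splits)
  moreover have "(a, b, p) \<in> sectors" by (auto simp: sectors_def p_def)
  moreover have "(s, P) \<in> enhanced_states D" by (auto simp: enhanced_states_def kauffman_states_def s P_def)
  ultimately show ?thesis using that by blast
qed

lemma hopf_state_inject: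
  assumes "k \<in> sectors" "k' \<in> sectors" "S \<in> enhanced_states D" "S' \<in> enhanced_states D"
    and eq: "hopf_state k S = hopf_state k' S'"
  shows "k = k' \<and> S = S'"
proof -
  obtain a b p where k: "k = (a, b, p)" by (cases k)
  obtain p' where k': "k' = (a, b, p')" and s: "fst S = fst S'" using eq by (cases k') (auto simp: k)
  have "C \<in> snd S \<longleftrightarrow> C \<in> snd S'" if "C \<subseteq> edges D" for C
    using lift_in_hopf_state[OF _ that, of _ a b] assms(3,4) eq by (metis k k')
  moreover have "C \<subseteq> edges D" if "C \<in> snd S \<or> C \<in> snd S'" for C
    using that circle_subset snd_subset assms(3,4) by metis
  ultimately have "snd S = snd S'" by (intro equalityI subsetI) metis+
  moreover have "p = p'"
  proof (cases "a = b")
    case True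
    then have "hopf_state (a, a, p) S = hopf_state (a, a, p') S'" using eq k k' by simp
    then show ?thesis using extra_in_hopf_state by metis
  qed (use assms(1,2) in \<open>auto simp: sectors_def k k'\<close>)
  ultimately show ?thesis using s k k' by (simp add: prod_eq_iff)
qed

fun sigma_shift :: "bool \<times> bool \<times> bool \<Rightarrow> int" where
  "sigma_shift (a, b, p) = (if a then 1 else -1) + (if b then 1 else -1)"

fun tau_shift :: "bool \<times> bool \<times> bool \<Rightarrow> int" where
  "tau_shift (a, b, p) = (if a \<noteq> b then 0 else if p then 1 else -1)"

lemma sigma_hopf_state: "sigma (hopf_state k S) = sigma S + sigma_shift k"
  by (cases k) (auto simp: sigma_def)

lemma tau_hopf_state:
  assumes S: "S \<in> enhanced_states D"
  shows "tau E (hopf_state k S) = tau D S + tau_shift k"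
proof -
  obtain a b p where k: "k = (a, b, p)" by (cases k)
  obtain s P where sP: "S = (s, P)" by (cases S)
  have P: "P \<subseteq> circles D s" using S by (simp add: enhanced_states_def sP)
  have inj: "inj_on (lift a b) (circles D s)"
    using circle_subset by (auto intro!: inj_onI simp: lift_inject)
  have fin: "finite (circles D s)" "finite P" using finite_circles P finite_subset by blast+
  have card: "card (lift a b ` P) = card P" "card (lift a b ` circles D s) = card (circles D s)"
    using inj P by (auto intro: card_image inj_on_subset)
  let ?Q = "snd (hopf_state k S)"
  have Q: "?Q \<subseteq> circles E (a # b # s)"
    using hopf_state_enhanced[OF S, of k] by (auto simp: enhanced_states_def k sP)
  have new: "extra_circle a \<notin> lift a b ` X" if "a = b" for X
    using that extra_neq_lift by auto
  have "card ?Q = card P + (if a = b \<and> p then 1 else 0)"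
    using fin card new[of P] by (auto simp: k sP)
  moreover have "card (circles E (a # b # s)) = card (circles D s) + (if a = b then 1 else 0)"
    using fin card new[of "circles D s"] by (auto simp: circles_E)
  ultimately show ?thesis
    using E.tau_eq[OF Q] tau_eq[OF P] by (simp add: k sP)
qed

abbreviation sector_generators where
  "sector_generators k i j \<equiv> generators D (i - sigma_shift k) (j - (sigma_shift k + 2 * tau_shift k))"

lemma hopf_state_generators:
  assumes "S \<in> enhanced_states D"
  shows "hopf_state k S \<in> generators E i j \<longleftrightarrow> S \<in> sector_generators k i j"
  using assms hopf_state_enhanced[OF assms]
  by (auto simp: generators_def sigma_hopf_state tau_hopf_state)

lemma generators_E: "generators E i j = (\<Union>k\<in>sectors. hopf_state k ` sector_generators k i j)"
proof
  show "generators E i j \<subseteq> (\<Union>k\<in>sectors. hopf_state k ` sector_generators k i j)"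
  proof
    fix T assume T: "T \<in> generators E i j"
    then obtain k S where "k \<in> sectors" "S \<in> enhanced_states D" "T = hopf_state k S"
      using enhanced_state_cases generators_enhanced by metis
    then show "T \<in> (\<Union>k\<in>sectors. hopf_state k ` sector_generators k i j)"
      using T hopf_state_generators by blast
  qed
  show "(\<Union>k\<in>sectors. hopf_state k ` sector_generators k i j) \<subseteq> generators E i j"
    using hopf_state_generators generators_enhanced by blast
qed

section \<open>Incidence numbers of a Hopf sum\<close>

lemma lift_touches:
  assumes "k < length (crossings D)"
  shows "lift a b C \<inter> set_crossing (crossings E ! Suc (Suc k)) = {} \<longleftrightarrow>
    C \<inter> set_crossing (crossings D ! k) = {}"
proof -
  have "x \<in> lift a b C \<longleftrightarrow> collapse e x \<in> C" if "x \<in> set_crossing (cs ! k)" for x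
    using cs_edges[OF assms that] by (simp add: lift_def)
  then show ?thesis unfolding nth_E set_cs[OF assms, symmetric] by blast
qed

lemma extra_untouched:
  assumes "k < length (crossings D)"
  shows "extra_circle a \<inter> set_crossing (crossings E ! Suc (Suc k)) = {}"
proof -
  have "detached a a x" if "x \<in> extra_circle a" for x
    using that by (auto simp: extra_circle_def detached_def)
  then show ?thesis using cs_edges(2)[OF assms] by (auto simp: nth_E)
qed

text \<open>
  A change of marker at an old crossing touches corresponding circles in \<open>D\<close> and in the Hopf sum, and
  it never touches the extra circle, which therefore keeps its sign.
\<close>

lemma adjacent_same_sector:
  assumes S: "S \<in> enhanced_states D" and S': "S' \<in> enhanced_states D"
  shows "adjacent E c (hopf_state (a, b, p) S) (hopf_state (a, b, p') S') \<longleftrightarrow>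
    (\<exists>l. c = Suc (Suc l) \<and> adjacent D l S S') \<and> (a = b \<longrightarrow> p = p')"
proof -
  let ?T = "hopf_state (a, b, p) S" and ?T' = "hopf_state (a, b, p') S'"
  let ?n = "length (crossings D)"
  have marks: "(\<forall>k < Suc (Suc ?n). fst ?T ! k \<noteq> fst ?T' ! k \<longleftrightarrow> k = c) \<longleftrightarrow>
    (\<exists>l. c = Suc (Suc l) \<and> (\<forall>k < ?n. fst S ! k \<noteq> fst S' ! k \<longleftrightarrow> k = l))" if "c < Suc (Suc ?n)"
  proof (cases "\<exists>l. c = Suc (Suc l)")
    case True
    then show ?thesis by (auto simp: All_less_Suc2)
  next
    case False
    then have "c = 0 \<or> c = Suc 0" by (cases c; cases "c - 1") auto
    then show ?thesis using False by (auto simp: All_less_Suc2)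
  qed
  have circ: "(\<forall>C \<in> circles E (fst ?T) \<union> circles E (fst ?T').
        C \<inter> set_crossing (crossings E ! Suc (Suc l)) = {} \<longrightarrow> (C \<in> snd ?T \<longleftrightarrow> C \<in> snd ?T'))
    \<longleftrightarrow> (\<forall>C \<in> circles D (fst S) \<union> circles D (fst S').
        C \<inter> set_crossing (crossings D ! l) = {} \<longrightarrow> (C \<in> snd S \<longleftrightarrow> C \<in> snd S'))
      \<and> (a = b \<longrightarrow> p = p')" if l: "l < ?n" for l
  proof -
    let ?A = "circles D (fst S) \<union> circles D (fst S')"
    let ?B = "if a = b then {extra_circle a} else {}"
    let ?\<phi> = "\<lambda>C. C \<inter> set_crossing (crossings E ! Suc (Suc l)) = {} \<longrightarrow> (C \<in> snd ?T \<longleftrightarrow> C \<in> snd ?T')"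
    let ?\<psi> = "\<lambda>C. C \<inter> set_crossing (crossings D ! l) = {} \<longrightarrow> (C \<in> snd S \<longleftrightarrow> C \<in> snd S')"
    have un: "circles E (fst ?T) \<union> circles E (fst ?T') = lift a b ` ?A \<union> ?B"
      by (auto simp: circles_E)
    have "?\<phi> (lift a b C) \<longleftrightarrow> ?\<psi> C" if "C \<in> ?A" for C
    proof -
      have "C \<subseteq> edges D" using that circle_subset by (metis UnE)
      then show ?thesis
        using lift_in_hopf_state[OF S, of C a b p] lift_in_hopf_state[OF S', of C a b p']
          lift_touches[OF l, of a b C] by metis
    qed
    then have 1: "(\<forall>C\<in>lift a b ` ?A. ?\<phi> C) \<longleftrightarrow> (\<forall>C\<in>?A. ?\<psi> C)" by simp
    have 2: "(\<forall>C\<in>?B. ?\<phi> C) \<longleftrightarrow> (a = b \<longrightarrow> p = p')"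
    proof (cases "a = b")
      case True
      then show ?thesis
        using extra_in_hopf_state[of a p S] extra_in_hopf_state[of a p' S'] extra_untouched[OF l, of a]
        by (simp del: hopf_state.simps)
    qed simp
    show ?thesis unfolding un ball_Un[of "lift a b ` ?A"] 1 2 by (rule refl)
  qed
  show ?thesis
  proof (cases "\<exists>l < ?n. c = Suc (Suc l)")
    case True
    then obtain l where l: "l < ?n" "c = Suc (Suc l)" by blast
    show ?thesis
      unfolding adjacent_def length_E l(2) using marks circ[OF l(1)] l by simp
  next
    case False
    then have "\<not> adjacent E c ?T ?T'" unfolding adjacent_def length_E using marks by auto
    moreover have "\<not> (\<exists>l. c = Suc (Suc l) \<and> adjacent D l S S')" using False by (auto simp: adjacent_def)
    ultimately show ?thesis by blast
  qed
qed

definition agree_away :: "'e enhanced_state \<Rightarrow> 'e enhanced_state \<Rightarrow> bool" where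
  "agree_away S S' \<longleftrightarrow> fst S = fst S' \<and>
     (\<forall>C \<in> circles D (fst S). e \<notin> C \<longrightarrow> (C \<in> snd S \<longleftrightarrow> C \<in> snd S'))"

text \<open>
  Both new crossings touch precisely the extra circle and the circle through \<open>e\<close>; these are the only
  ones whose signs may change.
\<close>

lemma adjacent_new_crossing:
  assumes S: "S \<in> enhanced_states D" and S': "S' \<in> enhanced_states D" and ne: "(a, b) \<noteq> (a', b')"
  shows "adjacent E c (hopf_state (a, b, p) S) (hopf_state (a', b', p') S') \<longleftrightarrow>
    (c = (if a = a' then 1 else 0) \<and> (a = a' \<or> b = b')) \<and> agree_away S S'"
proof -
  let ?T = "hopf_state (a, b, p) S" and ?T' = "hopf_state (a', b', p') S'"
  let ?n = "length (crossings D)"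
  have "length (fst S) = ?n" "length (fst S') = ?n"
    using S S' by (auto simp: enhanced_states_def kauffman_states_def)
  then have eq: "fst S = fst S' \<longleftrightarrow> (\<forall>k < ?n. fst S ! k = fst S' ! k)"
    by (auto intro: nth_equalityI)
  have marks: "(c < Suc (Suc ?n) \<and> (\<forall>k < Suc (Suc ?n). fst ?T ! k \<noteq> fst ?T' ! k \<longleftrightarrow> k = c)) \<longleftrightarrow>
    (c = (if a = a' then 1 else 0) \<and> (a = a' \<or> b = b')) \<and> fst S = fst S'"
    using ne unfolding eq by (auto simp: All_less_Suc2)
  have circ: "(\<forall>C \<in> circles E (fst ?T) \<union> circles E (fst ?T').
        C \<inter> set_crossing (crossings E ! c) = {} \<longrightarrow> (C \<in> snd ?T \<longleftrightarrow> C \<in> snd ?T'))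
    \<longleftrightarrow> (\<forall>C \<in> circles D (fst S). e \<notin> C \<longrightarrow> (C \<in> snd S \<longleftrightarrow> C \<in> snd S'))"
    if c: "c \<in> {0, 1}" and s: "fst S = fst S'"
  proof -
    have Mid: "Mid \<in> set_crossing (crossings E ! c)" using c by (auto simp: new_crossings)
    have ex: "extra_circle a'' \<inter> set_crossing (crossings E ! c) \<noteq> {}" for a''
      using Mid Mid_in_extra by blast
    have lifted: "lift a'' b'' C \<inter> set_crossing (crossings E ! c) = {} \<longleftrightarrow> e \<notin> C"
      if "C \<in> circles D (fst S)" for a'' b'' C
    proof (cases "e \<in> C")
      case True
      then have "Old e \<in> lift a'' b'' C" "f \<in> lift a'' b'' C"
        using point by (auto simp: lift_def edges_E)
      then show ?thesis using True c by (auto simp: new_crossings)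
    next
      case False
      then have "lift a'' b'' C = Old ` C" using lift_away circle_subset[OF that] by blast
      then show ?thesis using False c far by (auto simp: new_crossings)
    qed
    have mem: "lift a'' b'' C \<in> snd ?T \<longleftrightarrow> C \<in> snd S" "lift a'' b'' C \<in> snd ?T' \<longleftrightarrow> C \<in> snd S'"
      if "C \<in> circles D (fst S)" "e \<notin> C" for a'' b'' C
    proof -
      note sub = circle_subset[OF that(1)]
      show "lift a'' b'' C \<in> snd ?T \<longleftrightarrow> C \<in> snd S" "lift a'' b'' C \<in> snd ?T' \<longleftrightarrow> C \<in> snd S'"
        using lift_in_hopf_state[OF S sub, of a b p] lift_in_hopf_state[OF S' sub, of a' b' p']
          lift_away[OF sub that(2)] by simp_all
    qed
    show ?thesis
    proof
      assume l: "\<forall>C \<in> circles E (fst ?T) \<union> circles E (fst ?T').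
        C \<inter> set_crossing (crossings E ! c) = {} \<longrightarrow> (C \<in> snd ?T \<longleftrightarrow> C \<in> snd ?T')"
      show "\<forall>C \<in> circles D (fst S). e \<notin> C \<longrightarrow> (C \<in> snd S \<longleftrightarrow> C \<in> snd S')"
      proof (intro ballI impI)
        fix C assume C: "C \<in> circles D (fst S)" "e \<notin> C"
        then have "lift a b C \<in> circles E (fst ?T)" by (auto simp: circles_E)
        then have "lift a b C \<in> snd ?T \<longleftrightarrow> lift a b C \<in> snd ?T'"
          using l lifted[OF C(1), of a b] C(2) by (metis UnI1)
        then show "C \<in> snd S \<longleftrightarrow> C \<in> snd S'" using mem[OF C] by metis
      qed
    next
      assume r: "\<forall>C \<in> circles D (fst S). e \<notin> C \<longrightarrow> (C \<in> snd S \<longleftrightarrow> C \<in> snd S')"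
      show "\<forall>C \<in> circles E (fst ?T) \<union> circles E (fst ?T').
        C \<inter> set_crossing (crossings E ! c) = {} \<longrightarrow> (C \<in> snd ?T \<longleftrightarrow> C \<in> snd ?T')"
      proof (intro ballI impI)
        fix C' assume C': "C' \<in> circles E (fst ?T) \<union> circles E (fst ?T')"
          "C' \<inter> set_crossing (crossings E ! c) = {}"
        have "C' \<in> lift a b ` circles D (fst S) \<union> lift a' b' ` circles D (fst S) \<union> range extra_circle"
          using C'(1) s by (auto simp: circles_E split: if_splits)
        then obtain a'' b'' C where C: "C' = lift a'' b'' C" "C \<in> circles D (fst S)"
          using ex C'(2) by blast
        then have "e \<notin> C" using lifted C'(2) by blast
        then show "C' \<in> snd ?T \<longleftrightarrow> C' \<in> snd ?T'" using r C mem[OF C(2)] by metis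
      qed
    qed
  qed
  have "adjacent E c ?T ?T' \<longleftrightarrow>
    (c < Suc (Suc ?n) \<and> (\<forall>k < Suc (Suc ?n). fst ?T ! k \<noteq> fst ?T' ! k \<longleftrightarrow> k = c)) \<and>
    (\<forall>C \<in> circles E (fst ?T) \<union> circles E (fst ?T').
        C \<inter> set_crossing (crossings E ! c) = {} \<longrightarrow> (C \<in> snd ?T \<longleftrightarrow> C \<in> snd ?T'))"
    unfolding adjacent_def length_E by blast
  also have "\<dots> \<longleftrightarrow> (c = (if a = a' then 1 else 0) \<and> (a = a' \<or> b = b')) \<and> agree_away S S'"
  proof (cases "(c = (if a = a' then 1 else 0) \<and> (a = a' \<or> b = b')) \<and> fst S = fst S'")
    case True
    then have "c \<in> {0, 1}" by auto
    then show ?thesis using True circ marks unfolding agree_away_def by blast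
  next
    case False
    then show ?thesis using marks unfolding agree_away_def by blast
  qed
  finally show ?thesis .
qed

lemma incidence_same_sector:
  assumes "S \<in> enhanced_states D" "S' \<in> enhanced_states D" "a = b \<Longrightarrow> p = p'"
  shows "incidence R E (hopf_state (a, b, p) S) (hopf_state (a, b, p') S') = incidence R D S S'"
proof (cases "\<exists>l. adjacent D l S S'")
  case True
  then obtain l where l: "adjacent D l S S'" by blast
  then have "adjacent E (Suc (Suc l)) (hopf_state (a, b, p) S) (hopf_state (a, b, p') S')"
    unfolding adjacent_same_sector[OF assms(1,2)] using assms(3) by blast
  from incidence_adjacent[OF this] show ?thesis
    unfolding incidence_adjacent[OF l] negative_after_def by (simp del: hopf_state.simps add: fst_hopf_state)
next
  case False
  then show ?thesis
    using adjacent_same_sector[OF assms(1,2)] by (simp add: incidence_def del: hopf_state.simps)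
qed

lemma incidence_extra_sign:
  assumes "S \<in> enhanced_states D" "S' \<in> enhanced_states D" "p \<noteq> p'"
  shows "incidence R E (hopf_state (a, a, p) S) (hopf_state (a, a, p') S') = \<zero>\<^bsub>R\<^esub>"
  using adjacent_same_sector[OF assms(1,2)] assms(3) by (simp add: incidence_def del: hopf_state.simps)

text \<open>
  A change at the first new crossing also counts the marker \<open>b\<close> of the second one, which comes next
  in the ordering.
\<close>

lemma incidence_new_crossing:
  assumes "S \<in> enhanced_states D" "S' \<in> enhanced_states D" "(a, b) \<noteq> (a', b')"
  shows "incidence R E (hopf_state (a, b, p) S) (hopf_state (a', b', p') S') =
    (if (a = a' \<or> b = b') \<and> agree_away S S'
     then (\<ominus>\<^bsub>R\<^esub> \<one>\<^bsub>R\<^esub>) [^]\<^bsub>R\<^esub> count_list (if a = a' then fst S' else b # fst S') False else \<zero>\<^bsub>R\<^esub>)"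
proof -
  note adj = adjacent_new_crossing[OF assms]
  show ?thesis
  proof (cases "(a = a' \<or> b = b') \<and> agree_away S S'")
    case True
    then have step: "adjacent E (if a = a' then 1 else 0) (hopf_state (a, b, p) S) (hopf_state (a', b', p') S')"
      unfolding adj by blast
    have neg: "negative_after (if a = a' then 1 else 0) (hopf_state (a, b, p) S)
        = count_list (if a = a' then fst S' else b # fst S') False"
      using True by (simp add: negative_after_def agree_away_def)
    show ?thesis unfolding incidence_adjacent[OF step] neg using True by simp
  next
    case False
    then have "\<not> (\<exists>c. adjacent E c (hopf_state (a, b, p) S) (hopf_state (a', b', p') S'))"
      unfolding adj by blast
    then show ?thesis using False by (simp only: incidence_def if_False)
  qed
qed

text \<open>
  States that agree away from \<open>e\<close> differ at most in the sign of the circle through \<open>e\<close>, and this sign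
  is detected by \<open>\<tau>\<close>.
\<close>

lemma agree_away_equal_tau:
  assumes S: "S \<in> enhanced_states D" and S': "S' \<in> enhanced_states D"
  shows "tau D S' = tau D S \<Longrightarrow> agree_away S S' \<longleftrightarrow> S = S'"
    and "tau D S' = tau D S + 2 \<Longrightarrow> agree_away S S' \<longleftrightarrow> positive_at D e S' \<and> S = lower D e S'"
proof -
  have cases: "S = S' \<or> (positive_at D e S' \<and> S = lower D e S') \<or> (positive_at D e S \<and> S' = lower D e S)"
    if agree: "agree_away S S'"
  proof -
    have s: "fst S = fst S'" using agree by (simp add: agree_away_def)
    let ?c = "circle_of D (fst S) e"
    have "C \<in> snd S \<longleftrightarrow> C \<in> snd S'" if "C \<noteq> ?c" for C
      using that agree snd_subset[OF S, of C] snd_subset[OF S', of C] s circle_eq_circle_of[of C D "fst S" e]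
      unfolding agree_away_def by auto
    then have diff: "snd S - {?c} = snd S' - {?c}" by blast
    have "snd S = snd S'" if "?c \<in> snd S \<longleftrightarrow> ?c \<in> snd S'" using that diff by blast
    moreover have "snd S = snd S' - {?c}" if "?c \<notin> snd S" using that diff by blast
    moreover have "snd S' = snd S - {?c}" if "?c \<notin> snd S'" using that diff by blast
    ultimately show ?thesis using s unfolding positive_at_def lower_def prod_eq_iff by auto
  qed
  have tau_lower: "tau D T = tau D (lower D e T) + 2" if "T \<in> enhanced_states D" "positive_at D e T" for T
    using tau_raise[OF lower_enhanced[OF that(1)]] raise_lower[OF that(2)] by simp
  have refl: "agree_away S S" and low: "agree_away (lower D e S') S'"
    by (auto simp: agree_away_def lower_def)
  show "tau D S' = tau D S \<Longrightarrow> agree_away S S' \<longleftrightarrow> S = S'"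
    using cases tau_lower[OF S] tau_lower[OF S'] refl by auto
  show "tau D S' = tau D S + 2 \<Longrightarrow> agree_away S S' \<longleftrightarrow> positive_at D e S' \<and> S = lower D e S'"
    using cases tau_lower[OF S] low by auto
qed

section \<open>Adding and deleting the Hopf link\<close>

text \<open>
  For a circle \<open>C\<close> of \<open>D\<close> the set \<open>Old ` C\<close> is nonempty, so it lies in only one circle of the Hopf sum,
  which is the lift of \<open>C\<close>.
\<close>

lemma add_hopf_eq:
  assumes S: "S \<in> enhanced_states D"
  shows "add_hopf E S = hopf_state (False, False, False) S"
proof -
  have 1: "C' \<in> lift False False ` snd S"
    if C': "C' \<in> circles E (False # False # fst S)" and C: "C \<in> snd S" "Old ` C \<subseteq> C'" for C C'
  proof -
    obtain x where x: "x \<in> C" using snd_subset[OF S C(1)] circles_nonempty by blast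
    then obtain C1 where C1: "C1 \<in> circles D (fst S)" "C' = lift False False C1"
      using C' C(2) Old_notin_extra by (auto simp: circles_E)
    then have "x \<in> C1" using x C(2) Old_in_lift[OF circle_subset[OF C1(1)]] by blast
    then have "C = C1"
      using circle_eq_circle_of[OF C1(1)] circle_eq_circle_of[OF snd_subset[OF S C(1)] x] by simp
    then show ?thesis using C C1 by blast
  qed
  have 2: "lift False False C \<in> circles E (False # False # fst S)"
    "Old ` C \<subseteq> lift False False C" if "C \<in> snd S" for C
    using snd_subset[OF S that] Old_in_lift[OF circle_subset] by (auto simp: circles_E)
  have "{C' \<in> circles E (False # False # fst S). \<exists>C \<in> snd S. Old ` C \<subseteq> C'}
      = lift False False ` snd S"
  proof (intro equalityI subsetI)
    fix C' assume "C' \<in> {C' \<in> circles E (False # False # fst S). \<exists>C \<in> snd S. Old ` C \<subseteq> C'}"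
    then obtain C where "C' \<in> circles E (False # False # fst S)" "C \<in> snd S" "Old ` C \<subseteq> C'"
      by (elim CollectE conjE bexE)
    then show "C' \<in> lift False False ` snd S" by (rule 1)
  next
    fix C' assume "C' \<in> lift False False ` snd S"
    then obtain C where "C' = lift False False C" "C \<in> snd S" by (elim imageE)
    then show "C' \<in> {C' \<in> circles E (False # False # fst S). \<exists>C \<in> snd S. Old ` C \<subseteq> C'}"
      using 2[of C] by (intro CollectI conjI bexI[of _ C]) simp_all
  qed
  then show ?thesis by (simp add: add_hopf_def Let_def)
qed

lemma delete_hopf_eq:
  assumes S: "S \<in> enhanced_states D"
  shows "delete_hopf D (hopf_state k S) = S"
proof -
  obtain a b p where k: "k = (a, b, p)" by (cases k)
  have 1: "C \<in> snd S"
    if C: "C \<in> circles D (fst S)" and C': "C' \<in> snd (hopf_state k S)" "Old ` C \<subseteq> C'" for C C'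
  proof -
    obtain x where x: "x \<in> C" using circles_nonempty[OF C] by blast
    then obtain C1 where C1: "C1 \<in> snd S" "C' = lift a b C1"
      using C' Old_notin_extra by (auto simp: k split: if_splits)
    then have "x \<in> C1" using x C'(2) Old_in_lift[OF circle_subset[OF snd_subset[OF S C1(1)]]] by blast
    then have "C = C1"
      using circle_eq_circle_of[OF C x] circle_eq_circle_of[OF snd_subset[OF S C1(1)]] by simp
    then show ?thesis using C1 by simp
  qed
  have 2: "\<exists>C'\<in>snd (hopf_state k S). Old ` C \<subseteq> C'" if "C \<in> snd S" for C
    using that Old_in_lift[OF circle_subset[OF snd_subset[OF S that]]]
    by (intro bexI[of _ "lift a b C"]) (auto simp: k)
  have "{C \<in> circles D (fst S). \<exists>C'\<in>snd (hopf_state k S). Old ` C \<subseteq> C'} = snd S"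
    using 1 2 snd_subset[OF S] by blast
  then show ?thesis by (simp add: delete_hopf_def k prod_eq_iff)
qed

lemma extra_positive_hopf_state: "extra_positive (hopf_state (a, a, p) S) \<longleftrightarrow> p"
  using Mid_in_extra Mid_not_in_lift by (auto simp: extra_positive_def)

end

section \<open>The boundary map of a Hopf sum\<close>

lemma (in abelian_monoid) finsum_only:
  assumes "finite A" "a \<in> A" "f a \<in> carrier G" "\<And>x. x \<in> A \<Longrightarrow> x \<noteq> a \<Longrightarrow> f x = \<zero>"
  shows "(\<Oplus>x\<in>A. f x) = f a"
proof -
  have "(\<Oplus>x\<in>A. f x) = (\<Oplus>x\<in>A. if a = x then f x else \<zero>)"
    using assms(3,4) by (intro finsum_cong') auto
  also have "\<dots> = f a"
    by (rule finsum_singleton[OF assms(2,1)]) (use assms(3,4) in force)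
  finally show ?thesis .
qed

locale hopf_chains = hopf_addition D e E f v cs + pointed_diagram_over D e R
  for D :: "'e diagram" and e and E f v cs and R :: "('r, 'm) ring_scheme" (structure)
begin

definition part ::
  "bool \<times> bool \<times> bool \<Rightarrow> int \<Rightarrow> int \<Rightarrow> ('e hopf_edge enhanced_state \<Rightarrow> 'r) \<Rightarrow> 'e enhanced_state \<Rightarrow> 'r"
  where "part k i j y = (\<lambda>S\<in>generators D i j. y (hopf_state k S))"

lemma chain_E_closed: "y \<in> carrier (chains R E i j) \<Longrightarrow> T \<in> generators E i j \<Longrightarrow> y T \<in> carrier R"
  by (auto simp: free_module_simps)

lemma hopf_generator:
  assumes "S \<in> generators D i' j'" "i' = i - sigma_shift k" "j' = j - (sigma_shift k + 2 * tau_shift k)"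
  shows "hopf_state k S \<in> generators E i j"
  using assms hopf_state_generators[OF generators_enhanced[OF assms(1)]] by simp

lemma hopf_chain_closed:
  assumes "y \<in> carrier (chains R E i j)" "S \<in> generators D i' j'"
    "i' = i - sigma_shift k" "j' = j - (sigma_shift k + 2 * tau_shift k)"
  shows "y (hopf_state k S) \<in> carrier R"
  using chain_E_closed[OF assms(1)] hopf_generator[OF assms(2-4)] by blast

lemma part_closed:
  assumes "y \<in> carrier (chains R E i j)"
    "i' = i - sigma_shift k" "j' = j - (sigma_shift k + 2 * tau_shift k)"
  shows "part k i' j' y \<in> carrier (chains R D i' j')"
  using hopf_chain_closed[OF assms(1) _ assms(2,3)] by (auto simp: part_def free_module_simps)

definition contribution where
  "contribution i j y k T' =
     (\<Oplus>S\<in>sector_generators k i j. incidence R E (hopf_state k S) T' \<otimes> y (hopf_state k S))"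

lemma contribution_closed [simp]:
  "y \<in> carrier (chains R E i j) \<Longrightarrow> contribution i j y k T' \<in> carrier R"
  unfolding contribution_def by (rule finsum_closed) (auto intro: hopf_chain_closed)

lemma boundary_sectors:
  assumes y: "y \<in> carrier (chains R E i j)" and T': "T' \<in> generators E (i - 2) j"
  shows "boundary R E i j y T' = contribution i j y (True, True, True) T'
    \<oplus> (contribution i j y (True, True, False) T' \<oplus> (contribution i j y (True, False, False) T'
    \<oplus> (contribution i j y (False, True, False) T' \<oplus> (contribution i j y (False, False, True) T'
    \<oplus> contribution i j y (False, False, False) T'))))"
proof -
  let ?g = "\<lambda>T. incidence R E T T' \<otimes> y T"
  have g: "?g T \<in> carrier R" if "T \<in> generators E i j" for T
    using chain_E_closed[OF y that] by simp
  have gk: "?g \<in> hopf_state k ` sector_generators k i j \<rightarrow> carrier R" for k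
    using g[OF hopf_generator[OF _ refl refl]] by (intro funcsetI) (elim imageE, simp only:)
  have "boundary R E i j y T' = (\<Oplus>T\<in>(\<Union>k\<in>sectors. hopf_state k ` sector_generators k i j). ?g T)"
    unfolding boundary_apply[OF T'] generators_E[symmetric] by (rule refl)
  also have "\<dots> = (\<Oplus>k\<in>sectors. \<Oplus>T\<in>hopf_state k ` sector_generators k i j. ?g T)"
  proof (rule add.finprod_UN_disjoint)
    show "finite sectors" by (simp add: sectors_def)
    show "pairwise (\<lambda>k k'. disjnt (hopf_state k ` sector_generators k i j)
        (hopf_state k' ` sector_generators k' i j)) sectors"
    proof (intro pairwiseI)
      fix k k' assume k: "k \<in> sectors" "k' \<in> sectors" "k \<noteq> k'"
      have neq: "hopf_state k S \<noteq> hopf_state k' S'"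
        if "S \<in> sector_generators k i j" "S' \<in> sector_generators k' i j" for S S'
        using hopf_state_inject[OF k(1,2)] generators_enhanced that k(3) by blast
      show "disjnt (hopf_state k ` sector_generators k i j) (hopf_state k' ` sector_generators k' i j)"
        unfolding disjnt_def
      proof (rule equals0I)
        fix T assume "T \<in> hopf_state k ` sector_generators k i j \<inter> hopf_state k' ` sector_generators k' i j"
        then obtain S S' where "T = hopf_state k S" "S \<in> sector_generators k i j"
          "T = hopf_state k' S'" "S' \<in> sector_generators k' i j"
          by (elim IntE imageE)
        then show False using neq[of S S'] by simp
      qed
    qed
  qed (use funcset_mem[OF gk] in simp_all)
  also have "\<dots> = (\<Oplus>k\<in>sectors. contribution i j y k T')"
  proof (rule finsum_cong')
    fix k assume k: "k \<in> sectors"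
    show "(\<Oplus>T\<in>hopf_state k ` sector_generators k i j. ?g T) = contribution i j y k T'"
      unfolding contribution_def
    proof (rule finsum_reindex)
      show "inj_on (hopf_state k) (sector_generators k i j)"
        using hopf_state_inject[OF k k] generators_enhanced by (intro inj_onI) blast
      show "?g \<in> hopf_state k ` sector_generators k i j \<rightarrow> carrier R" by (rule gk)
    qed
  qed (use y in auto)
  also have "\<dots> = contribution i j y (True, True, True) T'
    \<oplus> (contribution i j y (True, True, False) T' \<oplus> (contribution i j y (True, False, False) T'
    \<oplus> (contribution i j y (False, True, False) T' \<oplus> (contribution i j y (False, False, True) T'
    \<oplus> contribution i j y (False, False, False) T'))))"
    using y by (simp add: sectors_def)
  finally show ?thesis .
qed

lemma contribution_same:
  assumes y: "y \<in> carrier (chains R E i j)" and S': "S' \<in> generators D (i' - 2) j'"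
    and ij: "i' = i - sigma_shift k" "j' = j - (sigma_shift k + 2 * tau_shift k)"
  shows "contribution i j y k (hopf_state k S') = boundary R D i' j' (part k i' j' y) S'"
proof -
  obtain a b p where k: "k = (a, b, p)" by (cases k)
  show ?thesis unfolding contribution_def boundary_apply[OF S'] ij[symmetric]
  proof (rule finsum_cong')
    fix S assume S: "S \<in> generators D i' j'"
    show "incidence R E (hopf_state k S) (hopf_state k S') \<otimes> y (hopf_state k S)
      = incidence R D S S' \<otimes> part k i' j' y S"
      using incidence_same_sector[OF generators_enhanced[OF S] generators_enhanced[OF S'], of a b p p R] S
      by (simp add: k part_def del: hopf_state.simps)
  qed (use part_closed[OF y ij] chain_closed in auto)
qed

lemma contribution_extra_sign:
  assumes y: "y \<in> carrier (chains R E i j)" and S': "S' \<in> generators D i' j'" and "p \<noteq> p'"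
  shows "contribution i j y (a, a, p) (hopf_state (a, a, p') S') = \<zero>"
  unfolding contribution_def
proof (rule add.finprod_one_eqI)
  fix S assume S: "S \<in> sector_generators (a, a, p) i j"
  show "incidence R E (hopf_state (a, a, p) S) (hopf_state (a, a, p') S') \<otimes> y (hopf_state (a, a, p) S) = \<zero>"
    using incidence_extra_sign[OF generators_enhanced[OF S] generators_enhanced[OF S'] assms(3), of R a]
      hopf_chain_closed[OF y S refl refl] by (simp del: hopf_state.simps)
qed

lemma sigma_agree_away: "agree_away S S' \<Longrightarrow> sigma S = sigma S'"
  by (simp add: agree_away_def sigma_def)

text \<open>
  A boundary term changes exactly one marker, from positive to negative.
\<close>

lemma contribution_skip:
  assumes y: "y \<in> carrier (chains R E i j)" and S': "S' \<in> sector_generators (a', b', p') (i - 2) j"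
    and ne: "(a, b) \<noteq> (a', b')" and shift: "sigma_shift (a, b, p) \<noteq> sigma_shift (a', b', p') + 2"
  shows "contribution i j y (a, b, p) (hopf_state (a', b', p') S') = \<zero>"
  unfolding contribution_def
proof (rule add.finprod_one_eqI)
  fix S assume S: "S \<in> sector_generators (a, b, p) i j"
  have "\<not> agree_away S S'"
    using sigma_agree_away[of S S'] sigma_generators[OF S] sigma_generators[OF S'] shift by linarith
  then show "incidence R E (hopf_state (a, b, p) S) (hopf_state (a', b', p') S')
      \<otimes> y (hopf_state (a, b, p) S) = \<zero>"
    using incidence_new_crossing[OF generators_enhanced[OF S] generators_enhanced[OF S'] ne, of R p p']
      hopf_chain_closed[OF y S refl refl] by (simp del: hopf_state.simps)
qed

definition crossing_sign where
  "crossing_sign a b a' S = (if a = a' \<or> b then marker_sign R S else \<ominus> marker_sign R S)"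

lemma incidence_step:
  assumes S: "S \<in> sector_generators (a, b, p) i j" and S': "S' \<in> sector_generators (a', b', p') (i - 2) j"
    and shift: "sigma_shift (a, b, p) = sigma_shift (a', b', p') + 2"
  shows "incidence R E (hopf_state (a, b, p) S) (hopf_state (a', b', p') S')
    = (if agree_away S S' then crossing_sign a b a' S' else \<zero>)"
proof -
  have "(a, b) \<noteq> (a', b')" "a = a' \<or> b = b'" using shift by (auto split: if_splits)
  then show ?thesis
    using incidence_new_crossing[OF generators_enhanced[OF S] generators_enhanced[OF S'], of a b a' b' R p p']
    by (simp add: crossing_sign_def marker_sign_def r_minus del: hopf_state.simps)
qed

lemma crossing_sign_closed [simp]: "crossing_sign a b a' S \<in> carrier R"
  by (simp add: crossing_sign_def)

text \<open>
  The relative grading of the two sectors leaves a single possible source.  In this lemma the circle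
  through \<open>e\<close> keeps its sign: \<open>1\<close> on the extra circle is merged into it, or \<open>X\<close> is split off.
\<close>

lemma contribution_equal:
  assumes y: "y \<in> carrier (chains R E i j)" and S': "S' \<in> sector_generators (a', b', p') (i - 2) j"
    and shift: "sigma_shift (a, b, p) = sigma_shift (a', b', p') + 2"
    and tau: "tau_shift (a', b', p') = tau_shift (a, b, p) + 1"
  shows "contribution i j y (a, b, p) (hopf_state (a', b', p') S')
    = crossing_sign a b a' S' \<otimes> y (hopf_state (a, b, p) S')"
proof -
  have same: "sector_generators (a', b', p') (i - 2) j = sector_generators (a, b, p) i j"
    unfolding shift tau by (simp add: algebra_simps)
  then have S: "S' \<in> sector_generators (a, b, p) i j" using S' by blast
  have inc: "incidence R E (hopf_state (a, b, p) S) (hopf_state (a', b', p') S')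
      = (if S = S' then crossing_sign a b a' S' else \<zero>)"
    if "S \<in> sector_generators (a, b, p) i j" for S
    using incidence_step[OF that S' shift] tau_generators[OF that] tau_generators[OF S]
      agree_away_equal_tau(1)[OF generators_enhanced[OF that] generators_enhanced[OF S']]
    by (simp del: hopf_state.simps)
  show ?thesis unfolding contribution_def
    by (subst finsum_only[of _ S'])
      (auto simp del: hopf_state.simps sigma_shift.simps tau_shift.simps
        simp: S inc hopf_chain_closed[OF y _ refl refl])
qed

text \<open>
  Here the circle through \<open>e\<close> becomes positive: \<open>X\<close> on the extra circle is merged into it, or \<open>1\<close> is
  split off.
\<close>

lemma contribution_lower:
  assumes y: "y \<in> carrier (chains R E i j)" and S': "S' \<in> sector_generators (a', b', p') (i - 2) j"
    and shift: "sigma_shift (a, b, p) = sigma_shift (a', b', p') + 2"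
    and tau: "tau_shift (a', b', p') = tau_shift (a, b, p) - 1"
  shows "contribution i j y (a, b, p) (hopf_state (a', b', p') S')
    = (if positive_at D e S' then crossing_sign a b a' S' \<otimes> y (hopf_state (a, b, p) (lower D e S')) else \<zero>)"
proof -
  let ?i = "i - sigma_shift (a, b, p)" and ?j = "j - (sigma_shift (a, b, p) + 2 * tau_shift (a, b, p))"
  have "sector_generators (a', b', p') (i - 2) j = generators D ?i (?j + 4)"
    unfolding shift tau by (simp add: algebra_simps)
  then have S4: "S' \<in> generators D ?i (?j + 4)" using S' by blast
  have inc: "incidence R E (hopf_state (a, b, p) S) (hopf_state (a', b', p') S')
      = (if positive_at D e S' \<and> S = lower D e S' then crossing_sign a b a' S' else \<zero>)"
    if "S \<in> sector_generators (a, b, p) i j" for S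
    using incidence_step[OF that S' shift] tau_generators[OF that] tau_generators[OF S4]
      agree_away_equal_tau(2)[OF generators_enhanced[OF that] generators_enhanced[OF S']]
    by (simp del: hopf_state.simps)
  show ?thesis
  proof (cases "positive_at D e S'")
    case True
    then have l: "lower D e S' \<in> sector_generators (a, b, p) i j" using lower_generators[OF S4] by simp
    show ?thesis unfolding contribution_def using True l
      by (subst finsum_only[of _ "lower D e S'"])
        (auto simp del: hopf_state.simps sigma_shift.simps tau_shift.simps
          simp: inc hopf_chain_closed[OF y _ refl refl])
  next
    case False
    have "contribution i j y (a, b, p) (hopf_state (a', b', p') S') = \<zero>"
      unfolding contribution_def
      by (rule add.finprod_one_eqI)
        (simp del: hopf_state.simps sigma_shift.simps tau_shift.simps
          add: inc False hopf_chain_closed[OF y _ refl refl])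
    then show ?thesis using False by simp
  qed
qed

text \<open>
  This is the formula \<open>(dp, dq, dt + \<epsilon>(q + Xp), du + \<epsilon>(q + Xp), dv + \<epsilon>(u - t), dw + \<epsilon>X(u - t))\<close>.  The
  signs of \<open>t\<close> and \<open>u\<close> differ because the change of the first new crossing passes the negative marker
  at the second one.
\<close>

lemma boundary_hopf:
  assumes y: "y \<in> carrier (chains R E i j)"
  shows "S \<in> generators D (i - 4) (j - 4) \<Longrightarrow> boundary R E i j y (hopf_state (True, True, True) S)
      = boundary R D (i - 2) (j - 4) (part (True, True, True) (i - 2) (j - 4) y) S"
    and "S \<in> generators D (i - 4) j \<Longrightarrow> boundary R E i j y (hopf_state (True, True, False) S)
      = boundary R D (i - 2) j (part (True, True, False) (i - 2) j y) S"
    and "S \<in> generators D (i - 2) j \<Longrightarrow> boundary R E i j y (hopf_state (True, False, False) S)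
      = marker_sign R S \<otimes> (base_action R D e (i - 2) (j - 4) (part (True, True, True) (i - 2) (j - 4) y) S
          \<oplus> y (hopf_state (True, True, False) S))
        \<oplus> boundary R D i j (part (True, False, False) i j y) S"
    and "S \<in> generators D (i - 2) j \<Longrightarrow> boundary R E i j y (hopf_state (False, True, False) S)
      = marker_sign R S \<otimes> (base_action R D e (i - 2) (j - 4) (part (True, True, True) (i - 2) (j - 4) y) S
          \<oplus> y (hopf_state (True, True, False) S))
        \<oplus> boundary R D i j (part (False, True, False) i j y) S"
    and "S \<in> generators D i j \<Longrightarrow> boundary R E i j y (hopf_state (False, False, True) S)
      = marker_sign R S \<otimes> (\<ominus> y (hopf_state (True, False, False) S) \<oplus> y (hopf_state (False, True, False) S))
        \<oplus> boundary R D (i + 2) j (part (False, False, True) (i + 2) j y) S"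
    and "S \<in> generators D i (j + 4) \<Longrightarrow> boundary R E i j y (hopf_state (False, False, False) S)
      = marker_sign R S \<otimes> (\<ominus> base_action R D e i j (part (True, False, False) i j y) S
          \<oplus> base_action R D e i j (part (False, True, False) i j y) S)
        \<oplus> boundary R D (i + 2) (j + 4) (part (False, False, False) (i + 2) (j + 4) y) S"
proof -
  \<comment> \<open>The local facts \<open>p\<close>, \<open>q\<close>, \<open>t\<close>, \<open>u\<close>, \<open>v\<close>, \<open>w\<close> evaluate the contributions of the six sectors in
    the order of the formula above.\<close>
  have b: "boundary R D i' j' (part k i' j' y) S \<in> carrier R"
    if "S \<in> generators D (i' - 2) j'" "i' = i - sigma_shift k" "j' = j - (sigma_shift k + 2 * tau_shift k)"
    for i' j' k
    using chain_closed[OF linear_mapsD(1)[OF boundary_linear part_closed[OF y that(2,3)]] that(1)] .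
  show "boundary R E i j y (hopf_state (True, True, True) S)
      = boundary R D (i - 2) (j - 4) (part (True, True, True) (i - 2) (j - 4) y) S"
    if S: "S \<in> generators D (i - 4) (j - 4)"
  proof -
    have Sx: "S \<in> sector_generators (True, True, True) (i - 2) j" using S by simp
    have T: "hopf_state (True, True, True) S \<in> generators E (i - 2) j" by (rule hopf_generator[OF Sx]) simp_all
    have same: "contribution i j y (True, True, True) (hopf_state (True, True, True) S)
        = boundary R D (i - 2) (j - 4) (part (True, True, True) (i - 2) (j - 4) y) S"
      by (rule contribution_same[OF y]) (use S in simp_all)
    have closed: "boundary R D (i - 2) (j - 4) (part (True, True, True) (i - 2) (j - 4) y) S \<in> carrier R"
      by (rule b) (use S in simp_all)
    have q: "contribution i j y (True, True, False) (hopf_state (True, True, True) S) = \<zero>" by (rule contribution_extra_sign[OF y S]) simp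
    have t: "contribution i j y (True, False, False) (hopf_state (True, True, True) S) = \<zero>" by (rule contribution_skip[OF y Sx]) simp_all
    have u: "contribution i j y (False, True, False) (hopf_state (True, True, True) S) = \<zero>" by (rule contribution_skip[OF y Sx]) simp_all
    have v: "contribution i j y (False, False, True) (hopf_state (True, True, True) S) = \<zero>" by (rule contribution_skip[OF y Sx]) simp_all
    have w: "contribution i j y (False, False, False) (hopf_state (True, True, True) S) = \<zero>" by (rule contribution_skip[OF y Sx]) simp_all
    show ?thesis unfolding boundary_sectors[OF y T] same q t u v w
      using closed 
      by (simp add: crossing_sign_def r_distr a_assoc l_minus r_minus del: hopf_state.simps)
  qed
  show "boundary R E i j y (hopf_state (True, True, False) S)
      = boundary R D (i - 2) j (part (True, True, False) (i - 2) j y) S"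
    if S: "S \<in> generators D (i - 4) (j)"
  proof -
    have Sx: "S \<in> sector_generators (True, True, False) (i - 2) j" using S by simp
    have T: "hopf_state (True, True, False) S \<in> generators E (i - 2) j" by (rule hopf_generator[OF Sx]) simp_all
    have same: "contribution i j y (True, True, False) (hopf_state (True, True, False) S)
        = boundary R D (i - 2) (j) (part (True, True, False) (i - 2) (j) y) S"
      by (rule contribution_same[OF y]) (use S in simp_all)
    have closed: "boundary R D (i - 2) (j) (part (True, True, False) (i - 2) (j) y) S \<in> carrier R"
      by (rule b) (use S in simp_all)
    have p: "contribution i j y (True, True, True) (hopf_state (True, True, False) S) = \<zero>" by (rule contribution_extra_sign[OF y S]) simp
    have t: "contribution i j y (True, False, False) (hopf_state (True, True, False) S) = \<zero>" by (rule contribution_skip[OF y Sx]) simp_all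
    have u: "contribution i j y (False, True, False) (hopf_state (True, True, False) S) = \<zero>" by (rule contribution_skip[OF y Sx]) simp_all
    have v: "contribution i j y (False, False, True) (hopf_state (True, True, False) S) = \<zero>" by (rule contribution_skip[OF y Sx]) simp_all
    have w: "contribution i j y (False, False, False) (hopf_state (True, True, False) S) = \<zero>" by (rule contribution_skip[OF y Sx]) simp_all
    show ?thesis unfolding boundary_sectors[OF y T] same p t u v w
      using closed 
      by (simp add: crossing_sign_def r_distr a_assoc l_minus r_minus del: hopf_state.simps)
  qed
  show "boundary R E i j y (hopf_state (True, False, False) S)
      = marker_sign R S \<otimes> (base_action R D e (i - 2) (j - 4) (part (True, True, True) (i - 2) (j - 4) y) S
          \<oplus> y (hopf_state (True, True, False) S))
        \<oplus> boundary R D i j (part (True, False, False) i j y) S"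
    if S: "S \<in> generators D (i - 2) (j)"
  proof -
    have Sx: "S \<in> sector_generators (True, False, False) (i - 2) j" using S by simp
    have T: "hopf_state (True, False, False) S \<in> generators E (i - 2) j" by (rule hopf_generator[OF Sx]) simp_all
    have same: "contribution i j y (True, False, False) (hopf_state (True, False, False) S)
        = boundary R D (i) (j) (part (True, False, False) (i) (j) y) S"
      by (rule contribution_same[OF y]) (use S in simp_all)
    have closed: "boundary R D (i) (j) (part (True, False, False) (i) (j) y) S \<in> carrier R"
      by (rule b) (use S in simp_all)
    have p_lower: "lower D e S \<in> generators D (i - 2) (j - 4)" if "positive_at D e S"
      by (rule lower_generators[OF _ that]) (use S in simp)
    have p_closed: "base_action R D e (i - 2) (j - 4) (part (True, True, True) (i - 2) (j - 4) y) S \<in> carrier R"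
      by (rule chain_closed[OF base_action_closed[OF part_closed[OF y]]]) (use S in simp_all)
    have "contribution i j y (True, True, True) (hopf_state (True, False, False) S)
        = (if positive_at D e S then crossing_sign True True True S \<otimes> y (hopf_state (True, True, True) (lower D e S)) else \<zero>)"
      by (rule contribution_lower[OF y Sx]) simp_all
    also have "\<dots> = crossing_sign True True True S \<otimes> base_action R D e (i - 2) (j - 4) (part (True, True, True) (i - 2) (j - 4) y) S"
      using S p_lower by (simp add: base_action_def part_def del: hopf_state.simps)
    finally have p: "contribution i j y (True, True, True) (hopf_state (True, False, False) S) = \<dots>" .
    have q: "contribution i j y (True, True, False) (hopf_state (True, False, False) S) = crossing_sign True True True S \<otimes> y (hopf_state (True, True, False) S)"
      by (rule contribution_equal[OF y Sx]) simp_all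
    have q_closed: "y (hopf_state (True, True, False) S) \<in> carrier R"
      by (rule hopf_chain_closed[OF y S]) simp_all
    have u: "contribution i j y (False, True, False) (hopf_state (True, False, False) S) = \<zero>" by (rule contribution_skip[OF y Sx]) simp_all
    have v: "contribution i j y (False, False, True) (hopf_state (True, False, False) S) = \<zero>" by (rule contribution_skip[OF y Sx]) simp_all
    have w: "contribution i j y (False, False, False) (hopf_state (True, False, False) S) = \<zero>" by (rule contribution_skip[OF y Sx]) simp_all
    show ?thesis unfolding boundary_sectors[OF y T] same p q u v w
      using closed p_closed q_closed
      by (simp add: crossing_sign_def r_distr a_assoc l_minus r_minus del: hopf_state.simps)
  qed
  show "boundary R E i j y (hopf_state (False, True, False) S)
      = marker_sign R S \<otimes> (base_action R D e (i - 2) (j - 4) (part (True, True, True) (i - 2) (j - 4) y) S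
          \<oplus> y (hopf_state (True, True, False) S))
        \<oplus> boundary R D i j (part (False, True, False) i j y) S"
    if S: "S \<in> generators D (i - 2) (j)"
  proof -
    have Sx: "S \<in> sector_generators (False, True, False) (i - 2) j" using S by simp
    have T: "hopf_state (False, True, False) S \<in> generators E (i - 2) j" by (rule hopf_generator[OF Sx]) simp_all
    have same: "contribution i j y (False, True, False) (hopf_state (False, True, False) S)
        = boundary R D (i) (j) (part (False, True, False) (i) (j) y) S"
      by (rule contribution_same[OF y]) (use S in simp_all)
    have closed: "boundary R D (i) (j) (part (False, True, False) (i) (j) y) S \<in> carrier R"
      by (rule b) (use S in simp_all)
    have p_lower: "lower D e S \<in> generators D (i - 2) (j - 4)" if "positive_at D e S"
      by (rule lower_generators[OF _ that]) (use S in simp)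
    have p_closed: "base_action R D e (i - 2) (j - 4) (part (True, True, True) (i - 2) (j - 4) y) S \<in> carrier R"
      by (rule chain_closed[OF base_action_closed[OF part_closed[OF y]]]) (use S in simp_all)
    have "contribution i j y (True, True, True) (hopf_state (False, True, False) S)
        = (if positive_at D e S then crossing_sign True True False S \<otimes> y (hopf_state (True, True, True) (lower D e S)) else \<zero>)"
      by (rule contribution_lower[OF y Sx]) simp_all
    also have "\<dots> = crossing_sign True True False S \<otimes> base_action R D e (i - 2) (j - 4) (part (True, True, True) (i - 2) (j - 4) y) S"
      using S p_lower by (simp add: base_action_def part_def del: hopf_state.simps)
    finally have p: "contribution i j y (True, True, True) (hopf_state (False, True, False) S) = \<dots>" .
    have q: "contribution i j y (True, True, False) (hopf_state (False, True, False) S) = crossing_sign True True False S \<otimes> y (hopf_state (True, True, False) S)"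
      by (rule contribution_equal[OF y Sx]) simp_all
    have q_closed: "y (hopf_state (True, True, False) S) \<in> carrier R"
      by (rule hopf_chain_closed[OF y S]) simp_all
    have t: "contribution i j y (True, False, False) (hopf_state (False, True, False) S) = \<zero>" by (rule contribution_skip[OF y Sx]) simp_all
    have v: "contribution i j y (False, False, True) (hopf_state (False, True, False) S) = \<zero>" by (rule contribution_skip[OF y Sx]) simp_all
    have w: "contribution i j y (False, False, False) (hopf_state (False, True, False) S) = \<zero>" by (rule contribution_skip[OF y Sx]) simp_all
    show ?thesis unfolding boundary_sectors[OF y T] same p q t v w
      using closed p_closed q_closed
      by (simp add: crossing_sign_def r_distr a_assoc l_minus r_minus del: hopf_state.simps)
  qed
  show "boundary R E i j y (hopf_state (False, False, True) S)
      = marker_sign R S \<otimes> (\<ominus> y (hopf_state (True, False, False) S) \<oplus> y (hopf_state (False, True, False) S))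
        \<oplus> boundary R D (i + 2) j (part (False, False, True) (i + 2) j y) S"
    if S: "S \<in> generators D (i) (j)"
  proof -
    have Sx: "S \<in> sector_generators (False, False, True) (i - 2) j" using S by simp
    have T: "hopf_state (False, False, True) S \<in> generators E (i - 2) j" by (rule hopf_generator[OF Sx]) simp_all
    have same: "contribution i j y (False, False, True) (hopf_state (False, False, True) S)
        = boundary R D (i + 2) (j) (part (False, False, True) (i + 2) (j) y) S"
      by (rule contribution_same[OF y]) (use S in simp_all)
    have closed: "boundary R D (i + 2) (j) (part (False, False, True) (i + 2) (j) y) S \<in> carrier R"
      by (rule b) (use S in simp_all)
    have p: "contribution i j y (True, True, True) (hopf_state (False, False, True) S) = \<zero>" by (rule contribution_skip[OF y Sx]) simp_all
    have q: "contribution i j y (True, True, False) (hopf_state (False, False, True) S) = \<zero>" by (rule contribution_skip[OF y Sx]) simp_all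
    have t: "contribution i j y (True, False, False) (hopf_state (False, False, True) S) = crossing_sign True False False S \<otimes> y (hopf_state (True, False, False) S)"
      by (rule contribution_equal[OF y Sx]) simp_all
    have t_closed: "y (hopf_state (True, False, False) S) \<in> carrier R"
      by (rule hopf_chain_closed[OF y S]) simp_all
    have u: "contribution i j y (False, True, False) (hopf_state (False, False, True) S) = crossing_sign False True False S \<otimes> y (hopf_state (False, True, False) S)"
      by (rule contribution_equal[OF y Sx]) simp_all
    have u_closed: "y (hopf_state (False, True, False) S) \<in> carrier R"
      by (rule hopf_chain_closed[OF y S]) simp_all
    have w: "contribution i j y (False, False, False) (hopf_state (False, False, True) S) = \<zero>" by (rule contribution_extra_sign[OF y S]) simp
    show ?thesis unfolding boundary_sectors[OF y T] same p q t u w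
      using closed t_closed u_closed
      by (simp add: crossing_sign_def r_distr a_assoc l_minus r_minus del: hopf_state.simps)
  qed
  show "boundary R E i j y (hopf_state (False, False, False) S)
      = marker_sign R S \<otimes> (\<ominus> base_action R D e i j (part (True, False, False) i j y) S
          \<oplus> base_action R D e i j (part (False, True, False) i j y) S)
        \<oplus> boundary R D (i + 2) (j + 4) (part (False, False, False) (i + 2) (j + 4) y) S"
    if S: "S \<in> generators D (i) (j + 4)"
  proof -
    have Sx: "S \<in> sector_generators (False, False, False) (i - 2) j" using S by simp
    have T: "hopf_state (False, False, False) S \<in> generators E (i - 2) j" by (rule hopf_generator[OF Sx]) simp_all
    have same: "contribution i j y (False, False, False) (hopf_state (False, False, False) S)
        = boundary R D (i + 2) (j + 4) (part (False, False, False) (i + 2) (j + 4) y) S"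
      by (rule contribution_same[OF y]) (use S in simp_all)
    have closed: "boundary R D (i + 2) (j + 4) (part (False, False, False) (i + 2) (j + 4) y) S \<in> carrier R"
      by (rule b) (use S in simp_all)
    have p: "contribution i j y (True, True, True) (hopf_state (False, False, False) S) = \<zero>" by (rule contribution_skip[OF y Sx]) simp_all
    have q: "contribution i j y (True, True, False) (hopf_state (False, False, False) S) = \<zero>" by (rule contribution_skip[OF y Sx]) simp_all
    have t_lower: "lower D e S \<in> generators D (i) (j)" if "positive_at D e S"
      by (rule lower_generators[OF _ that]) (use S in simp)
    have t_closed: "base_action R D e (i) (j) (part (True, False, False) (i) (j) y) S \<in> carrier R"
      by (rule chain_closed[OF base_action_closed[OF part_closed[OF y]]]) (use S in simp_all)
    have "contribution i j y (True, False, False) (hopf_state (False, False, False) S)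
        = (if positive_at D e S then crossing_sign True False False S \<otimes> y (hopf_state (True, False, False) (lower D e S)) else \<zero>)"
      by (rule contribution_lower[OF y Sx]) simp_all
    also have "\<dots> = crossing_sign True False False S \<otimes> base_action R D e (i) (j) (part (True, False, False) (i) (j) y) S"
      using S t_lower by (simp add: base_action_def part_def del: hopf_state.simps)
    finally have t: "contribution i j y (True, False, False) (hopf_state (False, False, False) S) = \<dots>" .
    have u_lower: "lower D e S \<in> generators D (i) (j)" if "positive_at D e S"
      by (rule lower_generators[OF _ that]) (use S in simp)
    have u_closed: "base_action R D e (i) (j) (part (False, True, False) (i) (j) y) S \<in> carrier R"
      by (rule chain_closed[OF base_action_closed[OF part_closed[OF y]]]) (use S in simp_all)
    have "contribution i j y (False, True, False) (hopf_state (False, False, False) S)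
        = (if positive_at D e S then crossing_sign False True False S \<otimes> y (hopf_state (False, True, False) (lower D e S)) else \<zero>)"
      by (rule contribution_lower[OF y Sx]) simp_all
    also have "\<dots> = crossing_sign False True False S \<otimes> base_action R D e (i) (j) (part (False, True, False) (i) (j) y) S"
      using S u_lower by (simp add: base_action_def part_def del: hopf_state.simps)
    finally have u: "contribution i j y (False, True, False) (hopf_state (False, False, False) S) = \<dots>" .
    have v: "contribution i j y (False, False, True) (hopf_state (False, False, False) S) = \<zero>" by (rule contribution_extra_sign[OF y S]) simp
    show ?thesis unfolding boundary_sectors[OF y T] same p q t u v
      using closed t_closed u_closed
      by (simp add: crossing_sign_def r_distr a_assoc l_minus r_minus del: hopf_state.simps)
  qed
qed

end

lemma khovanov_subquotient:
  assumes R: "cring R"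
  shows "subquotient R (chains R D i j) (cycles R D i j) (boundaries R D i j)"
proof -
  interpret cring R by fact
  have "submodule (cycles R D i j) R (chains R D i j)"
    unfolding cycles_def by (intro kernel_submodule module_free_module R boundary_linear)
  moreover have "submodule (boundaries R D i j) R (chains R D i j)"
    unfolding boundaries_def
    using image_submodule[OF module_free_module[OF R] module_free_module[OF R] boundary_linear[of D "i + 2" j]]
    by simp
  ultimately show ?thesis
    using module_free_module[OF R] by (simp add: subquotient_def subquotient_axioms_def)
qed

text \<open>
  A single homology group involves three consecutive degrees: \<open>f_down\<close> is where the boundary of a cycle
  vanishes, \<open>f_up\<close> is where boundaries come from.
\<close>

lemma khovanov_chain_map:
  assumes R: "cring R"
    and f: "f \<in> linear_maps R (chains R D i j) (chains R D' i' j')"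
    and f_down: "f_down \<in> linear_maps R (chains R D (i - 2) j) (chains R D' (i' - 2) j')"
    and f_up: "f_up \<in> linear_maps R (chains R D (i + 2) j) (chains R D' (i' + 2) j')"
    and commute: "\<And>x. x \<in> carrier (chains R D i j) \<Longrightarrow>
      boundary R D' i' j' (f x) = f_down (boundary R D i j x)"
    and commute_up: "\<And>x. x \<in> carrier (chains R D (i + 2) j) \<Longrightarrow>
      boundary R D' (i' + 2) j' (f_up x) = f (boundary R D (i + 2) j x)"
  shows "chain_map R (chains R D i j) (cycles R D i j) (boundaries R D i j)
    (chains R D' i' j') (cycles R D' i' j') (boundaries R D' i' j') f"
proof -
  note sub = khovanov_subquotient[OF R]
  show ?thesis
  proof (intro chain_map.intro chain_map_axioms.intro sub f)
    fix z assume "z \<in> cycles R D i j"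
    then have z: "z \<in> carrier (chains R D i j)" "boundary R D i j z = \<zero>\<^bsub>chains R D (i - 2) j\<^esub>"
      by (auto simp: cycles_def a_kernel_def')
    then have "boundary R D' i' j' (f z) = \<zero>\<^bsub>chains R D' (i' - 2) j'\<^esub>"
      using commute linear_maps_zero[OF f_down module_free_module[OF R] module_free_module[OF R]] by simp
    then show "f z \<in> cycles R D' i' j'"
      using linear_mapsD(1)[OF f z(1)] by (simp add: cycles_def a_kernel_def')
  next
    fix b assume "b \<in> boundaries R D i j"
    then show "f b \<in> boundaries R D' i' j'"
      using linear_mapsD(1)[OF f_up] by (auto simp: boundaries_def simp flip: commute_up)
  qed
qed

context hopf_chains
begin

section \<open>Maps between the chain complexes\<close>

lemma chain_E_eqI:
  assumes x: "x \<in> carrier (chains R E i j)" and y: "y \<in> carrier (chains R E i j)"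
    and "\<And>S. S \<in> generators D (i - 2) (j - 4) \<Longrightarrow> x (hopf_state (True, True, True) S) = y (hopf_state (True, True, True) S)"
    and "\<And>S. S \<in> generators D (i - 2) j \<Longrightarrow> x (hopf_state (True, True, False) S) = y (hopf_state (True, True, False) S)"
    and "\<And>S. S \<in> generators D i j \<Longrightarrow> x (hopf_state (True, False, False) S) = y (hopf_state (True, False, False) S)"
    and "\<And>S. S \<in> generators D i j \<Longrightarrow> x (hopf_state (False, True, False) S) = y (hopf_state (False, True, False) S)"
    and "\<And>S. S \<in> generators D (i + 2) j \<Longrightarrow> x (hopf_state (False, False, True) S) = y (hopf_state (False, False, True) S)"
    and "\<And>S. S \<in> generators D (i + 2) (j + 4) \<Longrightarrow> x (hopf_state (False, False, False) S) = y (hopf_state (False, False, False) S)"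
  shows "x = y"
proof (rule PiE_ext)
  show "x \<in> generators E i j \<rightarrow>\<^sub>E carrier R" "y \<in> generators E i j \<rightarrow>\<^sub>E carrier R"
    using x y by (simp_all add: free_module_simps)
  fix T assume "T \<in> generators E i j"
  then obtain k S where k: "k \<in> sectors" and S: "S \<in> sector_generators k i j" and T: "T = hopf_state k S"
    unfolding generators_E by blast
  show "x T = y T"
    using k S assms(3-8) unfolding T sectors_def insert_iff empty_iff
    by (elim disjE; simp del: hopf_state.simps)
qed

definition sector_of :: "'e hopf_edge enhanced_state \<Rightarrow> bool \<times> bool \<times> bool" where
  "sector_of T = (fst T ! 0, fst T ! 1, fst T ! 0 = fst T ! 1 \<and> extra_positive T)"

lemma sector_of_hopf_state: "k \<in> sectors \<Longrightarrow> sector_of (hopf_state k S) = k"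
  unfolding sectors_def insert_iff empty_iff
  by (elim disjE)
    (simp_all add: sector_of_def fst_hopf_state extra_positive_hopf_state del: hopf_state.simps)

text \<open>
  The inverse of taking components: the chain whose component in the sector \<open>k\<close> is \<open>g k\<close>.
\<close>

definition assemble ::
  "int \<Rightarrow> int \<Rightarrow> (bool \<times> bool \<times> bool \<Rightarrow> 'e enhanced_state \<Rightarrow> 'r) \<Rightarrow> 'e hopf_edge enhanced_state \<Rightarrow> 'r"
  where "assemble i j g = (\<lambda>T\<in>generators E i j. g (sector_of T) (delete_hopf D T))"

lemma assemble_apply:
  assumes "S \<in> generators D i' j'" "k \<in> sectors"
    "i' = i - sigma_shift k" "j' = j - (sigma_shift k + 2 * tau_shift k)"
  shows "assemble i j g (hopf_state k S) = g k S"
  using hopf_generator[OF assms(1,3,4)] sector_of_hopf_state[OF assms(2)]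
    delete_hopf_eq[OF generators_enhanced[OF assms(1)]]
  by (simp add: assemble_def del: hopf_state.simps)

lemma assemble_closed:
  assumes "\<And>k S. k \<in> sectors \<Longrightarrow> S \<in> sector_generators k i j \<Longrightarrow> g k S \<in> carrier R"
  shows "assemble i j g \<in> carrier (chains R E i j)"
proof -
  have "assemble i j g T \<in> carrier R" if T: "T \<in> generators E i j" for T
  proof -
    obtain k S where kS: "k \<in> sectors" "S \<in> sector_generators k i j" "T = hopf_state k S"
      using T unfolding generators_E by blast
    then show ?thesis using assemble_apply[OF kS(2,1) refl refl] assms by simp
  qed
  then show ?thesis by (auto simp: free_module_simps assemble_def)
qed

lemma boundary_zero:
  assumes "S \<in> generators D (i - 2) j" "\<And>S. S \<in> generators D i j \<Longrightarrow> z S = \<zero>"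
  shows "boundary R D i j z S = \<zero>"
  unfolding boundary_apply[OF assms(1)] by (rule add.finprod_one_eqI) (simp add: assms(2))

lemma boundary_cong:
  assumes "S \<in> generators D (i - 2) j" "\<And>S. S \<in> generators D i j \<Longrightarrow> z S = z' S"
    "z' \<in> carrier (chains R D i j)"
  shows "boundary R D i j z S = boundary R D i j z' S"
  unfolding boundary_apply[OF assms(1)]
  by (rule finsum_cong') (use assms(2,3) chain_closed in auto)

lemma boundary_E_closed:
  "y \<in> carrier (chains R E i j) \<Longrightarrow> boundary R E i j y \<in> carrier (chains R E (i - 2) j)"
  and boundary_D_closed:
  "x \<in> carrier (chains R D i j) \<Longrightarrow> boundary R D i j x \<in> carrier (chains R D (i - 2) j)"
  by (rule linear_mapsD(1)[OF boundary_linear]; assumption)+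

subsection \<open>Adding a Hopf link\<close>

lemma alpha_linear:
  "alpha_chain R D E i j \<in> linear_maps R (chains R D (i + 2) (j + 4)) (chains R E i j)"
  unfolding alpha_chain_def by (rule linear_extension_linear[OF is_cring]) simp

lemma alpha_apply:
  assumes x: "x \<in> carrier (chains R D (i + 2) (j + 4))" and S: "S \<in> generators D i' j'" and k: "k \<in> sectors"
    and ij: "i' = i - sigma_shift k" "j' = j - (sigma_shift k + 2 * tau_shift k)"
  shows "alpha_chain R D E i j x (hopf_state k S) = (if k = (False, False, False) then x S else \<zero>)"
proof -
  let ?f = "\<lambda>S'. (if hopf_state k S = add_hopf E S' then \<one> else \<zero>) \<otimes> x S'"
  have eq: "hopf_state k S = add_hopf E S' \<longleftrightarrow> k = (False, False, False) \<and> S = S'"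
    if "S' \<in> generators D (i + 2) (j + 4)" for S'
  proof -
    have "(False, False, False) \<in> sectors" by (simp add: sectors_def)
    then show ?thesis
      unfolding add_hopf_eq[OF generators_enhanced[OF that]]
      using hopf_state_inject[OF k _ generators_enhanced[OF S] generators_enhanced[OF that]] by blast
  qed
  have "alpha_chain R D E i j x (hopf_state k S) = (\<Oplus>S'\<in>generators D (i + 2) (j + 4). ?f S')"
    using hopf_generator[OF S ij] by (simp add: alpha_chain_def linear_extension_def del: hopf_state.simps)
  also have "\<dots> = (if k = (False, False, False) then x S else \<zero>)"
  proof (cases "k = (False, False, False)")
    case True
    then have "S \<in> generators D (i + 2) (j + 4)" using S ij by simp
    have "?f S' = \<zero>" if "S' \<in> generators D (i + 2) (j + 4)" "S' \<noteq> S" for S'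
      using eq[OF that(1)] that(2)[symmetric] chain_closed[OF x that(1)] by simp
    then have "(\<Oplus>S'\<in>generators D (i + 2) (j + 4). ?f S') = ?f S"
      using \<open>S \<in> generators D (i + 2) (j + 4)\<close> chain_closed[OF x] by (intro finsum_only) simp_all
    moreover have "hopf_state k S = add_hopf E S"
      using eq True \<open>S \<in> generators D (i + 2) (j + 4)\<close> by blast
    ultimately show ?thesis using True chain_closed[OF x \<open>S \<in> generators D (i + 2) (j + 4)\<close>] by simp
  next
    case False
    have "(\<Oplus>S'\<in>generators D (i + 2) (j + 4). ?f S') = \<zero>"
      by (rule add.finprod_one_eqI) (simp add: eq False chain_closed[OF x] del: hopf_state.simps)
    then show ?thesis using False by simp
  qed
  finally show ?thesis .
qed

lemma alpha_commute:
  assumes x: "x \<in> carrier (chains R D (i + 2) (j + 4))"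
  shows "boundary R E i j (alpha_chain R D E i j x)
    = alpha_chain R D E (i - 2) j (boundary R D (i + 2) (j + 4) x)"
proof (rule chain_E_eqI)
  let ?y = "alpha_chain R D E i j x" and ?z = "boundary R D (i + 2) (j + 4) x"
  have y: "?y \<in> carrier (chains R E i j)" using linear_mapsD(1)[OF alpha_linear x] .
  have z: "?z \<in> carrier (chains R D (i - 2 + 2) (j + 4))" using boundary_D_closed[OF x] by simp
  show "boundary R E i j ?y \<in> carrier (chains R E (i - 2) j)" using boundary_E_closed[OF y] .
  show "alpha_chain R D E (i - 2) j ?z \<in> carrier (chains R E (i - 2) j)" using linear_mapsD(1)[OF alpha_linear z] .
  note [simp del] = hopf_state.simps
  note [simp] = boundary_hopf[OF y] alpha_apply[OF x] alpha_apply[OF z] sectors_def part_def base_action_def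
    boundary_zero
  show "boundary R E i j ?y (hopf_state (True, True, True) S) = alpha_chain R D E (i - 2) j ?z (hopf_state (True, True, True) S)"
    if "S \<in> generators D (i - 2 - 2) (j - 4)" for S
    using that by simp
  show "boundary R E i j ?y (hopf_state (True, True, False) S) = alpha_chain R D E (i - 2) j ?z (hopf_state (True, True, False) S)"
    if "S \<in> generators D (i - 2 - 2) j" for S
    using that by simp
  show "boundary R E i j ?y (hopf_state (True, False, False) S) = alpha_chain R D E (i - 2) j ?z (hopf_state (True, False, False) S)"
    if "S \<in> generators D (i - 2) j" for S
    using that lower_generators[of S "i - 2" "j - 4"] by (cases "positive_at D e S") simp_all
  show "boundary R E i j ?y (hopf_state (False, True, False) S) = alpha_chain R D E (i - 2) j ?z (hopf_state (False, True, False) S)"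
    if "S \<in> generators D (i - 2) j" for S
    using that lower_generators[of S "i - 2" "j - 4"] by (cases "positive_at D e S") simp_all
  show "boundary R E i j ?y (hopf_state (False, False, True) S) = alpha_chain R D E (i - 2) j ?z (hopf_state (False, False, True) S)"
    if "S \<in> generators D (i - 2 + 2) j" for S
    using that by simp
  show "boundary R E i j ?y (hopf_state (False, False, False) S) = alpha_chain R D E (i - 2) j ?z (hopf_state (False, False, False) S)"
    if S: "S \<in> generators D (i - 2 + 2) (j + 4)" for S
  proof -
    have "boundary R D (i + 2) (j + 4) (part (False, False, False) (i + 2) (j + 4) ?y) S = ?z S"
      by (rule boundary_cong) (use S x in simp_all)
    then show ?thesis using S lower_generators[of S i j] chain_closed[OF z]
      by (cases "positive_at D e S") simp_all
  qed
qed

subsection \<open>Deleting a Hopf link\<close>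

lemma beta_linear:
  "beta_chain R D E i j \<in> linear_maps R (chains R E i j) (chains R D (i - 2) (j - 4))"
  unfolding beta_chain_def by (rule linear_extension_linear[OF is_cring]) simp

lemma beta_apply:
  assumes y: "y \<in> carrier (chains R E i j)" and S: "S \<in> generators D (i - 2) (j - 4)"
  shows "beta_chain R D E i j y S = y (hopf_state (True, True, True) S)"
proof -
  have eq: "take 2 (fst T) = [True, True] \<and> extra_positive T \<and> S = delete_hopf D T
      \<longleftrightarrow> T = hopf_state (True, True, True) S" if T: "T \<in> generators E i j" for T
  proof -
    obtain k S' where k: "k \<in> sectors" "S' \<in> enhanced_states D" "T = hopf_state k S'"
      using enhanced_state_cases[OF generators_enhanced[OF T]] .
    have "take 2 (fst T) = [True, True] \<and> extra_positive T \<longleftrightarrow> k = (True, True, True)"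
    proof -
      obtain a b p where abp: "k = (a, b, p)" by (cases k)
      show ?thesis unfolding k(3) abp using extra_positive_hopf_state[of a p S']
        by (cases "a = b") (auto simp: fst_hopf_state simp del: hopf_state.simps)
    qed
    moreover have "delete_hopf D T = S'" using delete_hopf_eq[OF k(2)] k(3) by blast
    moreover have "T = hopf_state (True, True, True) S \<longleftrightarrow> k = (True, True, True) \<and> S' = S"
    proof -
      have "(True, True, True) \<in> sectors" by (simp add: sectors_def)
      then show ?thesis
        unfolding k(3) using hopf_state_inject[OF k(1) _ k(2) generators_enhanced[OF S]] by blast
    qed
    ultimately show ?thesis by metis
  qed
  have T: "hopf_state (True, True, True) S \<in> generators E i j"
    by (rule hopf_generator[OF S]) simp_all
  have indicator: "(if b then \<one> else \<zero>) \<otimes> c = (if b then c else \<zero>)" if "c \<in> carrier R" for b c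
    using that by simp
  have "beta_chain R D E i j y S = (\<Oplus>T\<in>generators E i j.
      (if take 2 (fst T) = [True, True] \<and> extra_positive T \<and> S = delete_hopf D T then \<one> else \<zero>) \<otimes> y T)"
    using S by (simp add: beta_chain_def linear_extension_def)
  also have "\<dots> = (\<Oplus>T\<in>generators E i j. if T = hopf_state (True, True, True) S then y T else \<zero>)"
  proof (rule finsum_cong')
    fix T assume T: "T \<in> generators E i j"
    show "(if take 2 (fst T) = [True, True] \<and> extra_positive T \<and> S = delete_hopf D T then \<one> else \<zero>) \<otimes> y T
      = (if T = hopf_state (True, True, True) S then y T else \<zero>)"
      unfolding eq[OF T] using chain_E_closed[OF y T] by (rule indicator)
  qed (use chain_E_closed[OF y] in simp_all)
  also have "\<dots> = y (hopf_state (True, True, True) S)"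
    using T chain_E_closed[OF y T] by (subst finsum_only[OF _ T]) (simp_all del: hopf_state.simps)
  finally show ?thesis .
qed

lemma chain_D_eqI:
  assumes "x \<in> carrier (chains R D i j)" "y \<in> carrier (chains R D i j)"
    "\<And>S. S \<in> generators D i j \<Longrightarrow> x S = y S"
  shows "x = y"
  using assms by (auto simp: free_module_simps intro: PiE_ext)

lemma beta_commute:
  assumes y: "y \<in> carrier (chains R E i j)"
  shows "boundary R D (i - 2) (j - 4) (beta_chain R D E i j y)
    = beta_chain R D E (i - 2) j (boundary R E i j y)"
proof (rule chain_D_eqI)
  show "boundary R D (i - 2) (j - 4) (beta_chain R D E i j y) \<in> carrier (chains R D (i - 2 - 2) (j - 4))"
    by (intro boundary_D_closed linear_mapsD(1)[OF beta_linear] y)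
  show "beta_chain R D E (i - 2) j (boundary R E i j y) \<in> carrier (chains R D (i - 2 - 2) (j - 4))"
    by (intro boundary_E_closed linear_mapsD(1)[OF beta_linear] y)
  fix S assume S: "S \<in> generators D (i - 2 - 2) (j - 4)"
  have "boundary R D (i - 2) (j - 4) (beta_chain R D E i j y) S
      = boundary R D (i - 2) (j - 4) (part (True, True, True) (i - 2) (j - 4) y) S"
    by (rule boundary_cong[OF S])
      (auto simp: part_def beta_apply[OF y] simp del: hopf_state.simps intro!: part_closed[OF y, unfolded part_def])
  then show "boundary R D (i - 2) (j - 4) (beta_chain R D E i j y) S
      = beta_chain R D E (i - 2) j (boundary R E i j y) S"
    using S by (simp add: beta_apply[OF boundary_E_closed[OF y]] boundary_hopf[OF y] del: hopf_state.simps)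
qed

lemma boundary_uminus:
  assumes z: "z \<in> carrier (chains R D i j)" and S: "S \<in> generators D (i - 2) j"
  shows "boundary R D i j (\<lambda>S\<in>generators D i j. \<ominus> z S) S = \<ominus> boundary R D i j z S"
proof -
  have "(\<lambda>S\<in>generators D i j. \<ominus> z S) = (\<ominus> \<one>) \<odot>\<^bsub>chains R D i j\<^esub> z"
    using chain_closed[OF z] by (auto simp: free_module_simps l_minus intro!: restrict_ext)
  then show ?thesis
    using linear_mapsD(3)[OF boundary_linear, of "\<ominus> \<one>" z D i j] z S
      chain_closed[OF boundary_D_closed[OF z] S]
    by (simp add: free_module_simps(4) l_minus)
qed

lemma boundary_minus:
  assumes z: "z \<in> carrier (chains R D i j)" and z': "z' \<in> carrier (chains R D i j)"
    and S: "S \<in> generators D (i - 2) j"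
  shows "boundary R D i j (\<lambda>S\<in>generators D i j. z S \<ominus> z' S) S = boundary R D i j z S \<ominus> boundary R D i j z' S"
proof -
  let ?n = "\<lambda>S\<in>generators D i j. \<ominus> z' S"
  have n: "?n \<in> carrier (chains R D i j)" using chain_closed[OF z'] by (simp add: free_module_simps)
  have "(\<lambda>S\<in>generators D i j. z S \<ominus> z' S) = z \<oplus>\<^bsub>chains R D i j\<^esub> ?n"
    by (auto simp: free_module_simps minus_eq intro!: restrict_ext)
  then show ?thesis
    using linear_mapsD(2)[OF boundary_linear z n] S boundary_uminus[OF z' S]
    by (simp add: free_module_simps(3) minus_eq)
qed

lemma marker_sign_cancel [simp]:
  "c \<in> carrier R \<Longrightarrow> marker_sign R S \<otimes> (marker_sign R S \<otimes> c) = c"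
  by (simp flip: m_assoc)

subsection \<open>A retraction\<close>

text \<open>
  The map \<open>w - Xv\<close>.  Modulo the image of the splitting map, \<open>1 \<otimes> X\<close> equals \<open>-X \<otimes> 1\<close>, so the states with
  markers \<open>--\<close> and negative extra circle represent the whole cokernel; this is the projection onto
  them.
\<close>

definition retraction where
  "retraction i j y = (\<lambda>S\<in>generators D (i + 2) (j + 4). y (hopf_state (False, False, False) S)
     \<ominus> base_action R D e (i + 2) j (part (False, False, True) (i + 2) j y) S)"

lemma part_chains:
  assumes y: "y \<in> carrier (chains R E i j)"
  shows "part (True, True, True) (i - 2) (j - 4) y \<in> carrier (chains R D (i - 2) (j - 4))"
    "part (True, True, False) (i - 2) j y \<in> carrier (chains R D (i - 2) j)"
    "part (True, False, False) i j y \<in> carrier (chains R D i j)"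
    "part (False, True, False) i j y \<in> carrier (chains R D i j)"
    "part (False, False, True) (i + 2) j y \<in> carrier (chains R D (i + 2) j)"
    "part (False, False, False) (i + 2) (j + 4) y \<in> carrier (chains R D (i + 2) (j + 4))"
  by (rule part_closed[OF y]; simp)+

lemma retraction_eq:
  "retraction i j y = (\<lambda>S\<in>generators D (i + 2) (j + 4). part (False, False, False) (i + 2) (j + 4) y S
     \<ominus> base_action R D e (i + 2) j (part (False, False, True) (i + 2) j y) S)"
  by (auto simp: retraction_def part_def simp del: hopf_state.simps intro!: restrict_ext)

lemma retraction_closed:
  assumes y: "y \<in> carrier (chains R E i j)"
  shows "retraction i j y \<in> carrier (chains R D (i + 2) (j + 4))"
  using chain_closed[OF part_chains(6)[OF y]] chain_closed[OF base_action_closed[OF part_chains(5)[OF y]]]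
  by (simp add: retraction_eq free_module_simps)

lemma retraction_linear:
  "retraction i j \<in> linear_maps R (chains R E i j) (chains R D (i + 2) (j + 4))"
proof (rule linear_mapsI)
  have l: "lower D e S \<in> generators D (i + 2) j" if "S \<in> generators D (i + 2) (j + 4)" "positive_at D e S" for S
    using lower_generators that .
  have g: "hopf_state (False, False, False) S \<in> generators E i j" if "S \<in> generators D (i + 2) (j + 4)" for S
    by (rule hopf_generator[OF that]) simp_all
  have g': "hopf_state (False, False, True) (lower D e S) \<in> generators E i j"
    if "S \<in> generators D (i + 2) (j + 4)" "positive_at D e S" for S
    by (rule hopf_generator[OF l[OF that]]) simp_all
  note [simp del] = hopf_state.simps
  note simps = retraction_def base_action_def part_def free_module_simps(3,4) g g' l
  fix y assume y: "y \<in> carrier (chains R E i j)"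
  show "retraction i j y \<in> carrier (chains R D (i + 2) (j + 4))" using retraction_closed[OF y] .
  note yc = chain_E_closed[OF y]
  {
    fix y' assume y': "y' \<in> carrier (chains R E i j)"
    note yc' = chain_E_closed[OF y']
    show "retraction i j (y \<oplus>\<^bsub>chains R E i j\<^esub> y')
        = retraction i j y \<oplus>\<^bsub>chains R D (i + 2) (j + 4)\<^esub> retraction i j y'"
    proof
      fix S
      show "retraction i j (y \<oplus>\<^bsub>chains R E i j\<^esub> y') S
        = (retraction i j y \<oplus>\<^bsub>chains R D (i + 2) (j + 4)\<^esub> retraction i j y') S"
        using yc[OF g] yc[OF g'] yc'[OF g] yc'[OF g']
        by (cases "S \<in> generators D (i + 2) (j + 4)"; cases "positive_at D e S")
          (simp_all add: simps minus_eq minus_add a_ac)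
    qed
  next
    fix a assume a: "a \<in> carrier R"
    show "retraction i j (a \<odot>\<^bsub>chains R E i j\<^esub> y) = a \<odot>\<^bsub>chains R D (i + 2) (j + 4)\<^esub> retraction i j y"
    proof
      fix S
      show "retraction i j (a \<odot>\<^bsub>chains R E i j\<^esub> y) S = (a \<odot>\<^bsub>chains R D (i + 2) (j + 4)\<^esub> retraction i j y) S"
        using yc[OF g] yc[OF g'] a
        by (cases "S \<in> generators D (i + 2) (j + 4)"; cases "positive_at D e S")
          (simp_all add: simps minus_eq r_distr r_minus)
    qed
  }
qed

text \<open>
  The terms \<open>\<epsilon>X(u - t)\<close> of \<open>d\<close> in the last component and \<open>X\<close> applied to \<open>\<epsilon>(u - t)\<close> cancel, and \<open>X\<close>
  commutes with \<open>d\<close>.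
\<close>

lemma retraction_commute:
  assumes y: "y \<in> carrier (chains R E i j)"
  shows "boundary R D (i + 2) (j + 4) (retraction i j y) = retraction (i - 2) j (boundary R E i j y)"
proof (rule chain_D_eqI)
  show "boundary R D (i + 2) (j + 4) (retraction i j y) \<in> carrier (chains R D (i + 2 - 2) (j + 4))"
    by (rule boundary_D_closed[OF retraction_closed[OF y]])
  show "retraction (i - 2) j (boundary R E i j y) \<in> carrier (chains R D (i + 2 - 2) (j + 4))"
    using retraction_closed[OF boundary_E_closed[OF y]] by simp
  fix S assume S: "S \<in> generators D (i + 2 - 2) (j + 4)"
  then have S': "S \<in> generators D i (j + 4)" by simp
  let ?v = "part (False, False, True) (i + 2) j y" and ?w = "part (False, False, False) (i + 2) (j + 4) y"
  let ?t = "part (True, False, False) i j y" and ?u = "part (False, True, False) i j y"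
  note parts = part_chains[OF y]
  have dw: "boundary R D (i + 2) (j + 4) ?w S \<in> carrier R"
    by (rule chain_closed[OF boundary_D_closed[OF parts(6)] S])
  have "boundary R D (i + 2) (j + 4) (retraction i j y) S
      = boundary R D (i + 2) (j + 4) ?w S \<ominus> boundary R D (i + 2) (j + 4) (base_action R D e (i + 2) j ?v) S"
    unfolding retraction_eq by (rule boundary_minus[OF parts(6) base_action_closed[OF parts(5)] S])
  also have "\<dots> = boundary R D (i + 2) (j + 4) ?w S \<ominus> base_action R D e i j (boundary R D (i + 2) j ?v) S"
    using base_action_boundary[OF parts(5)] by simp
  also have "\<dots> = retraction (i - 2) j (boundary R E i j y) S"
  proof (cases "positive_at D e S")
    case True
    then have l: "lower D e S \<in> generators D i j" using lower_generators[OF S'] by simp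
    have "?t (lower D e S) \<in> carrier R" "?u (lower D e S) \<in> carrier R"
      using chain_closed[OF parts(3) l] chain_closed[OF parts(4) l] .
    moreover have "boundary R D (i + 2) j ?v (lower D e S) \<in> carrier R"
      using chain_closed[OF boundary_D_closed[OF parts(5)]] l by simp
    ultimately show ?thesis using S' True l dw
      by (simp add: retraction_def base_action_def part_def[of "(False, False, True)" i] boundary_hopf[OF y]
          part_def[of "(True, False, False)"] part_def[of "(False, True, False)"]
          minus_eq minus_add a_ac r_neg r_neg2 r_neg1 del: hopf_state.simps)
  next
    case False
    then show ?thesis using S' dw
      by (simp add: retraction_def base_action_def boundary_hopf[OF y] minus_eq del: hopf_state.simps)
  qed
  finally show "boundary R D (i + 2) (j + 4) (retraction i j y) S = retraction (i - 2) j (boundary R E i j y) S" .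
qed

subsection \<open>A section\<close>

text \<open>
  The map \<open>p \<mapsto> (p, -Xp, 0, 0, 0, 0)\<close>, that is \<open>x \<mapsto> x \<otimes> X - Xx \<otimes> 1\<close>, onto the kernel of the merging map.
\<close>

definition split_map where
  "split_map i j x = assemble i j (\<lambda>k S. if k = (True, True, True) then x S
     else if k = (True, True, False) then \<ominus> base_action R D e (i - 2) (j - 4) x S else \<zero>)"

lemma split_map_apply:
  "S \<in> generators D (i - 2) (j - 4) \<Longrightarrow> split_map i j x (hopf_state (True, True, True) S) = x S"
  "S \<in> generators D (i - 2) j \<Longrightarrow> split_map i j x (hopf_state (True, True, False) S)
    = \<ominus> base_action R D e (i - 2) (j - 4) x S"
  "S \<in> generators D i j \<Longrightarrow> split_map i j x (hopf_state (True, False, False) S) = \<zero>"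
  "S \<in> generators D i j \<Longrightarrow> split_map i j x (hopf_state (False, True, False) S) = \<zero>"
  "S \<in> generators D (i + 2) j \<Longrightarrow> split_map i j x (hopf_state (False, False, True) S) = \<zero>"
  "S \<in> generators D (i + 2) (j + 4) \<Longrightarrow> split_map i j x (hopf_state (False, False, False) S) = \<zero>"
  unfolding split_map_def by (subst assemble_apply; simp add: sectors_def)+

lemma split_map_closed:
  assumes x: "x \<in> carrier (chains R D (i - 2) (j - 4))"
  shows "split_map i j x \<in> carrier (chains R E i j)"
  unfolding split_map_def
  using chain_closed[OF x] chain_closed[OF base_action_closed[OF x]]
  by (intro assemble_closed) (simp add: sectors_def; elim disjE; simp)

lemma chain_E_plus:
  "T \<in> generators E i j \<Longrightarrow> (y \<oplus>\<^bsub>chains R E i j\<^esub> y') T = y T \<oplus> y' T"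
  "T \<in> generators E i j \<Longrightarrow> (a \<odot>\<^bsub>chains R E i j\<^esub> y) T = a \<otimes> y T"
  by (simp_all add: free_module_simps)

lemma hopf_generators:
  "S \<in> generators D (i - 2) (j - 4) \<Longrightarrow> hopf_state (True, True, True) S \<in> generators E i j"
  "S \<in> generators D (i - 2) j \<Longrightarrow> hopf_state (True, True, False) S \<in> generators E i j"
  "S \<in> generators D i j \<Longrightarrow> hopf_state (True, False, False) S \<in> generators E i j"
  "S \<in> generators D i j \<Longrightarrow> hopf_state (False, True, False) S \<in> generators E i j"
  "S \<in> generators D (i + 2) j \<Longrightarrow> hopf_state (False, False, True) S \<in> generators E i j"
  "S \<in> generators D (i + 2) (j + 4) \<Longrightarrow> hopf_state (False, False, False) S \<in> generators E i j"
  by (erule hopf_generator; simp)+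

lemma split_map_linear:
  "split_map i j \<in> linear_maps R (chains R D (i - 2) (j - 4)) (chains R E i j)"
proof (rule linear_mapsI)
  let ?D = "chains R D (i - 2) (j - 4)" and ?E = "chains R E i j"
  interpret M: module R ?D by (rule module_free_module[OF is_cring])
  interpret N: module R ?E by (rule module_free_module[OF is_cring])
  note [simp del] = hopf_state.simps
  have l: "lower D e S \<in> generators D (i - 2) (j - 4)" if "S \<in> generators D (i - 2) j" "positive_at D e S" for S
    using lower_generators[of S "i - 2" "j - 4"] that by simp
  fix x assume x: "x \<in> carrier ?D"
  show "split_map i j x \<in> carrier ?E" by (rule split_map_closed[OF x])
  {
    fix x' assume x': "x' \<in> carrier ?D"
    show "split_map i j (x \<oplus>\<^bsub>?D\<^esub> x') = split_map i j x \<oplus>\<^bsub>?E\<^esub> split_map i j x'"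
    proof (rule chain_E_eqI)
      show "split_map i j (x \<oplus>\<^bsub>?D\<^esub> x') \<in> carrier ?E"
        "split_map i j x \<oplus>\<^bsub>?E\<^esub> split_map i j x' \<in> carrier ?E"
        using x x' by (simp_all add: split_map_closed)
      fix S assume S: "S \<in> generators D (i - 2) j"
      show "split_map i j (x \<oplus>\<^bsub>?D\<^esub> x') (hopf_state (True, True, False) S)
          = (split_map i j x \<oplus>\<^bsub>?E\<^esub> split_map i j x') (hopf_state (True, True, False) S)"
        using S l[OF S] chain_closed[OF x] chain_closed[OF x']
        by (cases "positive_at D e S") (simp_all add: chain_E_plus hopf_generators split_map_apply
            base_action_def free_module_simps(3) minus_add)
    qed (simp_all add: chain_E_plus hopf_generators split_map_apply free_module_simps(3))
  next
    fix a assume a: "a \<in> carrier R"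
    show "split_map i j (a \<odot>\<^bsub>?D\<^esub> x) = a \<odot>\<^bsub>?E\<^esub> split_map i j x"
    proof (rule chain_E_eqI)
      show "split_map i j (a \<odot>\<^bsub>?D\<^esub> x) \<in> carrier ?E"
        "a \<odot>\<^bsub>?E\<^esub> split_map i j x \<in> carrier ?E"
        using x a by (simp_all add: split_map_closed)
      fix S assume S: "S \<in> generators D (i - 2) j"
      show "split_map i j (a \<odot>\<^bsub>?D\<^esub> x) (hopf_state (True, True, False) S)
          = (a \<odot>\<^bsub>?E\<^esub> split_map i j x) (hopf_state (True, True, False) S)"
        using S l[OF S] chain_closed[OF x] a
        by (cases "positive_at D e S") (simp_all add: chain_E_plus hopf_generators split_map_apply
            base_action_def free_module_simps(4) r_minus)
    qed (simp_all add: a chain_E_plus hopf_generators split_map_apply free_module_simps(4))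
  }
qed

lemma base_action_cong:
  assumes "\<And>S. S \<in> generators D i j \<Longrightarrow> z S = z' S"
  shows "base_action R D e i j z = base_action R D e i j z'"
  using assms lower_generators by (fastforce simp: base_action_def intro: restrict_ext)

lemma base_action_zero:
  assumes "S \<in> generators D i (j + 4)" "\<And>S. S \<in> generators D i j \<Longrightarrow> z S = \<zero>"
  shows "base_action R D e i j z S = \<zero>"
  using assms lower_generators[of S i j] by (simp add: base_action_def)

text \<open>
  The merging terms \<open>\<epsilon>(q + Xp)\<close> vanish for \<open>q = -Xp\<close>, and \<open>X\<close> commutes with \<open>d\<close>.
\<close>

lemma split_map_commute:
  assumes x: "x \<in> carrier (chains R D (i - 2) (j - 4))"
  shows "boundary R E i j (split_map i j x) = split_map (i - 2) j (boundary R D (i - 2) (j - 4) x)"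
proof (rule chain_E_eqI)
  let ?y = "split_map i j x" and ?z = "boundary R D (i - 2) (j - 4) x" and ?X = "base_action R D e (i - 2) (j - 4) x"
  have y: "?y \<in> carrier (chains R E i j)" by (rule split_map_closed[OF x])
  have z: "?z \<in> carrier (chains R D (i - 2 - 2) (j - 4))" by (rule boundary_D_closed[OF x])
  have X: "?X \<in> carrier (chains R D (i - 2) j)" using base_action_closed[OF x] by simp
  show "boundary R E i j ?y \<in> carrier (chains R E (i - 2) j)" by (rule boundary_E_closed[OF y])
  show "split_map (i - 2) j ?z \<in> carrier (chains R E (i - 2) j)" by (rule split_map_closed[OF z])
  note [simp del] = hopf_state.simps
  have p: "base_action R D e (i - 2) (j - 4) (part (True, True, True) (i - 2) (j - 4) ?y) = ?X"
    by (rule base_action_cong) (simp add: part_def split_map_apply)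
  {
    fix S assume S: "S \<in> generators D (i - 2 - 2) (j - 4)"
    have "boundary R D (i - 2) (j - 4) (part (True, True, True) (i - 2) (j - 4) ?y) S = ?z S"
      by (rule boundary_cong[OF S _ x]) (simp add: part_def split_map_apply)
    then show "boundary R E i j ?y (hopf_state (True, True, True) S) = split_map (i - 2) j ?z (hopf_state (True, True, True) S)"
      using S split_map_apply(1)[OF S] by (simp add: boundary_hopf[OF y])
  next
    fix S assume S: "S \<in> generators D (i - 2 - 2) j"
    have "boundary R D (i - 2) j (part (True, True, False) (i - 2) j ?y) S
        = boundary R D (i - 2) j (\<lambda>S\<in>generators D (i - 2) j. \<ominus> ?X S) S"
      by (rule boundary_cong[OF S])
        (use chain_closed[OF X] in \<open>simp_all add: part_def split_map_apply free_module_simps\<close>)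
    also have "\<dots> = \<ominus> boundary R D (i - 2) j ?X S" by (rule boundary_uminus[OF X S])
    also have "\<dots> = \<ominus> base_action R D e (i - 2 - 2) (j - 4) ?z S" using base_action_boundary[OF x] by simp
    finally show "boundary R E i j ?y (hopf_state (True, True, False) S) = split_map (i - 2) j ?z (hopf_state (True, True, False) S)"
      using S split_map_apply(2)[OF S, of ?z] by (simp add: boundary_hopf[OF y])
  next
    fix S assume S: "S \<in> generators D (i - 2) j"
    have Xc: "?X S \<in> carrier R" by (rule chain_closed[OF X S])
    have zero: "boundary R D i j (part (True, False, False) i j ?y) S = \<zero>"
      "boundary R D i j (part (False, True, False) i j ?y) S = \<zero>"
      by (rule boundary_zero[OF S]; simp add: part_def split_map_apply)+
    show "boundary R E i j ?y (hopf_state (True, False, False) S) = split_map (i - 2) j ?z (hopf_state (True, False, False) S)"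
      using S Xc by (simp add: boundary_hopf[OF y] p zero split_map_apply r_neg)
    show "boundary R E i j ?y (hopf_state (False, True, False) S) = split_map (i - 2) j ?z (hopf_state (False, True, False) S)"
      using S Xc by (simp add: boundary_hopf[OF y] p zero split_map_apply r_neg)
  next
    fix S assume S: "S \<in> generators D (i - 2 + 2) j"
    have zero: "boundary R D (i + 2) j (part (False, False, True) (i + 2) j ?y) S = \<zero>"
      by (rule boundary_zero) (use S in \<open>simp_all add: part_def split_map_apply\<close>)
    show "boundary R E i j ?y (hopf_state (False, False, True) S) = split_map (i - 2) j ?z (hopf_state (False, False, True) S)"
      using S split_map_apply(5)[OF S] by (simp add: boundary_hopf[OF y] zero split_map_apply)
  next
    fix S assume S: "S \<in> generators D (i - 2 + 2) (j + 4)"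
    have zero: "boundary R D (i + 2) (j + 4) (part (False, False, False) (i + 2) (j + 4) ?y) S = \<zero>"
      by (rule boundary_zero) (use S in \<open>simp_all add: part_def split_map_apply\<close>)
    have zero': "base_action R D e i j (part (True, False, False) i j ?y) S = \<zero>"
      "base_action R D e i j (part (False, True, False) i j ?y) S = \<zero>"
      by (rule base_action_zero; use S in \<open>simp add: part_def split_map_apply\<close>)+
    show "boundary R E i j ?y (hopf_state (False, False, False) S) = split_map (i - 2) j ?z (hopf_state (False, False, False) S)"
      using S split_map_apply(6)[OF S] by (simp add: boundary_hopf[OF y] zero zero')
  }
qed

subsection \<open>The homotopy\<close>

text \<open>
  The map \<open>(0, \<epsilon>t, 0, \<epsilon>v, 0, 0)\<close>.  It uses that merging with \<open>1\<close> on the extra circle is invertible, and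
  that splitting followed by the coefficient of \<open>X\<close> on the extra circle is invertible.
\<close>

definition homotopy where
  "homotopy i j y = assemble (i + 2) j (\<lambda>k S.
     if k = (True, True, False) then marker_sign R S \<otimes> y (hopf_state (True, False, False) S)
     else if k = (False, True, False) then marker_sign R S \<otimes> y (hopf_state (False, False, True) S)
     else \<zero>)"

lemma homotopy_apply:
  "S \<in> generators D i (j - 4) \<Longrightarrow> homotopy i j y (hopf_state (True, True, True) S) = \<zero>"
  "S \<in> generators D i j \<Longrightarrow> homotopy i j y (hopf_state (True, True, False) S)
    = marker_sign R S \<otimes> y (hopf_state (True, False, False) S)"
  "S \<in> generators D (i + 2) j \<Longrightarrow> homotopy i j y (hopf_state (True, False, False) S) = \<zero>"
  "S \<in> generators D (i + 2) j \<Longrightarrow> homotopy i j y (hopf_state (False, True, False) S)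
    = marker_sign R S \<otimes> y (hopf_state (False, False, True) S)"
  "S \<in> generators D (i + 4) j \<Longrightarrow> homotopy i j y (hopf_state (False, False, True) S) = \<zero>"
  "S \<in> generators D (i + 4) (j + 4) \<Longrightarrow> homotopy i j y (hopf_state (False, False, False) S) = \<zero>"
  unfolding homotopy_def
  by (rule trans[OF assemble_apply], assumption; simp add: sectors_def del: hopf_state.simps)+

lemma homotopy_closed:
  assumes y: "y \<in> carrier (chains R E i j)"
  shows "homotopy i j y \<in> carrier (chains R E (i + 2) j)"
  unfolding homotopy_def
  using chain_E_closed[OF y] hopf_generators(3,5)[of _ i j]
  by (intro assemble_closed) (simp add: sectors_def del: hopf_state.simps; elim disjE; simp del: hopf_state.simps)

lemma sign_solve:
  assumes "a \<in> carrier R" "d \<in> carrier R" "marker_sign R S \<otimes> a \<oplus> d = \<zero>"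
  shows "\<ominus> (marker_sign R S \<otimes> d) = a"
proof -
  have "d = \<ominus> (marker_sign R S \<otimes> a)" using assms by (metis add.inv_comm add.inv_equality m_closed marker_sign_closed)
  then show ?thesis using assms(1) by (simp add: r_minus)
qed

text \<open>
  The identity \<open>d h + h d = 1 - \<alpha> r - s \<beta>\<close>, evaluated on a cycle.  In the components \<open>q\<close> and \<open>u\<close> the term
  \<open>d \<epsilon> t\<close> or \<open>d \<epsilon> v\<close> remains; it is expressed by the other components through \<open>d y = 0\<close>, read off in the
  components \<open>t\<close> and \<open>v\<close> respectively.
\<close>

lemma cycle_decomposition:
  assumes "y \<in> cycles R E i j"
  shows "y = boundary R E (i + 2) j (homotopy i j y) \<oplus>\<^bsub>chains R E i j\<^esub>
    (alpha_chain R D E i j (retraction i j y) \<oplus>\<^bsub>chains R E i j\<^esub> split_map i j (beta_chain R D E i j y))"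
proof (rule chain_E_eqI)
  let ?h = "homotopy i j y" and ?a = "alpha_chain R D E i j (retraction i j y)"
  let ?b = "beta_chain R D E i j y"
  let ?s = "split_map i j ?b"
  have y: "y \<in> carrier (chains R E i j)" and dy: "boundary R E i j y = \<zero>\<^bsub>chains R E (i - 2) j\<^esub>"
    using assms by (auto simp: cycles_def a_kernel_def')
  have cycle: "boundary R E i j y T = \<zero>" if "T \<in> generators E (i - 2) j" for T
    using dy that by (simp add: free_module_simps)
  interpret E: module R "chains R E i j" by (rule module_free_module[OF is_cring])
  have h: "?h \<in> carrier (chains R E (i + 2) j)" by (rule homotopy_closed[OF y])
  have dh: "boundary R E (i + 2) j ?h \<in> carrier (chains R E i j)" using boundary_E_closed[OF h] by simp
  have r: "retraction i j y \<in> carrier (chains R D (i + 2) (j + 4))" by (rule retraction_closed[OF y])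
  have a: "?a \<in> carrier (chains R E i j)" by (rule linear_mapsD(1)[OF alpha_linear r])
  have b: "?b \<in> carrier (chains R D (i - 2) (j - 4))" by (rule linear_mapsD(1)[OF beta_linear y])
  have s: "?s \<in> carrier (chains R E i j)" by (rule split_map_closed[OF b])
  show "y \<in> carrier (chains R E i j)" by (rule y)
  show "boundary R E (i + 2) j ?h \<oplus>\<^bsub>chains R E i j\<^esub> (?a \<oplus>\<^bsub>chains R E i j\<^esub> ?s) \<in> carrier (chains R E i j)"
    using dh a s by simp
  note [simp del] = hopf_state.simps
  note hb = boundary_hopf[OF h]
  note yc = hopf_generators[THEN chain_E_closed[OF y]]
  note plus = chain_E_plus hopf_generators
  have Xb: "base_action R D e (i - 2) (j - 4) (part (True, True, True) (i - 2) (j - 4) y)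
      = base_action R D e (i - 2) (j - 4) ?b"
    by (rule base_action_cong) (simp add: part_def beta_apply[OF y])
  have alpha: "?a (hopf_state k S) = (if k = (False, False, False) then retraction i j y S else \<zero>)"
    if "S \<in> sector_generators k i j" "k \<in> sectors" for k S
    by (rule alpha_apply[OF r that refl refl])
  {
    fix S assume S: "S \<in> generators D (i - 2) (j - 4)"
    have "boundary R D i (j - 4) (part (True, True, True) i (j - 4) ?h) S = \<zero>"
      by (rule boundary_zero[OF S]) (simp add: part_def homotopy_apply)
    then show "y (hopf_state (True, True, True) S) = (boundary R E (i + 2) j ?h \<oplus>\<^bsub>chains R E i j\<^esub>
        (?a \<oplus>\<^bsub>chains R E i j\<^esub> ?s)) (hopf_state (True, True, True) S)"
      using S yc(1)[OF S] alpha[of S "(True, True, True)"]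
      by (simp add: plus hb sectors_def split_map_apply beta_apply[OF y])
  next
    fix S assume S: "S \<in> generators D (i - 2) j"
    let ?t = "part (True, False, False) i j y"
    have X: "base_action R D e (i - 2) (j - 4) ?b S \<in> carrier R"
      using chain_closed[OF base_action_closed[OF b]] S by simp
    have d: "boundary R D i j ?t S \<in> carrier R"
      by (rule chain_closed[OF boundary_D_closed[OF part_chains(3)[OF y]] S])
    have "boundary R D i j (part (True, True, False) i j ?h) S
        = boundary R D i j (\<lambda>S\<in>generators D i j. marker_sign R S \<otimes> ?t S) S"
      using chain_closed[OF part_chains(3)[OF y]]
      by (intro boundary_cong[OF S]) (simp_all add: part_def homotopy_apply free_module_simps)
    also have "\<dots> = \<ominus> (marker_sign R S \<otimes> boundary R D i j ?t S)"
      by (rule sign_boundary[OF part_chains(3)[OF y] S])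
    also have "\<dots> = base_action R D e (i - 2) (j - 4) ?b S \<oplus> y (hopf_state (True, True, False) S)"
    proof (rule sign_solve[OF _ d])
      have "hopf_state (True, False, False) S \<in> generators E (i - 2) j"
        by (rule hopf_generator[OF S]) simp_all
      then show "marker_sign R S \<otimes> (base_action R D e (i - 2) (j - 4) ?b S \<oplus> y (hopf_state (True, True, False) S))
          \<oplus> boundary R D i j ?t S = \<zero>"
        using cycle boundary_hopf(3)[OF y S] Xb by simp
    qed (use X yc(2)[OF S] in simp)
    finally show "y (hopf_state (True, True, False) S) = (boundary R E (i + 2) j ?h \<oplus>\<^bsub>chains R E i j\<^esub>
        (?a \<oplus>\<^bsub>chains R E i j\<^esub> ?s)) (hopf_state (True, True, False) S)"
      using S yc(2)[OF S] X alpha[of S "(True, True, False)"]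
      by (simp add: plus hb sectors_def split_map_apply a_ac r_neg r_neg1 r_neg2)
  next
    fix S assume S: "S \<in> generators D i j"
    have d: "boundary R D (i + 2) j (part (True, False, False) (i + 2) j ?h) S = \<zero>"
      by (rule boundary_zero) (use S in \<open>simp_all add: part_def homotopy_apply\<close>)
    have X: "base_action R D e i (j - 4) (part (True, True, True) i (j - 4) ?h) S = \<zero>"
      by (rule base_action_zero) (use S in \<open>simp_all add: part_def homotopy_apply\<close>)
    show "y (hopf_state (True, False, False) S) = (boundary R E (i + 2) j ?h \<oplus>\<^bsub>chains R E i j\<^esub>
        (?a \<oplus>\<^bsub>chains R E i j\<^esub> ?s)) (hopf_state (True, False, False) S)"
      using S yc(3)[OF S] alpha[of S "(True, False, False)"]
      by (simp add: plus hb sectors_def split_map_apply homotopy_apply d X)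
    let ?v = "part (False, False, True) (i + 2) j y"
    have S2: "S \<in> generators D (i + 2 - 2) j" using S by simp
    have d: "boundary R D (i + 2) j ?v S \<in> carrier R"
      by (rule chain_closed[OF boundary_D_closed[OF part_chains(5)[OF y]] S2])
    have "boundary R D (i + 2) j (part (False, True, False) (i + 2) j ?h) S
        = boundary R D (i + 2) j (\<lambda>S\<in>generators D (i + 2) j. marker_sign R S \<otimes> ?v S) S"
      using chain_closed[OF part_chains(5)[OF y]]
      by (intro boundary_cong[OF S2]) (simp_all add: part_def homotopy_apply free_module_simps)
    also have "\<dots> = \<ominus> (marker_sign R S \<otimes> boundary R D (i + 2) j ?v S)"
      by (rule sign_boundary[OF part_chains(5)[OF y] S2])
    also have "\<dots> = \<ominus> y (hopf_state (True, False, False) S) \<oplus> y (hopf_state (False, True, False) S)"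
    proof (rule sign_solve[OF _ d])
      have "hopf_state (False, False, True) S \<in> generators E (i - 2) j"
        by (rule hopf_generator[OF S]) simp_all
      then show "marker_sign R S \<otimes> (\<ominus> y (hopf_state (True, False, False) S) \<oplus> y (hopf_state (False, True, False) S))
          \<oplus> boundary R D (i + 2) j ?v S = \<zero>"
        using cycle boundary_hopf(5)[OF y S] by simp
    qed (use yc(3,4)[OF S] in simp)
    finally show "y (hopf_state (False, True, False) S) = (boundary R E (i + 2) j ?h \<oplus>\<^bsub>chains R E i j\<^esub>
        (?a \<oplus>\<^bsub>chains R E i j\<^esub> ?s)) (hopf_state (False, True, False) S)"
      using S yc(3,4)[OF S] alpha[of S "(False, True, False)"]
      by (simp add: plus hb sectors_def split_map_apply homotopy_apply X r_neg r_neg1 r_neg2)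
  next
    fix S assume S: "S \<in> generators D (i + 2) j"
    have d: "boundary R D (4 + i) j (part (False, False, True) (4 + i) j ?h) S = \<zero>"
      by (rule boundary_zero) (use S in \<open>simp_all add: part_def homotopy_apply add.commute\<close>)
    show "y (hopf_state (False, False, True) S) = (boundary R E (i + 2) j ?h \<oplus>\<^bsub>chains R E i j\<^esub>
        (?a \<oplus>\<^bsub>chains R E i j\<^esub> ?s)) (hopf_state (False, False, True) S)"
      using S yc(5)[OF S] alpha[of S "(False, False, True)"]
      by (simp add: plus hb sectors_def split_map_apply homotopy_apply d)
  next
    fix S assume S: "S \<in> generators D (i + 2) (j + 4)"
    let ?v = "part (False, False, True) (i + 2) j y"
    have d: "boundary R D (4 + i) (j + 4) (part (False, False, False) (4 + i) (j + 4) ?h) S = \<zero>"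
      by (rule boundary_zero) (use S in \<open>simp_all add: part_def homotopy_apply add.commute\<close>)
    have X: "base_action R D e (i + 2) j (part (True, False, False) (i + 2) j ?h) S = \<zero>"
      by (rule base_action_zero[OF S]) (simp add: part_def homotopy_apply)
    have v: "base_action R D e (i + 2) j ?v S \<in> carrier R"
      by (rule chain_closed[OF base_action_closed[OF part_chains(5)[OF y]] S])
    have "base_action R D e (i + 2) j (part (False, True, False) (i + 2) j ?h) S
        = marker_sign R S \<otimes> base_action R D e (i + 2) j ?v S"
      using S lower_generators[OF S] by (simp add: base_action_def part_def homotopy_apply)
    then show "y (hopf_state (False, False, False) S) = (boundary R E (i + 2) j ?h \<oplus>\<^bsub>chains R E i j\<^esub>
        (?a \<oplus>\<^bsub>chains R E i j\<^esub> ?s)) (hopf_state (False, False, False) S)"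
      using S yc(6)[OF S] v alpha[of S "(False, False, False)"]
      by (simp add: plus hb sectors_def split_map_apply retraction_def d X minus_eq a_ac r_neg r_neg1 r_neg2)
  }
qed

subsection \<open>Splitting\<close>

lemma retraction_alpha:
  assumes x: "x \<in> carrier (chains R D (i + 2) (j + 4))"
  shows "retraction i j (alpha_chain R D E i j x) = x"
proof (rule chain_D_eqI)
  let ?a = "alpha_chain R D E i j x"
  show "retraction i j ?a \<in> carrier (chains R D (i + 2) (j + 4))"
    by (rule retraction_closed[OF linear_mapsD(1)[OF alpha_linear x]])
  show "x \<in> carrier (chains R D (i + 2) (j + 4))" by (rule x)
  fix S assume S: "S \<in> generators D (i + 2) (j + 4)"
  have "base_action R D e (i + 2) j (part (False, False, True) (i + 2) j ?a) S = \<zero>"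
    by (rule base_action_zero[OF S]) (simp add: part_def alpha_apply[OF x] sectors_def del: hopf_state.simps)
  then show "retraction i j ?a S = x S"
    using S chain_closed[OF x S] by (simp add: retraction_def alpha_apply[OF x S] sectors_def minus_eq del: hopf_state.simps)
qed

lemma beta_split_map:
  assumes x: "x \<in> carrier (chains R D (i - 2) (j - 4))"
  shows "beta_chain R D E i j (split_map i j x) = x"
proof (rule chain_D_eqI)
  show "beta_chain R D E i j (split_map i j x) \<in> carrier (chains R D (i - 2) (j - 4))"
    by (rule linear_mapsD(1)[OF beta_linear split_map_closed[OF x]])
qed (simp_all add: x beta_apply[OF split_map_closed[OF x]] split_map_apply del: hopf_state.simps)

lemma beta_alpha:
  assumes x: "x \<in> carrier (chains R D (i + 2) (j + 4))"
  shows "beta_chain R D E i j (alpha_chain R D E i j x) = \<zero>\<^bsub>chains R D (i - 2) (j - 4)\<^esub>"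
proof (rule chain_D_eqI)
  have a: "alpha_chain R D E i j x \<in> carrier (chains R E i j)" by (rule linear_mapsD(1)[OF alpha_linear x])
  show "beta_chain R D E i j (alpha_chain R D E i j x) \<in> carrier (chains R D (i - 2) (j - 4))"
    by (rule linear_mapsD(1)[OF beta_linear a])
  show "\<zero>\<^bsub>chains R D (i - 2) (j - 4)\<^esub> \<in> carrier (chains R D (i - 2) (j - 4))"
    by (simp add: free_module_simps)
  fix S assume S: "S \<in> generators D (i - 2) (j - 4)"
  then show "beta_chain R D E i j (alpha_chain R D E i j x) S = \<zero>\<^bsub>chains R D (i - 2) (j - 4)\<^esub> S"
    by (simp add: beta_apply[OF a S] alpha_apply[OF x S] sectors_def free_module_simps(2) del: hopf_state.simps)
qed

theorem hopf_splitting: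
  "split_short_exact R
     (khovanov R D (i + 2) (j + 4)) (alpha_h R D E i j)
     (khovanov R E i j) (beta_h R D E i j)
     (khovanov R D (i - 2) (j - 4))
   \<and> isomorphic_modules R
     (khovanov R E i j)
     (direct_sum (khovanov R D (i + 2) (j + 4)) (khovanov R D (i - 2) (j - 4)))"
proof -
  have alpha: "chain_map R (chains R D (i + 2) (j + 4)) (cycles R D (i + 2) (j + 4)) (boundaries R D (i + 2) (j + 4))
      (chains R E i j) (cycles R E i j) (boundaries R E i j) (alpha_chain R D E i j)"
    by (rule khovanov_chain_map[where f_down = "alpha_chain R D E (i - 2) j" and f_up = "alpha_chain R D E (i + 2) j"])
      (use alpha_linear[of i j] alpha_linear[of "i - 2" j] alpha_linear[of "i + 2" j]
        alpha_commute[of _ i j] alpha_commute[of _ "i + 2" j] is_cring in simp_all)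
  have beta: "chain_map R (chains R E i j) (cycles R E i j) (boundaries R E i j)
      (chains R D (i - 2) (j - 4)) (cycles R D (i - 2) (j - 4)) (boundaries R D (i - 2) (j - 4)) (beta_chain R D E i j)"
    by (rule khovanov_chain_map[where f_down = "beta_chain R D E (i - 2) j" and f_up = "beta_chain R D E (i + 2) j"])
      (use beta_linear[of i j] beta_linear[of "i - 2" j] beta_linear[of "i + 2" j]
        beta_commute[of _ i j] beta_commute[of _ "i + 2" j] is_cring in simp_all)
  have retraction: "chain_map R (chains R E i j) (cycles R E i j) (boundaries R E i j)
      (chains R D (i + 2) (j + 4)) (cycles R D (i + 2) (j + 4)) (boundaries R D (i + 2) (j + 4)) (retraction i j)"
    by (rule khovanov_chain_map[where f_down = "retraction (i - 2) j" and f_up = "retraction (i + 2) j"])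
      (use retraction_linear[of i j] retraction_linear[of "i - 2" j] retraction_linear[of "i + 2" j]
        retraction_commute[of _ i j] retraction_commute[of _ "i + 2" j] is_cring in simp_all)
  have split: "chain_map R (chains R D (i - 2) (j - 4)) (cycles R D (i - 2) (j - 4)) (boundaries R D (i - 2) (j - 4))
      (chains R E i j) (cycles R E i j) (boundaries R E i j) (split_map i j)"
    by (rule khovanov_chain_map[where f_down = "split_map (i - 2) j" and f_up = "split_map (i + 2) j"])
      (use split_map_linear[of i j] split_map_linear[of "i - 2" j] split_map_linear[of "i + 2" j]
        split_map_commute[of _ i j] split_map_commute[of _ "i + 2" j] is_cring in simp_all)
  have "\<exists>b\<in>boundaries R E i j. y = b \<oplus>\<^bsub>chains R E i j\<^esub> (alpha_chain R D E i j (retraction i j y)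
      \<oplus>\<^bsub>chains R E i j\<^esub> split_map i j (beta_chain R D E i j y))" if y: "y \<in> cycles R E i j" for y
  proof -
    have "y \<in> carrier (chains R E i j)" using y by (simp add: cycles_def a_kernel_def')
    then have "boundary R E (i + 2) j (homotopy i j y) \<in> boundaries R E i j"
      unfolding boundaries_def using homotopy_closed by blast
    then show ?thesis using cycle_decomposition[OF y] by blast
  qed
  then show ?thesis
    unfolding khovanov_def alpha_h_def beta_h_def induced_def[abs_def]
    by (intro split_exact_homology[OF alpha beta retraction split] retraction_alpha beta_split_map beta_alpha)
qed

end

section \<open>Hopf sums of link diagrams\<close>

lemma link_diagram_diagram:
  assumes "link_diagram D" shows "diagram D"
proof
  show "finite (edges D)" using assms by (simp add: link_diagram_def)
  fix c assume "c \<in> set (crossings D)"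
  then obtain k where k: "k < length (crossings D)" "c = crossings D ! k" by (metis in_set_conv_nth)
  show "set_crossing c \<subseteq> edges D"
  proof
    fix x assume "x \<in> set_crossing c"
    then have "x \<in> set (ends c)" by (cases c) auto
    moreover have "length (ends c) = 4" by (cases c) simp
    ultimately obtain p where "p < 4" "x = ends c ! p" by (metis in_set_conv_nth)
    then have "x = edge_at D (k, p)" "(k, p) \<in> darts D" using k by (auto simp: edge_at_def darts_def)
    then show "x \<in> edges D" using assms unfolding link_diagram_def by blast
  qed
qed

lemma collapse_replace_end:
  assumes "p < 4" "ends c ! p = e"
  shows "map_crossing (collapse e) (replace_end Far p (map_crossing Old c)) = c"
proof -
  have "p \<in> {0, 1, 2, 3}" using assms(1) by auto
  then show ?thesis using assms(2) by (cases c) auto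
qed

lemma set_replace_end: "set_crossing (replace_end Far p (map_crossing Old c)) \<subseteq> insert Far (range Old)"
  by (cases c) auto

lemma hopf_sum_addition:
  assumes D: "link_diagram D" and x: "point_of D x"
  obtains e f cs where "hopf_addition D e (hopf_sum D x v) f v cs"
proof (cases x)
  case (On_circle e)
  have "hopf_addition D e (hopf_sum D x v) (Old e) v (map (map_crossing Old) (crossings D))"
  proof (intro hopf_addition.intro pointed_diagram.intro link_diagram_diagram[OF D]
      pointed_diagram_axioms.intro hopf_addition_axioms.intro)
    have "map_crossing (collapse e) (map_crossing Old c) = c" for c by (cases c) simp
    then show "map_crossing (collapse e) (map (map_crossing Old) (crossings D) ! k) = crossings D ! k"
      if "k < length (crossings D)" for k using that by simp
    show "set_crossing (map (map_crossing Old) (crossings D) ! k) \<subseteq> insert (Old e) (range Old)"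
      if "k < length (crossings D)" for k using that by (auto simp: crossing.set_map)
  qed (use x On_circle in auto)
  then show ?thesis by (rule that)
next
  case (On_edge d)
  obtain k p where d: "d = (k, p)" by (cases d)
  then have kp: "k < length (crossings D)" "p < 4" using x On_edge by (auto simp: darts_def)
  let ?e = "edge_at D (k, p)"
  let ?cs = "(map (map_crossing Old) (crossings D))
      [k := replace_end Far p (map_crossing Old (crossings D ! k))]"
  have "hopf_addition D ?e (hopf_sum D x v) Far v ?cs"
  proof (intro hopf_addition.intro pointed_diagram.intro link_diagram_diagram[OF D]
      pointed_diagram_axioms.intro hopf_addition_axioms.intro)
    show "?e \<in> edges D" using D x On_edge d by (auto simp: link_diagram_def)
    have old: "map_crossing (collapse ?e) (map_crossing Old c) = c" for c by (cases c) simp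
    show "map_crossing (collapse ?e) (?cs ! l) = crossings D ! l" if "l < length (crossings D)" for l
      using that kp old collapse_replace_end[OF kp(2), of "crossings D ! k" ?e]
      by (cases "l = k") (simp_all add: edge_at_def)
    show "set_crossing (?cs ! l) \<subseteq> insert Far (range Old)" if "l < length (crossings D)" for l
      using that kp set_replace_end[of p "crossings D ! k"]
      by (cases "l = k") (auto simp: crossing.set_map)
  qed (use x On_edge d in auto)
  then show ?thesis by (rule that)
qed

theorem theorem6p2:
  fixes R :: "('r, 'm) ring_scheme" and D :: "'e diagram" and x :: "'e point" and v :: bool
    and i j :: int
  assumes "cring R" and "link_diagram D" and "point_of D x"
  defines "E \<equiv> hopf_sum D x v"
  shows "split_short_exact R
           (khovanov R D (i + 2) (j + 4)) (alpha_h R D E i j)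
           (khovanov R E i j) (beta_h R D E i j)
           (khovanov R D (i - 2) (j - 4))
       \<and> isomorphic_modules R
           (khovanov R E i j)
           (direct_sum (khovanov R D (i + 2) (j + 4)) (khovanov R D (i - 2) (j - 4)))"
proof -
  obtain e f cs where "hopf_addition D e (hopf_sum D x v) f v cs"
    using hopf_sum_addition[OF assms(2,3)] .
  then interpret hopf_addition D e E f v cs unfolding E_def .
  interpret R: cring R by fact
  interpret hopf_chains D e E f v cs R ..
  show ?thesis by (rule hopf_splitting)
qed

end
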